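(* Let $\delta\ge 2$ be an integer, $L>0$, $0<\gamma<1$, and $x_0\in\mathbb{R}^\delta$ with $\Vert x_0\Vert<L$. Let $(X(n),T(n))_{n\ge 0}$ be the walk on moving spheres with parameter $\gamma$, started at $x_0$, in the ball of $\mathbb{R}^\delta$ centred at $0$ of radius $L$, built along the $\delta$-dimensional Brownian motion $B^{\delta,x_0}$ started at $x_0$. For $\varepsilon>0$ let $N_\varepsilon=\inf\{n\ge 0:\ \Vert X(n)\Vert\ge L-\varepsilon\}$ be the number of steps of the algorithm. Then: 1. There exist constants $C_\delta>0$ and $\varepsilon_0(\delta)>0$ such that $$\mathbb{E}[N_\varepsilon]\le C_\delta\,|\ln(\varepsilon)|\qquad\text{for any } \varepsilon\le\varepsilon_0(\delta).$$ 2. As $\varepsilon\to 0$, the couple $(X(N_\varepsilon),T(N_\varepsilon))$ converges in probability towards the couple $(B^{\delta,x_0}_\tau,\tau)$, where $\tau=\inf\{t>0:\ \Vert B^{\delta,x_0}_t\Vert=L\}$ is the Brownian exit time from the ball centred at $0$ of radius $L$.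
   Context: Set $\nu=\frac{\delta}{2}-1$; $\Vert\cdot\Vert$ is the Euclidean norm. The data $\delta, L,\gamma,x_0$ are fixed, and $0<\varepsilon<1$. For $a>0$, define the curved boundary $$\psi_a(t)=\sqrt{2t\ln\frac{a}{\Gamma(\nu+1)\,t^{\nu+1}\,2^{\nu}}},\qquad 0<t\le t_a:=\Big(\frac{a}{\Gamma(\nu+1)2^\nu}\Big)^{\frac1{\nu+1}},\qquad \psi_a(0)=0.$$ Walk on moving spheres, built along the Brownian motion $B=B^{\delta,x_0}$: the chain $X(n)$ represents the Brownian position at random times $T(n)$. Set $X(0)=x_0$, $T(0)=0$. For $n\ge 1$, let $$a_{n-1}=\Big(\frac{\gamma^2(L-\Vert X(n-1)\Vert)^2\,e}{\nu+1}\Big)^{\nu+1}\frac{\Gamma(\nu+1)}{2},$$ let $$R(n)=\inf\{t>0:\ \Vert B_{T(n-1)+t}-X(n-1)\Vert=\psi_{a_{n-1}}(t)\},$$ and set $T(n)=T(n-1)+R(n)$, $X(n)=B_{T(n)}$. (The maximum of $\psi_{a_{n-1}}$ is $\gamma(L-\Vert X(n-1)\Vert)$, so the moving sphere centred at $X(n-1)$ stays inside the ball of radius $L$.) Sampling form of the same chain: the sequence $(X(n),T(n))_n$ has the law of the one generated by $$R(n)=\Big(\frac{a_{n-1}}{\Gamma(\nu+1)2^\nu}\,U_n(1)\cdots U_n(\lfloor\nu\rfloor+2)\Big)^{\frac1{\nu+1}}\exp\Big\{-\frac{\nu-\lfloor\nu\rfloor}{\nu+1}\,G_n^2\Big\},$$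 $$T(n)=T(n-1)+R(n),\qquad X(n)=X(n-1)+\psi_{a_{n-1}}(R(n))\,V_n,$$ where $U_n$ is uniform on $[0,1]^{\lfloor\nu\rfloor+2}$, $G_n$ is standard Gaussian, $V_n$ is uniform on the unit sphere of $\mathbb{R}^\delta$ centred at the origin, and all of these are independent of each other and across $n$. The algorithm stops at the first $n$ for which $\Vert X(n)\Vert\ge L-\varepsilon$, and its outcome is $(X(n),T(n))$ for this $n$. *)

theory Defs
  imports "HOL-Probability.Probability"
begin

section \<open>Brownian motion in $\mathbb{R}^\delta$\<close>

text \<open>
  The time set is \<open>{0..}\<close>; nothing is required of \<open>B t\<close> for negative \<open>t\<close>.
  The density in \<open>gaussian_increments\<close> is that of the centred Gaussian law with covariance
  matrix \<open>(t - s)\<close> times the identity.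
\<close>

locale brownian_motion = prob_space M
  for M :: "'w measure" +
  fixes B :: "real \<Rightarrow> 'w \<Rightarrow> real ^ 'd" and x0 :: "real ^ 'd"
  assumes random_variable: "\<And>t. 0 \<le> t \<Longrightarrow> B t \<in> borel_measurable M"
    and start: "AE \<omega> in M. B 0 \<omega> = x0"
    and continuous_paths: "\<And>\<omega>. \<omega> \<in> space M \<Longrightarrow> continuous_on {0..} (\<lambda>t. B t \<omega>)"
    and independent_increments:
      "\<And>(t :: nat \<Rightarrow> real) n. 0 \<le> t 0 \<Longrightarrow> mono t \<Longrightarrow>
         indep_vars (\<lambda>_. borel) (\<lambda>i \<omega>. B (t (Suc i)) \<omega> - B (t i) \<omega>) {..<n}"
    and gaussian_increments:
      "\<And>s t. 0 \<le> s \<Longrightarrow> s < t \<Longrightarrow>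
         distributed M lborel (\<lambda>\<omega>. B t \<omega> - B s \<omega>)
           (\<lambda>x. ennreal (\<Prod>i\<in>UNIV. normal_density 0 (sqrt (t - s)) (x $ i)))"

section \<open>Moving spheres\<close>

definition bessel_index :: "nat \<Rightarrow> real" where
  "bessel_index \<delta> = real \<delta> / 2 - 1"

definition sphere_lifetime :: "nat \<Rightarrow> real \<Rightarrow> real" where
  "sphere_lifetime \<delta> a =
     (let \<nu> = bessel_index \<delta> in (a / (Gamma (\<nu> + 1) * 2 powr \<nu>)) powr (1 / (\<nu> + 1)))"

text \<open>The curved boundary $\psi_a$; it is only used on \<open>{0..sphere_lifetime \<delta> a}\<close>.\<close>

definition sphere_radius :: "nat \<Rightarrow> real \<Rightarrow> real \<Rightarrow> real" where
  "sphere_radius \<delta> a t =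
     (let \<nu> = bessel_index \<delta>
      in sqrt (2 * t * ln (a / (Gamma (\<nu> + 1) * t powr (\<nu> + 1) * 2 powr \<nu>))))"

definition sphere_size :: "real \<Rightarrow> real \<Rightarrow> real ^ 'd \<Rightarrow> real" where
  "sphere_size L \<gamma> x =
     (let \<nu> = bessel_index CARD('d)
      in (\<gamma>\<^sup>2 * (L - norm x)\<^sup>2 * exp 1 / (\<nu> + 1)) powr (\<nu> + 1) * Gamma (\<nu> + 1) / 2)"

text \<open>
  Infimum of a set of times. Every set to which it is applied below is nonempty almost surely.
  The value \<open>0\<close> on the remaining null event is an arbitrary choice; it keeps all random times
  real, nonnegative and measurable.
\<close>

definition first_time :: "real set \<Rightarrow> real" where
  "first_time S = (if S = {} then 0 else Inf S)"

section \<open>The walk on moving spheres along a path\<close>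

text \<open>
  \<open>wms\<close> gives the pair of position and time after \<open>n\<close> steps. Its argument \<open>w\<close> is a single path
  \<open>t \<mapsto> B t \<omega>\<close>. The walk starts at \<open>x0\<close>, which is \<open>w 0\<close> almost surely.
\<close>

definition sphere_exit :: "real \<Rightarrow> real \<Rightarrow> (real \<Rightarrow> real ^ 'd) \<Rightarrow> real ^ 'd \<Rightarrow> real \<Rightarrow> real" where
  "sphere_exit L \<gamma> w x s =
     (let a = sphere_size L \<gamma> x
      in first_time {t. 0 < t \<and> t \<le> sphere_lifetime CARD('d) a \<and>
                        norm (w (s + t) - x) = sphere_radius CARD('d) a t})"

primrec wms :: "real \<Rightarrow> real \<Rightarrow> real ^ 'd \<Rightarrow> (real \<Rightarrow> real ^ 'd) \<Rightarrow> nat \<Rightarrow> (real ^ 'd) \<times> real" where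
  "wms L \<gamma> x0 w 0 = (x0, 0)"
| "wms L \<gamma> x0 w (Suc n) =
     (let (x, s) = wms L \<gamma> x0 w n; s' = s + sphere_exit L \<gamma> w x s in (w s', s'))"

text \<open>The value is \<open>\<infinity>\<close> if the walk never gets within \<open>\<epsilon>\<close> of the boundary.\<close>

definition wms_steps ::
  "real \<Rightarrow> real \<Rightarrow> real ^ 'd \<Rightarrow> (real \<Rightarrow> real ^ 'd) \<Rightarrow> real \<Rightarrow> enat" where
  "wms_steps L \<gamma> x0 w \<epsilon> =
     (INF n \<in> {n. norm (fst (wms L \<gamma> x0 w n)) \<ge> L - \<epsilon>}. enat n)"

text \<open>\<open>the_enat \<infinity>\<close> is a fixed unspecified number; it only matters on a null event.\<close>

definition wms_outcome ::
  "real \<Rightarrow> real \<Rightarrow> real ^ 'd \<Rightarrow> (real \<Rightarrow> real ^ 'd) \<Rightarrow> real \<Rightarrow> (real ^ 'd) \<times> real" where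
  "wms_outcome L \<gamma> x0 w \<epsilon> = wms L \<gamma> x0 w (the_enat (wms_steps L \<gamma> x0 w \<epsilon>))"

definition ball_exit_time :: "real \<Rightarrow> (real \<Rightarrow> real ^ 'd) \<Rightarrow> real" where
  "ball_exit_time L w = first_time {t. 0 < t \<and> norm (w t) = L}"

section \<open>Convergence in probability\<close>

text \<open>
  Measurability is part of the notion: \<open>measure\<close> is \<open>0\<close> on non-measurable sets, so without it
  the limit could hold vacuously.
\<close>

definition converges_in_probability ::
  "'w measure \<Rightarrow> ('i \<Rightarrow> 'w \<Rightarrow> 'b :: metric_space) \<Rightarrow> ('w \<Rightarrow> 'b) \<Rightarrow> 'i filter \<Rightarrow> bool" where
  "converges_in_probability M Y Z F \<longleftrightarrow>
     (\<forall>\<^sub>F i in F. Y i \<in> borel_measurable M) \<and> Z \<in> borel_measurable M \<and>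
     (\<forall>\<eta>>0. ((\<lambda>i. measure M {\<omega> \<in> space M. dist (Y i \<omega>) (Z \<omega>) > \<eta>}) \<longlongrightarrow> 0) F)"

end

theory Submission
  imports Defs
begin

text \<open>
  Write \<open>D\<^sub>n = L - \<parallel>X\<^sub>n\<parallel>\<close>, \<open>e\<^sub>n\<close> for the unit vector in the direction of \<open>X\<^sub>n\<close>, and
  \<open>y\<^sub>n = \<langle>e\<^sub>n, X\<^sub>n\<^sub>+\<^sub>1 - X\<^sub>n\<rangle> / D\<^sub>n\<close>. By Cauchy-Schwarz \<open>D\<^sub>n\<^sub>+\<^sub>1 \<le> D\<^sub>n (1 - y\<^sub>n)\<close>, and
  \<open>\<bar>y\<^sub>n\<bar> \<le> \<gamma> < 1\<close>, so \<open>ln D\<^sub>n\<^sub>+\<^sub>1 - ln D\<^sub>n \<le> - y\<^sub>n - y\<^sub>n\<^sup>2 / 8\<close>. Given the past, optional stopping shows that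
  \<open>y\<^sub>n\<close> is centred and that the mean of \<open>y\<^sub>n\<^sup>2\<close> is proportional to that of the fraction of the
  maximal lifetime of the sphere used by the step, which is bounded below because Brownian
  motion is unlikely to leave the moving sphere at small times (a fourth-power maximal inequality
  on dyadic blocks). Hence \<open>ln D\<^sub>n\<close> decreases on average by a fixed amount per step until
  \<open>D\<^sub>n \<le> \<epsilon>\<close>, and the number of steps has mean \<open>O(\<bar>ln \<epsilon>\<bar>)\<close>.

  The times \<open>T\<^sub>n\<close> increase, and their means are bounded since \<open>\<parallel>B\<parallel>\<close> stays below \<open>L\<close>. Their limit is finite,
  the path is on the sphere of radius \<open>L\<close> at the limit because \<open>D\<^sub>n\<close> comes arbitrarily close to \<open>0\<close>, and it is
  inside the ball before. So the limit is the exit time, and the convergence in part 2 holds almost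
  surely.
\<close>

section \<open>The walk along a continuous path\<close>

text \<open>No strong Markov property is established. Conditioning at a random time is expressed by
  weights instead: \<open>optional_stopping\<close> carries a bounded factor \<open>h\<close> known
  at the earlier time, and the small-time estimate compares \<open>prob (A \<inter> Bad)\<close>
  with \<open>prob A\<close> for every event A known at that time. Both come from deterministic grid
  times by a limit. Every moving sphere is one fixed profile rescaled by the distance of its centre
  to the boundary. Dividing a step by that distance therefore leaves constants that are the same
  wherever the walk is. Fourth powers enter twice. On the block of scale 2^-k a second-moment bound
  would give probabilities of order 1/k, which are not summable, against 1/k^2 for fourth moments.
  Moreover, fourth moments bounded uniformly over the grids make the products of two coordinates
  uniformly integrable. The logarithm of the distance has no lower bound near the boundary, but a
  step keeps at least the fraction 1 - \<gamma> of the distance, so the step that passes the level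
  \<epsilon> still ends above (1 - \<gamma>) \<epsilon>.\<close>

lemma bessel_index_plus_one: "bessel_index \<delta> + 1 = real \<delta> / 2"
  by (simp add: bessel_index_def)

text \<open>The curved boundary with time in units of its lifetime and radius in units of its
  maximum. The factor \<open>exp 1\<close> normalises the maximum, attained at u = 1/e, to
  1.\<close>

definition profile :: "real \<Rightarrow> real" where
  "profile u = sqrt (exp 1 * u * ln (1 / u))"

text \<open>The lifetime of the boundary for the size used at x, freed of Gamma functions;
  \<open>sphere_lifetime_eq\<close> identifies the two.\<close>

definition lifespan :: "real \<Rightarrow> real \<Rightarrow> real ^ 'd \<Rightarrow> real" where
  "lifespan L \<gamma> x = exp 1 / real CARD('d) * (\<gamma> * (L - norm x))\<^sup>2"

lemma lifespan_nonneg: "0 \<le> lifespan L \<gamma> x"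
  by (simp add: lifespan_def)

lemma profile_one [simp]: "profile 1 = 0"
  by (simp add: profile_def)

lemma profile_nonneg: "0 < u \<Longrightarrow> u \<le> 1 \<Longrightarrow> 0 \<le> profile u"
  by (simp add: profile_def)

text \<open>The bound \<open>ln (1 + y) \<le> y\<close> at \<open>y = 1 / (exp 1 * u) - 1\<close>,
  so that equality falls on the time u = 1/e of maximal radius.\<close>

lemma profile_le_one: "0 < u \<Longrightarrow> profile u \<le> 1"
  using ln_add_one_self_le_self2[of "1 / (exp 1 * u) - 1"]
  by (simp add: profile_def ln_div ln_mult field_simps)

lemma continuous_on_profile: "continuous_on {0<..} profile"
  unfolding profile_def by (intro continuous_intros) auto

text \<open>The Gamma factors cancel, and the 1/2 inside \<open>sphere_size\<close> raises
  \<open>2 powr \<nu>\<close> to \<open>2 powr (\<nu> + 1)\<close>, leaving a pure power. Lifetime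
  and radius both depend on the size only through this quotient.\<close>

lemma sphere_size_ratio:
  fixes x :: "real ^ 'd"
  shows "sphere_size L \<gamma> x / (Gamma (bessel_index CARD('d) + 1) * 2 powr bessel_index CARD('d))
    = lifespan L \<gamma> x powr (real CARD('d) / 2)"
proof -
  define p where "p = real CARD('d) / 2"
  have p: "p > 0" by (simp add: p_def)
  have nu: "bessel_index CARD('d) = p - 1" by (simp add: bessel_index_def p_def)
  define y where "y = \<gamma>\<^sup>2 * (L - norm x)\<^sup>2 * exp 1 / p"
  have y: "y \<ge> 0" using p by (simp add: y_def)
  have life: "lifespan L \<gamma> x = y / 2"
    unfolding lifespan_def y_def p_def power_mult_distrib by simp
  have g: "Gamma p \<noteq> 0" using p by (metis Gamma_real_pos less_irrefl)
  have size: "sphere_size L \<gamma> x = y powr p * Gamma p / 2"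
    unfolding sphere_size_def Let_def nu y_def by simp
  have two: "2 * 2 powr (p - 1) = (2::real) powr p"
    by (simp add: powr_diff)
  then have "sphere_size L \<gamma> x / (Gamma p * 2 powr (p - 1)) = y powr p / 2 powr p"
    using g by (simp add: size two[symmetric])
  also have "\<dots> = (y / 2) powr p" using y by (simp add: powr_divide)
  finally show ?thesis by (simp add: life nu p_def)
qed

lemma sphere_lifetime_eq:
  fixes x :: "real ^ 'd"
  shows "sphere_lifetime CARD('d) (sphere_size L \<gamma> x) = lifespan L \<gamma> x"
proof -
  have "sphere_lifetime CARD('d) (sphere_size L \<gamma> x)
      = (lifespan L \<gamma> x powr (real CARD('d) / 2)) powr (1 / (real CARD('d) / 2))"
    unfolding sphere_lifetime_def Let_def sphere_size_ratio
    unfolding bessel_index_plus_one ..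
  also have "\<dots> = lifespan L \<gamma> x"
    using lifespan_nonneg[of L \<gamma> x] by (simp add: powr_powr)
  finally show ?thesis .
qed

text \<open>In units of the lifetime the argument of the logarithm is a power of 1/u alone, so the
  centre enters only through the prefactor. The absolute value lets the identity hold for centres
  outside the ball too.\<close>

lemma sphere_radius_eq:
  fixes x :: "real ^ 'd"
  assumes "0 < u" "lifespan L \<gamma> x > 0"
  shows "sphere_radius CARD('d) (sphere_size L \<gamma> x) (u * lifespan L \<gamma> x)
    = \<bar>\<gamma> * (L - norm x)\<bar> * profile u"
proof -
  define p where "p = real CARD('d) / 2"
  have p: "p > 0" by (simp add: p_def)
  let ?l = "lifespan L \<gamma> x"
  let ?nu = "bessel_index CARD('d)"
  have "sphere_size L \<gamma> x / (Gamma (?nu + 1) * (u * ?l) powr (?nu + 1) * 2 powr ?nu)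
     = sphere_size L \<gamma> x / (Gamma (?nu + 1) * 2 powr ?nu) / (u * ?l) powr p"
    by (simp add: bessel_index_plus_one p_def)
  also have "\<dots> = (1 / u) powr p"
    using assms by (simp add: sphere_size_ratio p_def powr_mult powr_divide)
  finally have "sphere_radius CARD('d) (sphere_size L \<gamma> x) (u * ?l)
      = sqrt (2 * (u * ?l) * (p * ln (1 / u)))"
    using assms by (simp add: sphere_radius_def Let_def ln_powr)
  also have "2 * (u * ?l) * (p * ln (1 / u)) = (\<gamma> * (L - norm x))\<^sup>2 * (exp 1 * u * ln (1 / u))"
    using p by (simp add: lifespan_def p_def)
  also have "sqrt \<dots> = \<bar>\<gamma> * (L - norm x)\<bar> * profile u"
    by (simp add: real_sqrt_mult profile_def)
  finally show ?thesis .
qed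

text \<open>Time runs in units of the lifetime, so that (0, 1] is the search window for every centre
  and small crossing fractions can be bounded uniformly over the steps.\<close>

definition cross_frac :: "real \<Rightarrow> real \<Rightarrow> (real \<Rightarrow> real ^ 'd) \<Rightarrow> real ^ 'd \<Rightarrow> real \<Rightarrow> real" where
  "cross_frac L \<gamma> w x s = Inf {u. 0 < u \<and> u \<le> 1 \<and>
     \<gamma> * (L - norm x) * profile u \<le> norm (w (s + u * lifespan L \<gamma> x) - x)}"

text \<open>Unlike \<open>wms\<close>, this walk uses the set of times at which the path is outside the moving
  sphere. That set is never empty, which makes all its times adapted to the past of the path; the
  two walks agree as soon as the path enters every moving sphere immediately.\<close>

primrec walk :: "real \<Rightarrow> real \<Rightarrow> real ^ 'd \<Rightarrow> (real \<Rightarrow> real ^ 'd) \<Rightarrow> nat \<Rightarrow> (real ^ 'd) \<times> real" where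
  "walk L \<gamma> x0 w 0 = (x0, 0)"
| "walk L \<gamma> x0 w (Suc n) =
     (let (x, s) = walk L \<gamma> x0 w n; s' = s + lifespan L \<gamma> x * cross_frac L \<gamma> w x s in (w s', s'))"

abbreviation "wpos L \<gamma> x0 w n \<equiv> fst (walk L \<gamma> x0 w n)"
abbreviation "wtime L \<gamma> x0 w n \<equiv> snd (walk L \<gamma> x0 w n)"

lemma wtime_Suc: "wtime L \<gamma> x0 w (Suc n) = wtime L \<gamma> x0 w n +
    lifespan L \<gamma> (wpos L \<gamma> x0 w n) * cross_frac L \<gamma> w (wpos L \<gamma> x0 w n) (wtime L \<gamma> x0 w n)"
  by (simp add: Let_def split: prod.split)

lemma wpos_eq: "w 0 = x0 \<Longrightarrow> wpos L \<gamma> x0 w n = w (wtime L \<gamma> x0 w n)"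
  by (cases n) (simp_all add: Let_def split: prod.split)

declare walk.simps(2) [simp del]

text \<open>The radius has shrunk to 0 at the end of the lifetime, so \<open>u = 1\<close> always
  qualifies.\<close>

lemma cross_set_nonempty:
  "{u. 0 < u \<and> u \<le> 1 \<and> \<gamma> * (L - norm x) * profile u \<le> norm (w (s + u * lifespan L \<gamma> x) - x)} \<noteq> {}"
proof -
  have "1 \<in> {u. 0 < u \<and> u \<le> 1 \<and> \<gamma> * (L - norm x) * profile u \<le> norm (w (s + u * lifespan L \<gamma> x) - x)}"
    by simp
  then show ?thesis by blast
qed

lemma cross_frac_bounds: "0 \<le> cross_frac L \<gamma> w x s" "cross_frac L \<gamma> w x s \<le> 1"
proof -
  let ?U = "{u. 0 < u \<and> u \<le> 1 \<and> \<gamma> * (L - norm x) * profile u \<le> norm (w (s + u * lifespan L \<gamma> x) - x)}"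
  have bdd: "bdd_below ?U" by (auto intro: bdd_belowI[of _ 0])
  show "0 \<le> cross_frac L \<gamma> w x s"
    unfolding cross_frac_def by (rule cInf_greatest[OF cross_set_nonempty]) auto
  show "cross_frac L \<gamma> w x s \<le> 1"
    unfolding cross_frac_def by (rule cInf_lower[OF _ bdd]) simp
qed

lemma inside_before_cross:
  assumes "0 < u" "u < cross_frac L \<gamma> w x s"
  shows "norm (w (s + u * lifespan L \<gamma> x) - x) < \<gamma> * (L - norm x) * profile u"
proof (rule ccontr)
  let ?U = "{u. 0 < u \<and> u \<le> 1 \<and> \<gamma> * (L - norm x) * profile u \<le> norm (w (s + u * lifespan L \<gamma> x) - x)}"
  have bdd: "bdd_below ?U" by (auto intro: bdd_belowI[of _ 0])
  assume "\<not> ?thesis"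
  then have "u \<in> ?U" using assms cross_frac_bounds(2)[of L \<gamma> w x s] by auto
  from cInf_lower[OF this bdd] assms show False by (simp add: cross_frac_def)
qed

lemma continuous_on_gap:
  fixes w :: "real \<Rightarrow> real ^ 'd"
  assumes "continuous_on {0..} w" "0 \<le> s"
  shows "continuous_on {0<..} (\<lambda>u. c * profile u - norm (w (s + u * lifespan L \<gamma> x) - x))"
proof -
  have "continuous_on {0<..} (\<lambda>u. w (s + u * lifespan L \<gamma> x))"
    by (rule continuous_on_compose2[OF assms(1)])
       (use assms lifespan_nonneg[of L \<gamma> x] in \<open>auto intro!: continuous_intros\<close>)
  then show ?thesis
    by (intro continuous_intros continuous_on_profile)
qed

text \<open>Continuity from both sides: a path strictly inside at the infimum would stay inside for
  a while, and a path strictly outside would contradict the left limit of inside positions. A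
  crossing at fraction 0 has no such left neighbourhood, hence the positivity.\<close>

lemma on_sphere_at_cross:
  fixes w :: "real \<Rightarrow> real ^ 'd"
  assumes w: "continuous_on {0..} w" "0 \<le> s" and pos: "0 < cross_frac L \<gamma> w x s"
  shows "norm (w (s + cross_frac L \<gamma> w x s * lifespan L \<gamma> x) - x)
    = \<gamma> * (L - norm x) * profile (cross_frac L \<gamma> w x s)"
proof -
  let ?U = "{u. 0 < u \<and> u \<le> 1 \<and> \<gamma> * (L - norm x) * profile u \<le> norm (w (s + u * lifespan L \<gamma> x) - x)}"
  let ?c = "cross_frac L \<gamma> w x s"
  let ?g = "\<lambda>u. \<gamma> * (L - norm x) * profile u - norm (w (s + u * lifespan L \<gamma> x) - x)"
  have bdd: "bdd_below ?U" by (auto intro: bdd_belowI[of _ 0])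
  have cont: "isCont ?g ?c"
    using continuous_on_gap[OF w, of "\<gamma> * (L - norm x)" L \<gamma> x] pos
    by (simp add: continuous_on_eq_continuous_at)
  have "?g ?c \<le> 0"
  proof (rule ccontr)
    assume "\<not> ?g ?c \<le> 0"
    then have "\<forall>\<^sub>F u in nhds ?c. ?g u > 0"
      using cont tendsto_at_iff_tendsto_nhds[of ?g ?c]
      by (intro order_tendstoD(1)[of _ "?g ?c"]) (auto simp: isCont_def)
    then obtain e where e: "e > 0" "\<And>u. dist u ?c < e \<Longrightarrow> ?g u > 0"
      unfolding eventually_nhds_metric by auto
    from e(1) have "Inf ?U < ?c + e" by (simp add: cross_frac_def)
    then obtain u where u: "u \<in> ?U" "u < ?c + e"
      using cInf_lessD[OF cross_set_nonempty] by blast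
    moreover have "?c \<le> u" using cInf_lower[OF u(1) bdd] by (simp add: cross_frac_def)
    ultimately show False using e(2)[of u] by (auto simp: dist_real_def)
  qed
  moreover have "0 \<le> ?g ?c"
  proof (rule tendsto_lowerbound[where F="at_left ?c"])
    show "(?g \<longlongrightarrow> ?g ?c) (at_left ?c)"
      using cont unfolding isCont_def by (rule filterlim_mono) (auto simp: at_le)
    show "\<forall>\<^sub>F u in at_left ?c. 0 \<le> ?g u"
      using eventually_at_left_real[OF pos]
      by eventually_elim (use inside_before_cross[of _ L \<gamma> w x s] in force)
  qed simp
  ultimately show ?thesis by simp
qed

section \<open>Invariants of the walk along one fixed path\<close>

locale anchored_path =
  fixes L \<gamma> :: real and x0 :: "real ^ 'd" and w :: "real \<Rightarrow> real ^ 'd"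
  assumes gamma: "0 < \<gamma>" "\<gamma> < 1" and inside: "norm x0 < L"
    and cont: "continuous_on {0..} w" and anchored: "w 0 = x0"
begin

abbreviation "X n \<equiv> wpos L \<gamma> x0 w n"
abbreviation "T n \<equiv> wtime L \<gamma> x0 w n"
abbreviation "\<rho> n \<equiv> cross_frac L \<gamma> w (X n) (T n)"

lemma time_nonneg: "0 \<le> T n"
  by (induction n)
     (simp_all add: wtime_Suc lifespan_nonneg cross_frac_bounds)

lemma pos_eq: "X n = w (T n)"
  using wpos_eq[where w = w, OF anchored] .

text \<open>When the crossing fraction is 0 the walk stands still, so the bound holds for every path
  and not only for those that enter each sphere.\<close>

lemma step_bound_of_inside:
  assumes "norm (X n) < L"
  shows "norm (X (Suc n) - X n) \<le> \<gamma> * (L - norm (X n))"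
proof (cases "\<rho> n = 0")
  case True
  then show ?thesis
    using assms gamma by (simp add: pos_eq wtime_Suc)
next
  case False
  then have pos: "0 < \<rho> n" using cross_frac_bounds(1)[of L \<gamma> w "X n" "T n"] by linarith
  have "norm (X (Suc n) - X n) = \<gamma> * (L - norm (X n)) * profile (\<rho> n)"
    using on_sphere_at_cross[OF cont time_nonneg[of n] pos]
    by (simp add: pos_eq[of "Suc n"] wtime_Suc mult.commute)
  also have "\<dots> \<le> \<gamma> * (L - norm (X n)) * 1"
    using assms gamma profile_le_one[OF pos] by (intro mult_left_mono) auto
  finally show ?thesis by simp
qed

lemma pos_inside: "norm (X n) < L"
proof (induction n)
  case 0
  then show ?case using inside by simp
next
  case (Suc n)
  have "norm (X (Suc n)) \<le> norm (X n) + norm (X (Suc n) - X n)"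
    by (metis norm_triangle_sub)
  also have "\<dots> \<le> norm (X n) + \<gamma> * (L - norm (X n))"
    using step_bound_of_inside[OF Suc] by simp
  also have "\<dots> < norm (X n) + 1 * (L - norm (X n))"
    using Suc gamma by (intro add_strict_left_mono mult_strict_right_mono) auto
  finally show ?case by simp
qed

lemmas step_bound = step_bound_of_inside[OF pos_inside]

lemma lifespan_pos: "0 < lifespan L \<gamma> (X n)"
  using pos_inside[of n] gamma by (simp add: lifespan_def)

lemma time_step: "T n \<le> T (Suc n)" "T (Suc n) \<le> T n + lifespan L \<gamma> (X n)"
  using cross_frac_bounds[of L \<gamma> w "X n" "T n"] lifespan_pos[of n]
  by (simp_all add: wtime_Suc mult_left_le)

lemma time_mono: "mono T"
  by (rule incseq_SucI) (rule time_step)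

text \<open>Crude, but deterministic: \<open>optional_stopping\<close> asks for times bounded by a
  constant.\<close>

lemma time_bound: "T n \<le> real n * (exp 1 / real CARD('d) * L\<^sup>2)"
proof (induction n)
  case (Suc n)
  have L: "0 < L" using inside norm_ge_zero[of x0] by linarith
  have "\<gamma> * (L - norm (X n)) \<le> 1 * L"
    using gamma pos_inside[of n] L by (intro mult_mono) auto
  then have "lifespan L \<gamma> (X n) \<le> exp 1 / real CARD('d) * L\<^sup>2"
    unfolding lifespan_def using gamma pos_inside[of n] by (intro mult_left_mono power_mono) auto
  then show ?case using time_step(2)[of n] Suc by (simp add: algebra_simps add_divide_distrib)
qed simp

definition enters :: bool where
  "enters \<longleftrightarrow> (\<forall>n. 0 < \<rho> n)"

text \<open>The path up to \<open>T n\<close> is covered by n moving spheres, each of radius at most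
  \<gamma> times the distance of its centre to the boundary and so strictly inside the ball. This
  excludes an earlier exit in \<open>ball_exit_time_eq\<close>.\<close>

lemma inside_until:
  assumes enters and "T 0 < t" "t \<le> T n"
  shows "norm (w t) < L"
  using assms(2-)
proof (induction n)
  case (Suc n)
  show ?case
  proof (cases "t \<le> T n")
    case True
    then show ?thesis using Suc by blast
  next
    case False
    define u where "u = (t - T n) / lifespan L \<gamma> (X n)"
    have u: "0 < u" "t = T n + u * lifespan L \<gamma> (X n)"
      using False lifespan_pos[of n] by (auto simp: u_def)
    have "u * lifespan L \<gamma> (X n) \<le> \<rho> n * lifespan L \<gamma> (X n)"
      using Suc.prems u by (simp add: wtime_Suc mult.commute)
    then have "u \<le> \<rho> n" using lifespan_pos[of n] by simp
    then have "norm (w t - X n) \<le> \<gamma> * (L - norm (X n)) * profile u"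
      using inside_before_cross[OF u(1), of L \<gamma> w "X n" "T n"]
        on_sphere_at_cross[OF cont time_nonneg, where n1 = n and L = L and \<gamma> = \<gamma> and x = "X n"] u
      by (cases "u = \<rho> n") auto
    also have "\<dots> \<le> \<gamma> * (L - norm (X n)) * 1"
      using pos_inside[of n] gamma profile_le_one[OF u(1)] by (intro mult_left_mono) auto
    also have "\<dots> < 1 * (L - norm (X n))"
      using pos_inside[of n] gamma by simp
    finally have "norm (w t - X n) < L - norm (X n)" by simp
    then show ?thesis using norm_triangle_sub[of "w t" "X n"] by linarith
  qed
qed simp

text \<open>The set in \<open>sphere_exit\<close> asks for equality with the radius, the one in
  \<open>cross_frac\<close> for an inequality. At a positive crossing fraction both have the same
  least element, since the path is strictly inside earlier and on the sphere then.\<close>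

lemma sphere_exit_eq:
  assumes pos: "0 < \<rho> n"
  shows "sphere_exit L \<gamma> w (X n) (T n) = lifespan L \<gamma> (X n) * \<rho> n"
proof -
  let ?l = "lifespan L \<gamma> (X n)"
  let ?H = "{t. 0 < t \<and> t \<le> ?l \<and> norm (w (T n + t) - X n) = sphere_radius CARD('d) (sphere_size L \<gamma> (X n)) t}"
  have c: "0 \<le> \<gamma> * (L - norm (X n))" using pos_inside[of n] gamma by simp
  have rad: "sphere_radius CARD('d) (sphere_size L \<gamma> (X n)) (u * ?l) = \<gamma> * (L - norm (X n)) * profile u"
    if "0 < u" for u
    using sphere_radius_eq[OF that lifespan_pos[of n]] c by simp
  have mem: "?l * \<rho> n \<in> ?H"
    using on_sphere_at_cross[OF cont time_nonneg pos] rad[OF pos] lifespan_pos[of n] pos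
      cross_frac_bounds(2)[of L \<gamma> w "X n" "T n"]
    by (simp add: mult.commute mult_left_le)
  have "?l * \<rho> n \<le> t" if "t \<in> ?H" for t
  proof (rule ccontr)
    assume *: "\<not> ?l * \<rho> n \<le> t"
    define u where "u = t / ?l"
    have t: "t = u * ?l" using lifespan_pos[of n] by (simp add: u_def)
    have u: "0 < u" "u < \<rho> n" using that * lifespan_pos[of n] by (auto simp: u_def field_simps)
    show False using inside_before_cross[OF u] rad[OF u(1)] that by (auto simp: t)
  qed
  then have "Inf ?H = ?l * \<rho> n"
    using mem by (intro cInf_eq_minimum)
  moreover have "?H \<noteq> {}" using mem by blast
  ultimately show ?thesis
    by (simp add: sphere_exit_def first_time_def sphere_lifetime_eq del: Collect_empty_eq)
qed

lemma wms_eq_walk: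
  assumes enters
  shows "wms L \<gamma> x0 w n = walk L \<gamma> x0 w n"
proof (induction n)
  case (Suc n)
  then show ?case using sphere_exit_eq[of n] assms
    by (simp add: walk.simps(2) enters_def Let_def split_beta)
qed simp

end

text \<open>Galmarino's test: it makes the times of the walk adapted to the past.\<close>

lemma walk_cong_before:
  fixes w w' :: "real \<Rightarrow> real ^ 'd"
  assumes agree: "\<And>u. 0 \<le> u \<Longrightarrow> u \<le> t \<Longrightarrow> w u = w' u"
    and time: "wtime L \<gamma> x0 w n < t"
  shows "walk L \<gamma> x0 w' n = walk L \<gamma> x0 w n"
  using time
proof (induction n)
  case (Suc n)
  obtain x s where xs: "walk L \<gamma> x0 w n = (x, s)" by fastforce
  have s: "0 \<le> s"
  proof -
    have "0 \<le> wtime L \<gamma> x0 w n" for n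
      by (induction n) (simp_all add: wtime_Suc lifespan_nonneg cross_frac_bounds)
    from this[of n] show ?thesis by (simp add: xs)
  qed
  let ?l = "lifespan L \<gamma> x"
  let ?c = "cross_frac L \<gamma> w x s"
  have less: "s + ?l * ?c < t" using Suc.prems by (simp add: wtime_Suc xs)
  have st: "s < t"
    using less lifespan_nonneg[of L \<gamma> x] cross_frac_bounds(1)[of L \<gamma> w x s]
    by (smt (verit) mult_nonneg_nonneg)
  have IH: "walk L \<gamma> x0 w' n = (x, s)" using Suc.IH st xs by simp
  have "?l * cross_frac L \<gamma> w' x s = ?l * ?c"
  proof (cases "?l = 0")
    case False
    then have l: "0 < ?l" using lifespan_nonneg[of L \<gamma> x] by linarith
    let ?U = "\<lambda>w. {u. 0 < u \<and> u \<le> 1 \<and> \<gamma> * (L - norm x) * profile u \<le> norm (w (s + u * ?l) - x)}"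
    have bdd: "bdd_below (?U w)" for w by (auto intro: bdd_belowI[of _ 0])
    have iff: "u \<in> ?U w \<longleftrightarrow> u \<in> ?U w'" if "s + u * ?l \<le> t" for u
      using agree[of "s + u * ?l"] that s l by auto
    have "Inf (?U w) < (t - s) / ?l"
      using less l unfolding cross_frac_def[symmetric] by (simp add: field_simps)
    \<comment> \<open>The crossing falls strictly before t, so some member v of the crossing set is
      seen by both paths. Only members up to v matter for the infimum, and on those the two sets
      agree; \<open>le\<close> is stated symmetrically to give both inequalities.\<close>
    then obtain v where v: "v \<in> ?U w" "v < (t - s) / ?l"
      using cInf_lessD[OF cross_set_nonempty] by blast
    have vt: "s + v * ?l \<le> t" using v(2) l by (simp add: field_simps)
    have v': "v \<in> ?U w'" using iff[OF vt] v(1) by blast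
    have le: "Inf (?U a) \<le> Inf (?U b)"
      if va: "v \<in> ?U a" and ab: "\<And>u. s + u * ?l \<le> t \<Longrightarrow> u \<in> ?U b \<longleftrightarrow> u \<in> ?U a" for a b
    proof (rule cInf_greatest[OF cross_set_nonempty])
      fix u assume u: "u \<in> ?U b"
      show "Inf (?U a) \<le> u"
      proof (cases "u \<le> v")
        case True
        then have "u * ?l \<le> v * ?l" using l by (intro mult_right_mono) auto
        then have "s + u * ?l \<le> t" using vt by linarith
        then show ?thesis using u ab cInf_lower[OF _ bdd, of u a] by blast
      next
        case False
        then show ?thesis using cInf_lower[OF va bdd] by linarith
      qed
    qed
    have "Inf (?U w) = Inf (?U w')"
      using le[of w w', OF v(1)] le[of w' w, OF v'] iff by (intro antisym) blast+
    then show ?thesis by (simp add: cross_frac_def)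
  qed simp
  moreover have "w (s + ?l * ?c) = w' (s + ?l * ?c)"
    using agree less s lifespan_nonneg[of L \<gamma> x] cross_frac_bounds(1)[of L \<gamma> w x s] by simp
  ultimately show ?case by (auto simp: walk.simps(2) xs IH Let_def)
qed simp

section \<open>Measurability\<close>

text \<open>Adding 1 to the floor, rather than taking the ceiling, puts the grid point strictly
  after s even when s lies on the grid. Hence the index is at most k exactly on
  \<open>s < real k / 2 ^ m\<close>, the kind of event that is decided by the past at that grid
  time.\<close>

definition dyadic_index :: "nat \<Rightarrow> real \<Rightarrow> nat" where
  "dyadic_index m s = nat \<lfloor>s * 2 ^ m\<rfloor> + 1"

lemma dyadic_index_le_iff:
  assumes "0 \<le> s"
  shows "dyadic_index m s \<le> k \<longleftrightarrow> s < real k / 2 ^ m"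
proof -
  have "0 \<le> s * 2 ^ m" using assms by simp
  then have "dyadic_index m s \<le> k \<longleftrightarrow> \<lfloor>s * 2 ^ m\<rfloor> < int k"
    unfolding dyadic_index_def by (metis Suc_eq_plus1 Suc_le_eq nat_less_iff zero_le_floor)
  also have "\<dots> \<longleftrightarrow> s < real k / 2 ^ m"
    by (simp add: floor_less_iff field_simps)
  finally show ?thesis .
qed

lemma dyadic_index_gt: "0 \<le> s \<Longrightarrow> s < real (dyadic_index m s) / 2 ^ m"
  using dyadic_index_le_iff[of s m "dyadic_index m s"] by simp

lemma dyadic_index_upper:
  assumes "0 \<le> s"
  shows "real (dyadic_index m s) / 2 ^ m \<le> s + 1 / 2 ^ m"
proof -
  have "real (dyadic_index m s) \<le> s * 2 ^ m + 1"
    using assms by (simp add: dyadic_index_def)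
  then show ?thesis by (simp add: field_simps)
qed

lemma half_power_tendsto: "(\<lambda>m. 1 / 2 ^ m :: real) \<longlonglongrightarrow> 0"
  using LIMSEQ_power_zero[of "1 / 2 :: real"] by (simp add: power_one_over)

lemma dyadic_index_tendsto:
  assumes "0 \<le> s"
  shows "(\<lambda>m. real (dyadic_index m s) / 2 ^ m) \<longlonglongrightarrow> s"
proof (rule tendsto_sandwich[of "\<lambda>_. s" _ _ "\<lambda>m. s + 1 / 2 ^ m"])
  show "(\<lambda>m. s + 1 / 2 ^ m) \<longlonglongrightarrow> s"
    using tendsto_add[OF tendsto_const half_power_tendsto, of s] by simp
qed (use assms dyadic_index_gt dyadic_index_upper in \<open>auto intro!: always_eventually less_imp_le\<close>)

lemma continuous_on_Ici_tendsto:
  fixes w :: "real \<Rightarrow> 'b::topological_space"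
  assumes "continuous_on {0..} w" "X \<longlonglongrightarrow> t" "\<And>n. 0 \<le> X n"
  shows "(\<lambda>n. w (X n)) \<longlonglongrightarrow> w t"
proof -
  have "0 \<le> t" using assms by (intro LIMSEQ_le_const) auto
  then show ?thesis
    using assms by (intro continuous_on_tendsto_compose[OF assms(1,2)] always_eventually) auto
qed

lemma measurable_dyadic_index [measurable]:
  assumes [measurable]: "S \<in> borel_measurable N"
  shows "(\<lambda>\<omega>. dyadic_index m (S \<omega>)) \<in> measurable N (count_space UNIV)"
  unfolding dyadic_index_def by measurable

text \<open>Kept apart from Brownian motion so that the measurability of the walk also applies to
  the path stopped at t over the sigma-algebra \<open>past t\<close>, as needed in
  \<open>prior_walk\<close>.\<close>

locale continuous_process =
  fixes N :: "'w measure" and Y :: "real \<Rightarrow> 'w \<Rightarrow> real ^ 'd"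
  assumes process_measurable: "\<And>t. 0 \<le> t \<Longrightarrow> Y t \<in> borel_measurable N"
    and process_continuous: "\<And>\<omega>. \<omega> \<in> space N \<Longrightarrow> continuous_on {0..} (\<lambda>t. Y t \<omega>)"
begin

abbreviation "traj \<omega> t \<equiv> Y t \<omega>"

text \<open>On each grid the approximating time takes countably many values, and at a fixed time the
  process is measurable by assumption; path continuity passes to the limit.\<close>

lemma measurable_at_random_time:
  assumes S: "S \<in> borel_measurable N" "\<And>\<omega>. \<omega> \<in> space N \<Longrightarrow> 0 \<le> S \<omega>"
  shows "(\<lambda>\<omega>. Y (S \<omega>) \<omega>) \<in> borel_measurable N"
proof (rule borel_measurable_LIMSEQ_metric)
  fix m :: nat
  show "(\<lambda>\<omega>. Y (real (dyadic_index m (S \<omega>)) / 2 ^ m) \<omega>) \<in> borel_measurable N"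
    by (rule measurable_compose_countable[where f = "\<lambda>k. Y (real k / 2 ^ m)"])
       (use S in \<open>auto intro: process_measurable\<close>)
next
  fix \<omega> assume "\<omega> \<in> space N"
  then show "(\<lambda>m. Y (real (dyadic_index m (S \<omega>)) / 2 ^ m) \<omega>) \<longlonglongrightarrow> Y (S \<omega>) \<omega>"
    by (intro continuous_on_Ici_tendsto[OF process_continuous] dyadic_index_tendsto S) auto
qed

end

section \<open>First zeros of continuous random functions\<close>

lemma first_time_nonempty: "S \<noteq> {} \<Longrightarrow> first_time S = Inf S"
  by (simp add: first_time_def)

lemma first_time_empty [simp]: "first_time {} = 0"
  by (simp add: first_time_def)

text \<open>By compactness and continuity, a zero in [a, b] exists iff the function comes
  arbitrarily close to 0 at rational points of [a, b], which is a countable condition. Intervals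
  with rational endpoints then locate the first zero.\<close>

lemma measurable_first_zero:
  fixes g :: "real \<Rightarrow> 'w \<Rightarrow> real"
  assumes g [measurable]: "\<And>u. 0 < u \<Longrightarrow> g u \<in> borel_measurable N"
    and cont: "\<And>\<omega>. \<omega> \<in> space N \<Longrightarrow> continuous_on {0<..} (\<lambda>u. g u \<omega>)"
  shows "(\<lambda>\<omega>. first_time {u. 0 < u \<and> g u \<omega> = 0}) \<in> borel_measurable N"
proof -
  define hit where "hit a b = {\<omega> \<in> space N. \<exists>u\<in>{a..b}. g u \<omega> = 0}" for a b
  have hit [measurable]: "hit a b \<in> sets N" if ab: "a \<in> \<rat>" "b \<in> \<rat>" "0 < a" "a \<le> b" for a b
  proof -
    have "hit a b = (\<Inter>k::nat. \<Union>r\<in>\<rat> \<inter> {a..b}. {\<omega> \<in> space N. \<bar>g r \<omega>\<bar> < 1 / (real k + 1)})"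
      (is "_ = ?R")
    proof (intro set_eqI iffI)
      fix \<omega> assume "\<omega> \<in> hit a b"
      then obtain u where w: "\<omega> \<in> space N" and u: "u \<in> {a..b}" "g u \<omega> = 0" by (auto simp: hit_def)
      have "\<exists>r\<in>\<rat> \<inter> {a..b}. \<bar>g r \<omega>\<bar> < 1 / (real k + 1)" for k :: nat
      proof (cases "u \<in> \<rat>")
        case True
        then show ?thesis using u by (intro bexI[of _ u]) auto
      next
        case False
        \<comment> \<open>An irrational zero cannot be the rational endpoint b, which leaves room
          for a rational approximation on its right.\<close>
        then have "u < b" using u ab by (cases "u = b") auto
        have "isCont (\<lambda>u. g u \<omega>) u"
          using cont[OF w] u ab by (simp add: continuous_on_eq_continuous_at)
        then obtain d where d: "d > 0" "\<And>r. dist r u < d \<Longrightarrow> dist (g r \<omega>) (g u \<omega>) < 1 / (real k + 1)"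
          unfolding continuous_at_eps_delta
          by (metis (no_types, lifting) add_nonneg_pos divide_pos_pos of_nat_0_le_iff zero_less_one)
        obtain r where r: "r \<in> \<rat>" "u < r" "r < min b (u + d)"
          using Rats_dense_in_real[of u "min b (u + d)"] \<open>u < b\<close> d(1) by auto
        then show ?thesis using d(2)[of r] u by (intro bexI[of _ r]) (auto simp: dist_real_def)
      qed
      then show "\<omega> \<in> ?R" using w by auto
    next
      fix \<omega> assume *: "\<omega> \<in> ?R"
      then have w: "\<omega> \<in> space N" by auto
      have "continuous_on {a..b} (\<lambda>u. \<bar>g u \<omega>\<bar>)"
        using cont[OF w] ab by (intro continuous_intros) (auto elim: continuous_on_subset)
      then obtain u where u: "u \<in> {a..b}" "\<And>v. v \<in> {a..b} \<Longrightarrow> \<bar>g u \<omega>\<bar> \<le> \<bar>g v \<omega>\<bar>"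
        using continuous_attains_inf[of "{a..b}"] ab by (metis atLeastAtMost_iff compact_Icc empty_iff order_refl)
      have "g u \<omega> = 0"
      proof (rule ccontr)
        assume "g u \<omega> \<noteq> 0"
        then obtain k :: nat where k: "1 / (real k + 1) < \<bar>g u \<omega>\<bar>"
          using reals_Archimedean[of "\<bar>g u \<omega>\<bar>"] by (auto simp: inverse_eq_divide add.commute)
        from INT_D[OF *, of k] obtain r where "r \<in> {a..b}" "\<bar>g r \<omega>\<bar> < 1 / (real k + 1)"
          by auto
        then show False using k u(2)[of r] by simp
      qed
      then show "\<omega> \<in> hit a b" using u w by (auto simp: hit_def)
    qed
    also have "\<dots> \<in> sets N"
    proof (rule sets.countable_INT)
      have "(\<Union>r\<in>\<rat> \<inter> {a..b}. {\<omega> \<in> space N. \<bar>g r \<omega>\<bar> < 1 / (real k + 1)}) \<in> sets N" for k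
      proof (rule sets.countable_UN'')
        show "countable (\<rat> \<inter> {a..b})" using countable_rat by blast
      next
        fix r assume "r \<in> \<rat> \<inter> {a..b}"
        then have "0 < r" using ab by auto
        from g[OF this] show "{\<omega> \<in> space N. \<bar>g r \<omega>\<bar> < 1 / (real k + 1)} \<in> sets N" by measurable
      qed
      then show "range (\<lambda>k. \<Union>r\<in>\<rat> \<inter> {a..b}. {\<omega> \<in> space N. \<bar>g r \<omega>\<bar> < 1 / (real k + 1)}) \<subseteq> sets N"
        by blast
    qed simp
    finally show ?thesis .
  qed
  show ?thesis
  proof (rule borel_measurable_iff_less[THEN iffD2], rule allI)
    fix q :: real
    define Q where "Q = {(a, b). a \<in> \<rat> \<and> b \<in> \<rat> \<and> 0 < a \<and> a \<le> (b::real)}"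
    have Q: "countable Q"
      unfolding Q_def by (rule countable_subset[of _ "\<rat> \<times> \<rat>"]) (auto intro: countable_rat)
    have approx: "\<exists>(a, b)\<in>Q. u \<in> {a..b} \<and> b < q" if uq: "0 < u" "u < q" for u q
    proof -
      obtain a where "a \<in> \<rat>" "0 < a" "a < u" using Rats_dense_in_real[OF uq(1)] by auto
      moreover obtain b where "b \<in> \<rat>" "u < b" "b < q" using Rats_dense_in_real[OF uq(2)] by auto
      ultimately show ?thesis by (intro bexI[of _ "(a, b)"]) (auto simp: Q_def)
    qed
    have bdd: "bdd_below {u. 0 < u \<and> g u \<omega> = 0}" for \<omega> by (auto intro: bdd_belowI[of _ 0])
    have sets: "(\<Union>(a, b)\<in>Q'. hit a b) \<in> sets N" if "Q' \<subseteq> Q" for Q'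
    proof (rule sets.countable_UN'')
      show "countable Q'" using that Q by (rule countable_subset)
    next
      fix p assume "p \<in> Q'"
      then show "(case p of (a, b) \<Rightarrow> hit a b) \<in> sets N" using that by (auto simp: Q_def intro: hit)
    qed
    show "{\<omega> \<in> space N. first_time {u. 0 < u \<and> g u \<omega> = 0} < q} \<in> sets N"
    proof (cases "0 < q")
      case False
      have "0 \<le> first_time {u. 0 < u \<and> g u \<omega> = 0}" for \<omega>
        by (auto simp: first_time_def intro!: cInf_greatest)
      then have "{\<omega> \<in> space N. first_time {u. 0 < u \<and> g u \<omega> = 0} < q} = {}"
        using False by (smt (verit) Collect_empty_eq)
      then show ?thesis by (simp only: sets.empty_sets)
    next
      case True
      \<comment> \<open>For positive q the default value 0 of \<open>first_time\<close> lies below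
        q, so the paths without any zero belong to the event.\<close>
      have "{\<omega> \<in> space N. first_time {u. 0 < u \<and> g u \<omega> = 0} < q}
        = (space N - (\<Union>(a, b)\<in>Q. hit a b)) \<union> (\<Union>(a, b)\<in>{(a, b) \<in> Q. b < q}. hit a b)" (is "?A = ?B \<union> ?C")
      proof (intro set_eqI iffI)
        fix \<omega> assume w: "\<omega> \<in> ?A"
        show "\<omega> \<in> ?B \<union> ?C"
        proof (cases "{u. 0 < u \<and> g u \<omega> = 0} = {}")
          case True
          then have "\<omega> \<in> ?B" using w by (auto simp: hit_def Q_def)
          then show ?thesis by blast
        next
          case False
          then have "Inf {u. 0 < u \<and> g u \<omega> = 0} < q"
            using w first_time_nonempty[OF False] by simp
          then obtain u where "0 < u" "u < q" "g u \<omega> = 0"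
            using cInf_lessD[OF False] by blast
          moreover from approx[OF this(1,2)] obtain a b
            where "(a, b) \<in> Q" "u \<in> {a..b}" "b < q" by blast
          ultimately have "\<omega> \<in> hit a b" "(a, b) \<in> {(a, b) \<in> Q. b < q}"
            using w by (auto simp: hit_def)
          then show ?thesis by blast
        qed
      next
        fix \<omega> assume "\<omega> \<in> ?B \<union> ?C"
        then consider "\<omega> \<in> ?B" | "\<omega> \<in> ?C" by blast
        then show "\<omega> \<in> ?A"
        proof cases
          case 1
          have "{u. 0 < u \<and> g u \<omega> = 0} = {}"
          proof (rule ccontr)
            assume "\<not> ?thesis"
            then obtain u where u: "0 < u" "g u \<omega> = 0" by blast
            then obtain a b where ab: "(a, b) \<in> Q" "u \<in> {a..b}" using approx[of u "u + 1"] by auto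
            then have "\<omega> \<in> hit a b" using 1 u by (auto simp: hit_def)
            then show False using 1 ab(1) by blast
          qed
          then have "first_time {u. 0 < u \<and> g u \<omega> = 0} = 0" by (simp only: first_time_empty)
          then show ?thesis using 1 \<open>0 < q\<close> by simp
        next
          case 2
          then obtain a b u where "(a, b) \<in> Q" "b < q" "\<omega> \<in> space N" "u \<in> {a..b}" "g u \<omega> = 0"
            by (auto simp: hit_def)
          then have u: "\<omega> \<in> space N" "u \<in> {u. 0 < u \<and> g u \<omega> = 0}" "u < q"
            by (auto simp: Q_def)
          then have ne: "{u. 0 < u \<and> g u \<omega> = 0} \<noteq> {}" by blast
          have "first_time {u. 0 < u \<and> g u \<omega> = 0} < q"
            using cInf_lower[OF u(2) bdd] u(3) first_time_nonempty[OF ne] by linarith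
          then show ?thesis using u(1) by blast
        qed
      qed
      also have "\<dots> \<in> sets N" by (intro sets.Un sets.Diff sets.top) (auto intro!: sets)
      finally show ?thesis .
    qed
  qed
qed

text \<open>Freezing g after time 1 removes the constraint \<open>u \<le> 1\<close>: new zeros
  appear only beyond 1, and only if 1 is a zero already, so the infimum does not change.\<close>

lemma measurable_first_zero_unit:
  fixes g :: "real \<Rightarrow> 'w \<Rightarrow> real"
  assumes g: "\<And>u. 0 < u \<Longrightarrow> g u \<in> borel_measurable N"
    and cont: "\<And>\<omega>. \<omega> \<in> space N \<Longrightarrow> continuous_on {0<..} (\<lambda>u. g u \<omega>)"
  shows "(\<lambda>\<omega>. first_time {u. 0 < u \<and> u \<le> 1 \<and> g u \<omega> = 0}) \<in> borel_measurable N"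
proof -
  have "first_time {u. 0 < u \<and> u \<le> 1 \<and> g u \<omega> = 0} = first_time {u. 0 < u \<and> g (min u 1) \<omega> = 0}"
    (is "first_time ?U = first_time ?V") for \<omega>
  proof (cases "g 1 \<omega> = 0")
    case True
    have ne: "1 \<in> ?U" "1 \<in> ?V" using True by (auto intro!: exI[of _ 1])
    have bdd: "bdd_below ?U" "bdd_below ?V" by (auto intro: bdd_belowI[of _ 0])
    have "Inf ?V \<le> Inf ?U"
      using ne bdd by (intro cInf_superset_mono) auto
    moreover have "Inf ?U \<le> Inf ?V"
    proof (rule cInf_greatest)
      fix v assume "v \<in> ?V"
      then have "min v 1 \<in> ?U" by (auto simp: min_def split: if_splits)
      from cInf_lower[OF this bdd(1)] show "Inf ?U \<le> v" by simp
    qed (use ne in blast)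
    moreover have "?U \<noteq> {}" "?V \<noteq> {}" using ne by blast+
    ultimately show ?thesis using first_time_nonempty[of ?U] first_time_nonempty[of ?V] by linarith
  next
    case False
    then have "?U = ?V" by (auto simp: min_def split: if_splits)
    then show ?thesis by simp
  qed
  moreover have "continuous_on {0<..} (\<lambda>u. g (min u 1) \<omega>)" if "\<omega> \<in> space N" for \<omega>
    by (rule continuous_on_compose2[OF cont[OF that]]) (auto intro!: continuous_intros)
  ultimately show ?thesis
    using measurable_first_zero[of "\<lambda>u. g (min u 1)" N] g by (simp add: min_def)
qed

text \<open>Taking the maximum with 0 turns the inequality into the zero of a continuous function,
  the form that \<open>measurable_first_zero_unit\<close> handles.\<close>

lemma cross_frac_eq_first_time:
  "cross_frac L \<gamma> w x s = first_time {u. 0 < u \<and> u \<le> 1 \<and>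
     max (\<gamma> * (L - norm x) * profile u - norm (w (s + u * lifespan L \<gamma> x) - x)) 0 = 0}"
proof -
  have "{u. 0 < u \<and> u \<le> 1 \<and>
     max (\<gamma> * (L - norm x) * profile u - norm (w (s + u * lifespan L \<gamma> x) - x)) 0 = 0}
     = {u. 0 < u \<and> u \<le> 1 \<and> \<gamma> * (L - norm x) * profile u \<le> norm (w (s + u * lifespan L \<gamma> x) - x)}"
    by (auto simp: max_def)
  then show ?thesis
    using cross_set_nonempty[of \<gamma> L x w s] by (simp only: first_time_nonempty cross_frac_def not_False_eq_True)
qed

text \<open>Measurability of \<open>wms\<close> must hold on the whole space, also where
  \<open>wms\<close> and \<open>walk\<close> differ. Hence there is no condition on the path or the
  centre, and degenerate lifetimes and empty hitting sets are included.\<close>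

lemma sphere_exit_eq_first_time:
  fixes x :: "real ^ 'd"
  shows "sphere_exit L \<gamma> w x s = lifespan L \<gamma> x * first_time {u. 0 < u \<and> u \<le> 1 \<and>
     \<bar>\<gamma> * (L - norm x)\<bar> * profile u - norm (w (s + u * lifespan L \<gamma> x) - x) = 0}"
proof (cases "lifespan L \<gamma> x = 0")
  case True
  then show ?thesis by (simp add: sphere_exit_def sphere_lifetime_eq first_time_def)
next
  case False
  let ?l = "lifespan L \<gamma> x"
  have l: "0 < ?l" using False lifespan_nonneg[of L \<gamma> x] by linarith
  let ?U = "{u. 0 < u \<and> u \<le> 1 \<and> \<bar>\<gamma> * (L - norm x)\<bar> * profile u - norm (w (s + u * ?l) - x) = 0}"
  have "{t. 0 < t \<and> t \<le> ?l \<and> norm (w (s + t) - x) = sphere_radius CARD('d) (sphere_size L \<gamma> x) t}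
      = (\<lambda>u. u * ?l) ` ?U" (is "?H = _")
  proof (intro set_eqI iffI)
    fix t assume "t \<in> ?H"
    then have "t / ?l \<in> ?U" using sphere_radius_eq[of "t / ?l" L \<gamma> x] l by auto
    then show "t \<in> (\<lambda>u. u * ?l) ` ?U" using l by (intro image_eqI[of _ _ "t / ?l"]) auto
  next
    fix t assume "t \<in> (\<lambda>u. u * ?l) ` ?U"
    then show "t \<in> ?H" using sphere_radius_eq[of _ L \<gamma> x] l by auto
  qed
  moreover have "first_time ((\<lambda>u. u * ?l) ` U) = ?l * first_time U" if "U \<subseteq> {0<..}" for U
  proof (cases "U = {}")
    case False
    have bdd: "bdd_below U" using that by (intro bdd_belowI[of _ 0]) force
    have "Inf ((\<lambda>u. u * ?l) ` U) = ?l * Inf U"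
    proof (rule cInf_eq_non_empty)
      fix y assume y: "\<And>x. x \<in> (\<lambda>u. u * ?l) ` U \<Longrightarrow> y \<le> x"
      have "y / ?l \<le> Inf U"
        using y l by (intro cInf_greatest[OF False]) (auto simp: field_simps)
      then show "y \<le> ?l * Inf U" using l by (simp add: field_simps)
    qed (use False l cInf_lower[OF _ bdd] in \<open>auto simp: mult.commute\<close>)
    then show ?thesis using False by (simp add: first_time_def)
  qed (simp add: first_time_def)
  ultimately show ?thesis by (simp add: sphere_exit_def sphere_lifetime_eq subset_eq)
qed

lemma borel_measurable_lifespan [measurable]: "lifespan L \<gamma> \<in> borel_measurable borel"
  unfolding lifespan_def by measurable

lemma first_time_nonneg: "(\<And>t. t \<in> S \<Longrightarrow> 0 \<le> t) \<Longrightarrow> 0 \<le> first_time S"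
  by (auto simp: first_time_def intro!: cInf_greatest)

lemma sphere_exit_nonneg: "0 \<le> sphere_exit L \<gamma> w x s"
  by (auto simp: sphere_exit_def Let_def intro!: first_time_nonneg)

section \<open>Measurability of the two walks, the outcome and the exit time\<close>

context continuous_process
begin

lemma measurable_gap:
  assumes [measurable]: "x \<in> borel_measurable N" "s \<in> borel_measurable N" "c \<in> borel_measurable N"
    and "\<And>\<omega>. \<omega> \<in> space N \<Longrightarrow> 0 \<le> s \<omega>" "0 < u"
  shows "(\<lambda>\<omega>. c \<omega> * profile u - norm (Y (s \<omega> + u * lifespan L \<gamma> (x \<omega>)) \<omega> - x \<omega>)) \<in> borel_measurable N"
proof -
  have [measurable]: "(\<lambda>\<omega>. Y (s \<omega> + u * lifespan L \<gamma> (x \<omega>)) \<omega>) \<in> borel_measurable N"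
    using assms lifespan_nonneg[of L \<gamma>]
    by (intro measurable_at_random_time) (auto intro!: add_nonneg_nonneg mult_nonneg_nonneg)
  show ?thesis by measurable
qed

lemma measurable_cross_frac:
  assumes [measurable]: "x \<in> borel_measurable N" "s \<in> borel_measurable N"
    and s: "\<And>\<omega>. \<omega> \<in> space N \<Longrightarrow> 0 \<le> s \<omega>"
  shows "(\<lambda>\<omega>. cross_frac L \<gamma> (traj \<omega>) (x \<omega>) (s \<omega>)) \<in> borel_measurable N"
  unfolding cross_frac_eq_first_time
proof (rule measurable_first_zero_unit)
  fix \<omega> assume "\<omega> \<in> space N"
  then show "continuous_on {0<..} (\<lambda>u. max (\<gamma> * (L - norm (x \<omega>)) * profile u
      - norm (Y (s \<omega> + u * lifespan L \<gamma> (x \<omega>)) \<omega> - x \<omega>)) 0)"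
    by (intro continuous_on_max continuous_on_const continuous_on_gap process_continuous s)
next
  fix u :: real assume "0 < u"
  then show "(\<lambda>\<omega>. max (\<gamma> * (L - norm (x \<omega>)) * profile u
      - norm (Y (s \<omega> + u * lifespan L \<gamma> (x \<omega>)) \<omega> - x \<omega>)) 0) \<in> borel_measurable N"
    using measurable_gap[of x s "\<lambda>\<omega>. \<gamma> * (L - norm (x \<omega>))" u L \<gamma>] s by measurable
qed

lemma measurable_sphere_exit:
  assumes [measurable]: "x \<in> borel_measurable N" "s \<in> borel_measurable N"
    and s: "\<And>\<omega>. \<omega> \<in> space N \<Longrightarrow> 0 \<le> s \<omega>"
  shows "(\<lambda>\<omega>. sphere_exit L \<gamma> (traj \<omega>) (x \<omega>) (s \<omega>)) \<in> borel_measurable N"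
  unfolding sphere_exit_eq_first_time
proof (intro borel_measurable_times measurable_first_zero_unit)
  fix \<omega> assume "\<omega> \<in> space N"
  then show "continuous_on {0<..} (\<lambda>u. \<bar>\<gamma> * (L - norm (x \<omega>))\<bar> * profile u
      - norm (Y (s \<omega> + u * lifespan L \<gamma> (x \<omega>)) \<omega> - x \<omega>))"
    by (intro continuous_on_gap process_continuous s)
next
  fix u :: real assume "0 < u"
  then show "(\<lambda>\<omega>. \<bar>\<gamma> * (L - norm (x \<omega>))\<bar> * profile u
      - norm (Y (s \<omega> + u * lifespan L \<gamma> (x \<omega>)) \<omega> - x \<omega>)) \<in> borel_measurable N"
    by (intro measurable_gap s) auto
qed simp

lemma measurable_walk:
  "(\<lambda>\<omega>. wpos L \<gamma> x0 (traj \<omega>) n) \<in> borel_measurable N \<and>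
   (\<lambda>\<omega>. wtime L \<gamma> x0 (traj \<omega>) n) \<in> borel_measurable N \<and>
   (\<forall>\<omega>. 0 \<le> wtime L \<gamma> x0 (traj \<omega>) n)"
proof (induction n)
  case (Suc n)
  let ?x = "\<lambda>\<omega>. wpos L \<gamma> x0 (traj \<omega>) n"
  let ?s = "\<lambda>\<omega>. wtime L \<gamma> x0 (traj \<omega>) n"
  have [measurable]: "?x \<in> borel_measurable N" "?s \<in> borel_measurable N" and s: "\<And>\<omega>. 0 \<le> ?s \<omega>"
    using Suc by auto
  have [measurable]: "(\<lambda>\<omega>. cross_frac L \<gamma> (traj \<omega>) (?x \<omega>) (?s \<omega>)) \<in> borel_measurable N"
    by (intro measurable_cross_frac s) auto
  have "(\<lambda>\<omega>. ?s \<omega> + lifespan L \<gamma> (?x \<omega>) * cross_frac L \<gamma> (traj \<omega>) (?x \<omega>) (?s \<omega>))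
      \<in> borel_measurable N" (is "?t \<in> _") by measurable
  moreover have "0 \<le> ?t \<omega>" for \<omega>
    by (simp add: s lifespan_nonneg cross_frac_bounds)
  moreover note measurable_at_random_time[OF calculation]
  ultimately show ?case by (simp add: walk.simps(2) Let_def split_beta)
qed simp

lemma measurable_wms:
  "(\<lambda>\<omega>. fst (wms L \<gamma> x0 (traj \<omega>) n)) \<in> borel_measurable N \<and>
   (\<lambda>\<omega>. snd (wms L \<gamma> x0 (traj \<omega>) n)) \<in> borel_measurable N \<and>
   (\<forall>\<omega>. 0 \<le> snd (wms L \<gamma> x0 (traj \<omega>) n))"
proof (induction n)
  case (Suc n)
  let ?x = "\<lambda>\<omega>. fst (wms L \<gamma> x0 (traj \<omega>) n)"
  let ?s = "\<lambda>\<omega>. snd (wms L \<gamma> x0 (traj \<omega>) n)"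
  have [measurable]: "?x \<in> borel_measurable N" "?s \<in> borel_measurable N" and s: "\<And>\<omega>. 0 \<le> ?s \<omega>"
    using Suc by auto
  have [measurable]: "(\<lambda>\<omega>. sphere_exit L \<gamma> (traj \<omega>) (?x \<omega>) (?s \<omega>)) \<in> borel_measurable N"
    by (intro measurable_sphere_exit s) auto
  have "(\<lambda>\<omega>. ?s \<omega> + sphere_exit L \<gamma> (traj \<omega>) (?x \<omega>) (?s \<omega>))
      \<in> borel_measurable N" (is "?t \<in> _") by measurable
  moreover have "0 \<le> ?t \<omega>" for \<omega>
    by (simp add: s sphere_exit_nonneg)
  moreover note measurable_at_random_time[OF calculation]
  ultimately show ?case by (simp add: Let_def split_beta)
qed simp

lemma measurable_ball_exit_time:
  "(\<lambda>\<omega>. ball_exit_time L (traj \<omega>)) \<in> borel_measurable N"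
proof -
  have "(\<lambda>\<omega>. first_time {t. 0 < t \<and> norm (Y t \<omega>) - L = 0}) \<in> borel_measurable N"
  proof (rule measurable_first_zero)
    fix u :: real assume "0 < u"
    then show "(\<lambda>\<omega>. norm (Y u \<omega>) - L) \<in> borel_measurable N" using process_measurable[of u] by simp
  next
    fix \<omega> assume "\<omega> \<in> space N"
    then have "continuous_on {0<..} (traj \<omega>)"
      by (intro continuous_on_subset[OF process_continuous]) auto
    then show "continuous_on {0<..} (\<lambda>t. norm (Y t \<omega>) - L)" by (intro continuous_intros)
  qed
  then show ?thesis by (simp add: ball_exit_time_def)
qed

end

lemma wms_steps_eq:
  "wms_steps L \<gamma> x0 w \<epsilon> =
    (if \<exists>n. L - \<epsilon> \<le> norm (fst (wms L \<gamma> x0 w n)) then enat (LEAST n. L - \<epsilon> \<le> norm (fst (wms L \<gamma> x0 w n)))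
     else \<infinity>)"
proof (cases "\<exists>n. L - \<epsilon> \<le> norm (fst (wms L \<gamma> x0 w n))")
  case True
  let ?P = "\<lambda>n. L - \<epsilon> \<le> norm (fst (wms L \<gamma> x0 w n))"
  have "(INF n \<in> {n. ?P n}. enat n) = enat (LEAST n. ?P n)"
    by (rule antisym)
       (use True in \<open>auto intro!: INF_lower INF_greatest Least_le intro: LeastI_ex\<close>)
  with True show ?thesis by (simp add: wms_steps_def)
next
  case False
  then show ?thesis by (simp add: wms_steps_def top_enat_def)
qed

lemma (in continuous_process) measurable_wms_outcome:
  "(\<lambda>\<omega>. wms_outcome L \<gamma> x0 (traj \<omega>) \<epsilon>) \<in> borel_measurable N"
proof -
  have [measurable]: "(\<lambda>\<omega>. fst (wms L \<gamma> x0 (traj \<omega>) n)) \<in> borel_measurable N"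
    "(\<lambda>\<omega>. snd (wms L \<gamma> x0 (traj \<omega>) n)) \<in> borel_measurable N" for n
    using measurable_wms by auto
  have "(\<lambda>\<omega>. (fst (wms L \<gamma> x0 (traj \<omega>) n), snd (wms L \<gamma> x0 (traj \<omega>) n))) \<in> borel_measurable N" for n
    by (intro borel_measurable_Pair) measurable
  then have [measurable]: "(\<lambda>\<omega>. wms L \<gamma> x0 (traj \<omega>) n) \<in> borel_measurable N" for n by simp
  have eq: "the_enat (wms_steps L \<gamma> x0 w \<epsilon>) =
      (if \<exists>n. L - \<epsilon> \<le> norm (fst (wms L \<gamma> x0 w n)) then LEAST n. L - \<epsilon> \<le> norm (fst (wms L \<gamma> x0 w n))
       else the_enat \<infinity>)" for w
    by (simp add: wms_steps_eq)
  have steps: "(\<lambda>\<omega>. the_enat (wms_steps L \<gamma> x0 (traj \<omega>) \<epsilon>)) \<in> measurable N (count_space UNIV)"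
    unfolding eq by measurable
  show ?thesis
    unfolding wms_outcome_def
    by (rule measurable_compose_countable[where f = "\<lambda>n \<omega>. wms L \<gamma> x0 (traj \<omega>) n", OF _ steps])
      measurable
qed

section \<open>Gaussian increments and the past\<close>

text \<open>The preimages under one map are closed under intersection, so the product formula on
  them extends to the generated sigma-algebras.\<close>

lemma (in prob_space) indep_varI:
  assumes X [measurable]: "X \<in> measurable M S" and Y [measurable]: "Y \<in> measurable M T"
    and eq: "\<And>A C. A \<in> sets S \<Longrightarrow> C \<in> sets T \<Longrightarrow>
      prob ((X -` A \<inter> space M) \<inter> (Y -` C \<inter> space M)) = prob (X -` A \<inter> space M) * prob (Y -` C \<inter> space M)"
  shows "indep_var S X T Y"
proof -
  have stable: "Int_stable {Z -` A \<inter> space M | A. A \<in> sets R}" for Z and R :: "'z measure"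
  proof (rule Int_stableI)
    fix a b assume "a \<in> {Z -` A \<inter> space M | A. A \<in> sets R}" "b \<in> {Z -` A \<inter> space M | A. A \<in> sets R}"
    then obtain A C where "A \<in> sets R" "C \<in> sets R" "a = Z -` A \<inter> space M" "b = Z -` C \<inter> space M" by blast
    then show "a \<inter> b \<in> {Z -` A \<inter> space M | A. A \<in> sets R}"
      by (intro CollectI exI[of _ "A \<inter> C"]) auto
  qed
  have "indep_set {X -` A \<inter> space M | A. A \<in> sets S} {Y -` A \<inter> space M | A. A \<in> sets T}"
    using eq by (intro indep_setI) auto
  then show ?thesis
    unfolding indep_var_eq using X Y stable by (auto intro: indep_set_sigma_sets)
qed

lemma Basis_vec_real: "(Basis :: (real ^ 'd) set) = range (\<lambda>i. axis i 1)"
  by (auto simp: Basis_vec_def)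

lemma nn_integral_lborel_vec_prod:
  fixes f :: "'d :: finite \<Rightarrow> real \<Rightarrow> ennreal"
  assumes [measurable]: "\<And>i. f i \<in> borel_measurable borel"
  shows "(\<integral>\<^sup>+x. (\<Prod>i\<in>UNIV. f i (x $ i)) \<partial>(lborel :: (real ^ 'd) measure)) = (\<Prod>i\<in>UNIV. \<integral>\<^sup>+x. f i x \<partial>lborel)"
proof -
  let ?e = "\<lambda>i. axis i 1 :: real ^ 'd"
  have inj: "inj ?e" by (auto simp: inj_on_def axis_eq_axis)
  define g where "g b = f (inv ?e b)" for b
  have g: "g (?e i) = f i" for i using inv_f_f[OF inj, of i] by (simp add: g_def)
  have reindex: "(\<Prod>b\<in>Basis. F b) = (\<Prod>i\<in>UNIV. F (?e i))" for F :: "real ^ 'd \<Rightarrow> ennreal"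
    unfolding Basis_vec_real using inj by (simp add: prod.reindex)
  have "(\<integral>\<^sup>+x. (\<Prod>b\<in>Basis. g b (x \<bullet> b)) \<partial>lborel) = (\<Prod>b\<in>Basis. \<integral>\<^sup>+x. g b x \<partial>lborel)"
    by (rule nn_integral_lborel_prod) (auto simp: g_def)
  then show ?thesis by (simp add: reindex g inner_axis)
qed

section \<open>Law of the coordinates of one increment\<close>

context brownian_motion
begin

abbreviation "incr s t i x \<equiv> (B t x - B s x) $ i"

context
  fixes s t :: real
  assumes st: "0 \<le> s" "s < t"
begin

lemma incr_measurable [measurable]: "(\<lambda>x. B t x - B s x) \<in> borel_measurable M"
  using random_variable[of t] random_variable[of s] st by simp

lemma incr_coordinate_measurable [measurable]: "(\<lambda>x. incr s t i x) \<in> borel_measurable M"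
  by (rule measurable_compose[OF incr_measurable])
     (intro borel_measurable_continuous_onI continuous_intros)

text \<open>The source of both the marginal law and the pairwise independence of the coordinates:
  put \<open>UNIV\<close> in the other coordinates, whose factors are then 1.\<close>

lemma prob_incr_coordinates:
  assumes C: "\<And>i. C i \<in> sets borel"
  shows "emeasure M {x \<in> space M. \<forall>i. incr s t i x \<in> C i}
    = (\<Prod>i\<in>UNIV. \<integral>\<^sup>+x. ennreal (normal_density 0 (sqrt (t - s)) x) * indicator (C i) x \<partial>lborel)"
proof -
  let ?f = "normal_density 0 (sqrt (t - s))"
  let ?A = "{x :: real ^ 'd. \<forall>i. x $ i \<in> C i}"
  have [measurable]: "?A \<in> sets borel"
  proof -
    have "?A = (\<Inter>i. (\<lambda>x. x $ i) -` C i \<inter> space borel)" by auto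
    also have "\<dots> \<in> sets borel" by (intro sets.finite_INT) (auto intro!: measurable_sets_borel[OF _ C] borel_measurable_continuous_onI continuous_intros)
    finally show ?thesis .
  qed
  have "{x \<in> space M. \<forall>i. incr s t i x \<in> C i} = (\<lambda>x. B t x - B s x) -` ?A \<inter> space M"
    by auto
  also have "emeasure M \<dots> = (\<integral>\<^sup>+x. ennreal (\<Prod>i\<in>UNIV. ?f (x $ i)) * indicator ?A x \<partial>lborel)"
    by (rule distributed_emeasure[OF gaussian_increments[OF st]]) simp
  also have "\<dots> = (\<integral>\<^sup>+x. (\<Prod>i\<in>UNIV. ennreal (?f (x $ i)) * indicator (C i) (x $ i)) \<partial>lborel)"
  proof (rule nn_integral_cong)
    fix x :: "real ^ 'd"
    have "indicator ?A x = (\<Prod>i\<in>UNIV. indicator (C i) (x $ i) :: ennreal)"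
      by (simp add: indicator_def)
    then show "ennreal (\<Prod>i\<in>UNIV. ?f (x $ i)) * indicator ?A x
      = (\<Prod>i\<in>UNIV. ennreal (?f (x $ i)) * indicator (C i) (x $ i))"
      by (simp add: prod.distrib prod_ennreal)
  qed
  also have "\<dots> = (\<Prod>i\<in>UNIV. \<integral>\<^sup>+x. ennreal (?f x) * indicator (C i) x \<partial>lborel)"
    by (rule nn_integral_lborel_vec_prod) (use C in measurable)
  finally show ?thesis .
qed

lemma nn_integral_normal_one: "(\<integral>\<^sup>+x. ennreal (normal_density 0 (sqrt (t - s)) x) \<partial>lborel) = 1"
  using st by (simp add: nn_integral_eq_integral integral_normal_density)

lemma incr_coordinate_distributed:
  "distributed M lborel (\<lambda>x. incr s t i x) (normal_density 0 (sqrt (t - s)))"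
  unfolding distributed_def
proof (intro conjI measure_eqI)
  fix A assume "A \<in> sets (distr M lborel (\<lambda>x. incr s t i x))"
  then have A [measurable]: "A \<in> sets borel" by simp
  have "emeasure (distr M lborel (\<lambda>x. incr s t i x)) A
      = emeasure M ((\<lambda>x. incr s t i x) -` A \<inter> space M)"
    using incr_coordinate_measurable[of i] A by (intro emeasure_distr) auto
  also have "(\<lambda>x. incr s t i x) -` A \<inter> space M =
      {x \<in> space M. \<forall>j. incr s t j x \<in> (if j = i then A else UNIV)}" by auto
  also have "emeasure M \<dots> = (\<Prod>j\<in>UNIV. \<integral>\<^sup>+x. ennreal (normal_density 0 (sqrt (t - s)) x) *
      indicator (if j = i then A else UNIV) x \<partial>lborel)"
    by (rule prob_incr_coordinates) auto
  also have "\<dots> = (\<Prod>j\<in>UNIV. if j = i then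
      \<integral>\<^sup>+x. ennreal (normal_density 0 (sqrt (t - s)) x) * indicator A x \<partial>lborel else 1)"
    by (intro prod.cong refl) (auto simp: nn_integral_normal_one)
  also have "\<dots> = emeasure (density lborel (normal_density 0 (sqrt (t - s)))) A"
    by (simp add: emeasure_density)
  finally show "emeasure (distr M lborel (\<lambda>x. incr s t i x)) A
      = emeasure (density lborel (normal_density 0 (sqrt (t - s)))) A" .
qed (use incr_coordinate_measurable[of i] in auto)

lemma incr_coordinates_indep:
  assumes ij: "i \<noteq> j"
  shows "indep_var borel (\<lambda>x. incr s t i x) borel (\<lambda>x. incr s t j x)"
proof (rule indep_varI)
  fix A C :: "real set" assume AC: "A \<in> sets borel" "C \<in> sets borel"
  let ?D = "\<lambda>i x. incr s t i x"
  let ?I = "\<lambda>A. \<integral>\<^sup>+x. ennreal (normal_density 0 (sqrt (t - s)) x) * indicator A x \<partial>lborel"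
  have single: "emeasure M (?D i -` A \<inter> space M) = ?I A" if [measurable]: "A \<in> sets borel" for i A
    using distributed_emeasure[OF incr_coordinate_distributed] that by simp
  have "(?D i -` A \<inter> space M) \<inter> (?D j -` C \<inter> space M) =
      {x \<in> space M. \<forall>k. incr s t k x \<in> (if k = i then A else if k = j then C else UNIV)}"
    using ij by auto
  also have "emeasure M \<dots> = (\<Prod>k\<in>UNIV. ?I (if k = i then A else if k = j then C else UNIV))"
    by (rule prob_incr_coordinates) (use AC in auto)
  also have "\<dots> = (\<Prod>k\<in>{i, j}. ?I (if k = i then A else if k = j then C else UNIV))"
    by (intro prod.mono_neutral_right) (auto simp: nn_integral_normal_one)
  also have "\<dots> = ?I A * ?I C" using ij by simp
  finally have "emeasure M ((?D i -` A \<inter> space M) \<inter> (?D j -` C \<inter> space M))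
      = emeasure M (?D i -` A \<inter> space M) * emeasure M (?D j -` C \<inter> space M)"
    by (simp only: single[OF AC(1)] single[OF AC(2)])
  then show "prob ((?D i -` A \<inter> space M) \<inter> (?D j -` C \<inter> space M))
      = prob (?D i -` A \<inter> space M) * prob (?D j -` C \<inter> space M)"
    by (simp only: measure_def enn2real_mult)
qed (rule incr_coordinate_measurable)+

lemma incr_moment:
  fixes k :: nat
  shows "integrable M (\<lambda>x. (incr s t i x) ^ k)"
    and "expectation (\<lambda>x. (incr s t i x) ^ k) = (\<integral>x. normal_density 0 (sqrt (t - s)) x * x ^ k \<partial>lborel)"
proof -
  have "integrable lborel (\<lambda>x. normal_density 0 (sqrt (t - s)) x * x ^ k)"
    using integrable_normal_moment[of "sqrt (t - s)" 0 k] st by simp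
  then show "integrable M (\<lambda>x. (incr s t i x) ^ k)"
    by (subst distributed_integrable[OF incr_coordinate_distributed, symmetric]) auto
  show "expectation (\<lambda>x. (incr s t i x) ^ k) = (\<integral>x. normal_density 0 (sqrt (t - s)) x * x ^ k \<partial>lborel)"
    by (subst distributed_integral[OF incr_coordinate_distributed, symmetric]) auto
qed

lemma incr_moments:
  "expectation (\<lambda>x. incr s t i x) = 0"
  "expectation (\<lambda>x. (incr s t i x) ^ 4) = 3 * (t - s)\<^sup>2"
  using incr_moment(2)[of i 1] incr_moment(2)[of i 4] st
    integral_normal_moment_odd[of "sqrt (t - s)" 0 0] integral_normal_moment_even[of "sqrt (t - s)" 0 2]
  by (simp_all add: fact_numeral power_divide)

lemma incr_product_moment:
  "integrable M (\<lambda>x. incr s t i x * incr s t j x)"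
  "expectation (\<lambda>x. incr s t i x * incr s t j x) = (if i = j then t - s else 0)"
proof -
  have int: "integrable M (\<lambda>x. incr s t i x)" for i
    using incr_moment(1)[of i 1] by simp
  have two: "expectation (\<lambda>x. (incr s t i x) ^ 2) = t - s"
    using incr_moment(2)[of i 2] st integral_normal_moment_even[of "sqrt (t - s)" 0 1]
    by (simp add: fact_numeral)
  show "integrable M (\<lambda>x. incr s t i x * incr s t j x)"
    using incr_moment(1)[of i 2] indep_var_integrable[OF incr_coordinates_indep int int, of i j]
    by (cases "i = j") (simp_all add: power2_eq_square)
  show "expectation (\<lambda>x. incr s t i x * incr s t j x) = (if i = j then t - s else 0)"
    using two indep_var_lebesgue_integral[OF incr_coordinates_indep int int, of i j] incr_moments(1)
    by (cases "i = j") (simp_all add: power2_eq_square)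
qed

end

text \<open>The natural filtration as it is, neither completed nor made right-continuous;
  \<open>prior\<close> supplies the right limit at random times.\<close>

definition past :: "real \<Rightarrow> 'w measure" where
  "past s = sigma (space M) {B u -` C \<inter> space M | u C. 0 \<le> u \<and> u \<le> s \<and> C \<in> sets borel}"

lemma space_past [simp]: "space (past s) = space M"
  by (simp add: past_def space_measure_of_conv)

lemma sets_past:
  "sets (past s) = sigma_sets (space M) {B u -` C \<inter> space M | u C. 0 \<le> u \<and> u \<le> s \<and> C \<in> sets borel}"
  unfolding past_def by (rule sets_measure_of) auto

lemma measurable_past: "0 \<le> u \<Longrightarrow> u \<le> s \<Longrightarrow> B u \<in> borel_measurable (past s)"
  by (rule measurableI) (auto simp: sets_past intro!: sigma_sets.Basic)

lemma sets_past_subset: "sets (past s) \<subseteq> sets M"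
  unfolding sets_past using random_variable by (intro sets.sigma_sets_subset) (auto intro: measurable_sets)

lemma sets_past_mono: "s \<le> t \<Longrightarrow> sets (past s) \<subseteq> sets (past t)"
  unfolding sets_past by (intro sigma_sets_mono') (blast intro: order_trans)

lemma measurable_from_past: "f \<in> measurable (past s) N \<Longrightarrow> f \<in> measurable M N"
  using sets_past_subset[of s] by (auto simp: measurable_def)

lemma measurable_past_mono: "f \<in> measurable (past s) N \<Longrightarrow> s \<le> t \<Longrightarrow> f \<in> measurable (past t) N"
  using sets_past_mono[of s t] by (auto simp: measurable_def)

end

text \<open>Starting at x0 at every sample point makes each position exactly x0 plus a sum of
  increments. A null event could not simply be discarded in \<open>past\<close>, which is not
  completed.\<close>

locale anchored_brownian_motion = brownian_motion M B x0
  for M :: "'w measure" and B :: "real \<Rightarrow> 'w \<Rightarrow> real ^ 'd" and x0 :: "real ^ 'd" +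
  assumes anchored: "\<And>x. x \<in> space M \<Longrightarrow> B 0 x = x0"
begin

text \<open>Adding 0 and s to the observation times and sorting makes every observed position a
  partial sum of consecutive increments up to s, while the increment from s to t comes last in the
  same independent family.\<close>

lemma cylinder_indep:
  assumes st: "0 \<le> s" "s < t" and J: "finite J" "J \<subseteq> {0..s}" and C: "\<And>u. C u \<in> sets borel"
    and A: "A \<in> sets borel"
  shows "prob ({x \<in> space M. \<forall>u\<in>J. B u x \<in> C u} \<inter> ((\<lambda>x. B t x - B s x) -` A \<inter> space M))
    = prob {x \<in> space M. \<forall>u\<in>J. B u x \<in> C u} * prob ((\<lambda>x. B t x - B s x) -` A \<inter> space M)"
proof -
  define l where "l = sorted_list_of_set (insert 0 (insert s J))"
  define n where "n = length l - 1"
  have l: "set l = insert 0 (insert s J)" "sorted l" using J unfolding l_def by (subst set_sorted_list_of_set) auto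
  then have len: "length l = Suc n" by (cases l) (auto simp: n_def)
  have range: "0 \<le> l ! i" "l ! i \<le> s" if "i \<le> n" for i
    using nth_mem[of i l] that len l(1) J st(1) by auto
  obtain i0 where "i0 \<le> n" "l ! i0 = 0"
    using in_set_conv_nth[of 0 l] l(1) len by (auto simp: less_Suc_eq_le)
  then have l0: "l ! 0 = 0"
    using sorted_nth_mono[OF l(2), of 0 i0] range[of 0] len by simp
  obtain i1 where "i1 \<le> n" "l ! i1 = s"
    using in_set_conv_nth[of s l] l(1) len by (auto simp: less_Suc_eq_le)
  then have ln: "l ! n = s"
    using sorted_nth_mono[OF l(2), of i1 n] range[of n] len by simp
  \<comment> \<open>\<open>independent_increments\<close> wants a monotone sequence over all
    naturals; from index n + 1 on it stays at t.\<close>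
  define \<tau> where "\<tau> i = (if i \<le> n then l ! i else t)" for i
  have mono: "mono \<tau>"
    using range st sorted_nth_mono[OF l(2)] len
    by (auto simp: mono_def \<tau>_def less_Suc_eq_le intro: order_trans[of _ s])
  define D where "D i x = B (\<tau> (Suc i)) x - B (\<tau> i) x" for i x
  have "indep_vars (\<lambda>_. borel) D {..<Suc n}"
    unfolding D_def using independent_increments[OF _ mono, of "Suc n"] l0 by (simp add: \<tau>_def)
  from indep_var_restrict[OF this, of "{..<n}" "{n}"]
  have ind: "indep_var (Pi\<^sub>M {..<n} (\<lambda>_. borel)) (\<lambda>x. restrict (\<lambda>i. D i x) {..<n})
       (Pi\<^sub>M {n} (\<lambda>_. borel)) (\<lambda>x. restrict (\<lambda>i. D i x) {n})" by auto
  define K where "K = {k. k \<le> n \<and> l ! k \<in> J}"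
  have K: "finite K" by (simp add: K_def)
  define E where "E = {f \<in> space (Pi\<^sub>M {..<n} (\<lambda>_. borel :: (real ^ 'd) measure)).
     \<forall>k\<in>K. x0 + (\<Sum>i<k. f i) \<in> C (l ! k)}"
  have E: "E \<in> sets (Pi\<^sub>M {..<n} (\<lambda>_. borel))"
  proof -
    have [measurable]: "(\<lambda>f. x0 + (\<Sum>i<k. f i)) \<in> borel_measurable (Pi\<^sub>M {..<n} (\<lambda>_. borel))"
      if "k \<in> K" for k
      using that by (intro borel_measurable_add borel_measurable_sum borel_measurable_const
        measurable_component_singleton) (auto simp: K_def)
    show ?thesis unfolding E_def using K C by measurable
  qed
  define F where "F = {f \<in> space (Pi\<^sub>M {n} (\<lambda>_. borel :: (real ^ 'd) measure)). f n \<in> A}"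
  have F: "F \<in> sets (Pi\<^sub>M {n} (\<lambda>_. borel))"
    unfolding F_def using A by measurable
  have pos: "x0 + (\<Sum>i<k. D i x) = B (l ! k) x" if "k \<le> n" "x \<in> space M" for k x
    unfolding D_def using sum_lessThan_telescope[of "\<lambda>i. B (\<tau> i) x" k] that anchored l0
    by (simp add: \<tau>_def)
  have J_eq: "J = (\<lambda>k. l ! k) ` K"
  proof
    show "J \<subseteq> (\<lambda>k. l ! k) ` K"
    proof
      fix u assume "u \<in> J"
      then have "u \<in> set l" using l(1) by simp
      then obtain k where "k < length l" "l ! k = u" unfolding in_set_conv_nth by blast
      then show "u \<in> (\<lambda>k. l ! k) ` K" using \<open>u \<in> J\<close> len by (auto simp: K_def)
    qed
  qed (auto simp: K_def)
  have sumr: "(\<Sum>i<k. restrict (\<lambda>i. D i x) {..<n} i) = (\<Sum>i<k. D i x)" if "k \<in> K" for k x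
    using that by (intro sum.cong) (auto simp: K_def)
  have 1: "(\<lambda>x. restrict (\<lambda>i. D i x) {..<n}) -` E \<inter> space M = {x \<in> space M. \<forall>u\<in>J. B u x \<in> C u}"
  proof -
    have "x0 + (\<Sum>i<k. restrict (\<lambda>i. D i x) {..<n} i) = B (l ! k) x" if "k \<in> K" "x \<in> space M" for k x
      using sumr[OF that(1)] pos[of k x] that by (simp add: K_def)
    then show ?thesis unfolding E_def J_eq by (auto simp: space_PiM)
  qed
  have "D n x = B t x - B s x" for x by (simp add: D_def \<tau>_def ln)
  then have 2: "(\<lambda>x. restrict (\<lambda>i. D i x) {n}) -` F \<inter> space M = (\<lambda>x. B t x - B s x) -` A \<inter> space M"
    unfolding F_def by (auto simp: space_PiM)
  have "(\<lambda>x. (restrict (\<lambda>i. D i x) {..<n}, restrict (\<lambda>i. D i x) {n})) -` (E \<times> F) \<inter> space M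
     = ((\<lambda>x. restrict (\<lambda>i. D i x) {..<n}) -` E \<inter> space M) \<inter> ((\<lambda>x. restrict (\<lambda>i. D i x) {n}) -` F \<inter> space M)"
    by auto
  then show ?thesis
    using indep_varD[OF ind E F] unfolding 1 2 by simp
qed

text \<open>Cylinder events generate \<open>past s\<close> and are closed under intersection, so the
  independence passes from them to the whole sigma-algebra.\<close>

lemma past_indep:
  fixes g :: "real ^ 'd \<Rightarrow> 'z"
  assumes st: "0 \<le> s" "s < t" and h: "h \<in> measurable (past s) N" and g: "g \<in> measurable borel N'"
  shows "indep_var N h N' (\<lambda>x. g (B t x - B s x))"
proof -
  let ?D = "\<lambda>x. B t x - B s x"
  define G where "G = {{x \<in> space M. \<forall>u\<in>J. B u x \<in> C u} | J C.
     finite J \<and> J \<subseteq> {0..s} \<and> (\<forall>u. C u \<in> sets borel)}"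
  define H where "H = {?D -` A \<inter> space M | A. A \<in> sets borel}"
  have H: "H \<subseteq> events" using incr_measurable[OF st] by (auto simp: H_def)
  have G: "G \<subseteq> events"
  proof
    fix g assume "g \<in> G"
    then obtain J C where g: "g = {x \<in> space M. \<forall>u\<in>J. B u x \<in> C u}"
      and J: "finite J" "J \<subseteq> {0..s}" "\<And>u. C u \<in> sets borel" unfolding G_def by blast
    have "{x \<in> space M. B u x \<in> C u} \<in> events" if "u \<in> J" for u
      using random_variable[of u] J that by (intro measurable_sets_Collect[of _ M borel]) auto
    then show "g \<in> events" unfolding g using J(1) by (intro sets.sets_Collect_finite_All) auto
  qed
  have stable_G: "Int_stable G"
  proof (rule Int_stableI)
    fix a b assume "a \<in> G" "b \<in> G"
    then obtain J C J' C' where ab: "a = {x \<in> space M. \<forall>u\<in>J. B u x \<in> C u}" "b = {x \<in> space M. \<forall>u\<in>J'. B u x \<in> C' u}"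
      and J: "finite J" "J \<subseteq> {0..s}" "\<forall>u. C u \<in> sets borel"
       "finite J'" "J' \<subseteq> {0..s}" "\<forall>u. C' u \<in> sets borel" unfolding G_def by blast
    let ?C = "\<lambda>u. (if u \<in> J then C u else UNIV) \<inter> (if u \<in> J' then C' u else UNIV)"
    have "a \<inter> b = {x \<in> space M. \<forall>u\<in>J \<union> J'. B u x \<in> ?C u}" unfolding ab by auto
    then show "a \<inter> b \<in> G" unfolding G_def using J
      by (intro CollectI exI[of _ "J \<union> J'"] exI[of _ ?C]) auto
  qed
  have stable_H: "Int_stable H"
  proof (rule Int_stableI)
    fix a b assume "a \<in> H" "b \<in> H"
    then obtain A C where "A \<in> sets borel" "C \<in> sets borel" "a = ?D -` A \<inter> space M" "b = ?D -` C \<inter> space M"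
      unfolding H_def by blast
    then show "a \<inter> b \<in> H" unfolding H_def by (intro CollectI exI[of _ "A \<inter> C"]) auto
  qed
  have "indep_set G H"
    using G H cylinder_indep[OF st] unfolding G_def H_def by (intro indep_setI) auto
  then have ind: "indep_set (sigma_sets (space M) G) (sigma_sets (space M) H)"
    by (rule indep_set_sigma_sets[OF _ stable_G stable_H])
  have past: "sets (past s) \<subseteq> sigma_sets (space M) G"
    unfolding sets_past
  proof (rule sigma_sets_mono, rule subsetI)
    fix a assume "a \<in> {B u -` C \<inter> space M | u C. 0 \<le> u \<and> u \<le> s \<and> C \<in> sets borel}"
    then obtain u C where "a = B u -` C \<inter> space M" "0 \<le> u" "u \<le> s" "C \<in> sets borel" by blast
    then have "a \<in> G" unfolding G_def
      by (intro CollectI exI[of _ "{u}"] exI[of _ "\<lambda>_. C"]) auto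
    then show "a \<in> sigma_sets (space M) G" by (rule sigma_sets.Basic)
  qed
  show ?thesis
  proof (rule indep_varI[OF measurable_from_past[OF h] measurable_compose[OF incr_measurable[OF st] g]])
    fix A C assume AC: "A \<in> sets N" "C \<in> sets N'"
    have "h -` A \<inter> space M \<in> sigma_sets (space M) G"
      using measurable_sets[OF h AC(1)] past by auto
    moreover have "(\<lambda>x. g (B t x - B s x)) -` C \<inter> space M = ?D -` (g -` C) \<inter> space M" by auto
    then have "(\<lambda>x. g (B t x - B s x)) -` C \<inter> space M \<in> sigma_sets (space M) H"
      unfolding H_def using measurable_sets_borel[OF g AC(2)] by (intro sigma_sets.Basic) blast
    ultimately show "prob ((h -` A \<inter> space M) \<inter> ((\<lambda>x. g (B t x - B s x)) -` C \<inter> space M))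
        = prob (h -` A \<inter> space M) * prob ((\<lambda>x. g (B t x - B s x)) -` C \<inter> space M)"
      by (rule indep_setD[OF ind])
  qed
qed

lemma past_indep_compose:
  fixes h :: "'w \<Rightarrow> real" and g :: "real ^ 'd \<Rightarrow> real"
  assumes st: "0 \<le> s" "s < t" and h: "h \<in> borel_measurable (past s)" "integrable M h"
    and g: "g \<in> borel_measurable borel" "integrable M (\<lambda>x. g (B t x - B s x))"
  shows "integrable M (\<lambda>x. h x * g (B t x - B s x))"
    and "expectation (\<lambda>x. h x * g (B t x - B s x)) = expectation h * expectation (\<lambda>x. g (B t x - B s x))"
proof -
  have "indep_var borel h borel (\<lambda>x. g (B t x - B s x))"
    by (rule past_indep[OF st h(1) g(1)])
  from indep_var_integrable[OF this h(2) g(2)] indep_var_lebesgue_integral[OF this h(2) g(2)]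
  show "integrable M (\<lambda>x. h x * g (B t x - B s x))"
    "expectation (\<lambda>x. h x * g (B t x - B s x)) = expectation h * expectation (\<lambda>x. g (B t x - B s x))" .
qed

end

section \<open>Optional stopping\<close>

lemma integrable_bounded_mult:
  fixes f h :: "'a \<Rightarrow> real"
  assumes f: "integrable M f" and [measurable]: "h \<in> borel_measurable M"
    and h: "\<And>x. x \<in> space M \<Longrightarrow> \<bar>h x\<bar> \<le> c"
  shows "integrable M (\<lambda>x. h x * f x)"
proof (rule Bochner_Integration.integrable_bound)
  show "integrable M (\<lambda>x. c * f x)" using f by simp
  show "AE x in M. norm (h x * f x) \<le> norm (c * f x)"
    using h by (intro AE_I2) (force simp: abs_mult intro!: mult_right_mono)
qed (use borel_measurable_integrable[OF f] in measurable)

context prob_space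
begin

text \<open>Bounded second moments give uniform integrability. By Fatou the limit obeys the same
  bound C. The differences Z are split by
  \<open>\<bar>Z\<bar> \<le> min \<bar>Z\<bar> R + Z^2 / R\<close>: dominated convergence handles
  the first term, and the second has mean at most 4 C / R.\<close>

lemma expectation_tendsto_of_second_moment:
  fixes X :: "nat \<Rightarrow> 'a \<Rightarrow> real"
  assumes X: "\<And>m. X m \<in> borel_measurable M"
    and lim: "\<And>x. x \<in> space M \<Longrightarrow> (\<lambda>m. X m x) \<longlonglongrightarrow> Y x"
    and int: "\<And>m. integrable M (\<lambda>x. (X m x)\<^sup>2)" and C: "\<And>m. expectation (\<lambda>x. (X m x)\<^sup>2) \<le> C"
  shows "integrable M Y" and "(\<lambda>m. expectation (X m)) \<longlonglongrightarrow> expectation Y"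
proof -
  note X [measurable]
  have [measurable]: "Y \<in> borel_measurable M" by (rule borel_measurable_LIMSEQ_real[OF lim X])
  have "(\<integral>\<^sup>+x. ennreal ((Y x)\<^sup>2) \<partial>M) = (\<integral>\<^sup>+x. liminf (\<lambda>m. ennreal ((X m x)\<^sup>2)) \<partial>M)"
    using lim by (intro nn_integral_cong lim_imp_Liminf[symmetric] tendsto_ennrealI tendsto_power) auto
  also have "\<dots> \<le> liminf (\<lambda>m. \<integral>\<^sup>+x. ennreal ((X m x)\<^sup>2) \<partial>M)"
    by (rule nn_integral_liminf) measurable
  also have "\<dots> \<le> ennreal C"
    using C by (intro Liminf_le) (auto simp: nn_integral_eq_integral[OF int] ennreal_leI)
  finally have Y2: "(\<integral>\<^sup>+x. ennreal ((Y x)\<^sup>2) \<partial>M) \<le> ennreal C" .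
  then have intY: "integrable M (\<lambda>x. (Y x)\<^sup>2)"
    by (intro integrableI_nonneg) (auto intro: order_le_less_trans)
  have "0 \<le> expectation (\<lambda>x. (X 0 x)\<^sup>2)" by (rule Bochner_Integration.integral_nonneg) simp
  also note C[of 0]
  finally have C0: "0 \<le> C" .
  have EY: "expectation (\<lambda>x. (Y x)\<^sup>2) \<le> C"
    using Y2 C0 by (simp add: nn_integral_eq_integral[OF intY])
  have int1: "integrable M f" if [measurable]: "f \<in> borel_measurable M" and "integrable M (\<lambda>x. (f x)\<^sup>2)"
    for f :: "'a \<Rightarrow> real"
    using square_integrable_imp_integrable[OF that] .
  show "integrable M Y" by (rule int1[OF _ intY]) simp
  define Z where "Z m x = X m x - Y x" for m x
  have [measurable]: "Z m \<in> borel_measurable M" for m unfolding Z_def by measurable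
  have Zle: "(Z m x)\<^sup>2 \<le> 2 * (X m x)\<^sup>2 + 2 * (Y x)\<^sup>2" for m x
    using zero_le_power2[of "X m x + Y x"] by (simp add: Z_def power2_sum power2_diff)
  have bnd: "integrable M (\<lambda>x. 2 * (X m x)\<^sup>2 + 2 * (Y x)\<^sup>2)" for m
    using int intY by simp
  have intZ: "integrable M (\<lambda>x. (Z m x)\<^sup>2)" for m
    by (rule Bochner_Integration.integrable_bound[OF bnd[of m]]) (use Zle in \<open>auto intro!: AE_I2\<close>)
  have EZ: "expectation (\<lambda>x. (Z m x)\<^sup>2) \<le> 4 * C" for m
  proof -
    have "expectation (\<lambda>x. (Z m x)\<^sup>2) \<le> expectation (\<lambda>x. 2 * (X m x)\<^sup>2 + 2 * (Y x)\<^sup>2)"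
      using Zle intZ bnd by (intro integral_mono) auto
    also have "\<dots> = 2 * expectation (\<lambda>x. (X m x)\<^sup>2) + 2 * expectation (\<lambda>x. (Y x)\<^sup>2)"
      using int intY by simp
    finally show ?thesis using C[of m] EY by simp
  qed
  have small: "\<forall>\<^sub>F m in sequentially. expectation (\<lambda>x. \<bar>Z m x\<bar>) < e" if "0 < e" for e
  proof -
    \<comment> \<open>Large enough that 4 C / R falls below e / 2; the summand 1 keeps R positive
      when C = 0.\<close>
    define R where "R = 8 * C / e + 1"
    have R: "0 < R" "4 * C / R < e / 2" using C0 that by (simp_all add: R_def field_simps add_nonneg_pos)
    have "(\<lambda>m. expectation (\<lambda>x. min \<bar>Z m x\<bar> R)) \<longlonglongrightarrow> expectation (\<lambda>x. 0)"
    proof (rule integral_dominated_convergence[where w = "\<lambda>_. R"])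
      have "(\<lambda>m. min \<bar>Z m x\<bar> R) \<longlonglongrightarrow> min \<bar>Y x - Y x\<bar> R" if "x \<in> space M" for x
        unfolding Z_def by (intro tendsto_intros lim that)
      then show "AE x in M. (\<lambda>m. min \<bar>Z m x\<bar> R) \<longlonglongrightarrow> 0" using R by (intro AE_I2) auto
    qed (use R in auto)
    then have "\<forall>\<^sub>F m in sequentially. expectation (\<lambda>x. min \<bar>Z m x\<bar> R) < e / 2"
      using that by (intro order_tendstoD(2)) auto
    then show ?thesis
    proof eventually_elim
      case (elim m)
      have le: "\<bar>Z m x\<bar> \<le> min \<bar>Z m x\<bar> R + (Z m x)\<^sup>2 / R" for x
      proof (cases "\<bar>Z m x\<bar> \<le> R")
        case False
        then have "R * \<bar>Z m x\<bar> \<le> \<bar>Z m x\<bar> * \<bar>Z m x\<bar>" using R by (intro mult_right_mono) auto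
        then have "\<bar>Z m x\<bar> \<le> (Z m x)\<^sup>2 / R" using R by (simp add: field_simps power2_eq_square)
        then show ?thesis using R by simp
      qed (use R in simp)
      have intmin: "integrable M (\<lambda>x. min \<bar>Z m x\<bar> R)"
        by (rule integrable_const_bound[of _ R]) (use R in auto)
      have "expectation (\<lambda>x. \<bar>Z m x\<bar>) \<le> expectation (\<lambda>x. min \<bar>Z m x\<bar> R + (Z m x)\<^sup>2 / R)"
      proof (rule integral_mono)
        have "integrable M (Z m)" by (rule int1[OF _ intZ]) simp
        then show "integrable M (\<lambda>x. \<bar>Z m x\<bar>)" by simp
        show "integrable M (\<lambda>x. min \<bar>Z m x\<bar> R + (Z m x)\<^sup>2 / R)" using intmin intZ[of m] by simp
      qed (rule le)
      also have "\<dots> = expectation (\<lambda>x. min \<bar>Z m x\<bar> R) + expectation (\<lambda>x. (Z m x)\<^sup>2) / R"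
        using intmin intZ[of m] by simp
      also have "\<dots> \<le> expectation (\<lambda>x. min \<bar>Z m x\<bar> R) + 4 * C / R"
        using EZ[of m] R by (simp add: divide_right_mono)
      finally show ?case using elim R by simp
    qed
  qed
  show "(\<lambda>m. expectation (X m)) \<longlonglongrightarrow> expectation Y"
  proof (rule LIMSEQ_I)
    fix e :: real assume "0 < e"
    have "norm (expectation (X m) - expectation Y) \<le> expectation (\<lambda>x. \<bar>Z m x\<bar>)" for m
    proof -
      have "expectation (X m) - expectation Y = expectation (Z m)"
        unfolding Z_def using int1[OF X int] \<open>integrable M Y\<close> by simp
      then show ?thesis using integral_norm_bound[of M "Z m"] by simp
    qed
    then show "\<exists>n0. \<forall>m\<ge>n0. norm (expectation (X m) - expectation Y) < e"
      using small[OF \<open>0 < e\<close>] unfolding eventually_sequentially by (meson order_le_less_trans)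
  qed
qed

end

section \<open>Optional times and their dyadic approximations\<close>

context anchored_brownian_motion
begin

text \<open>\<open>prior S h\<close> expresses measurability of \<open>h\<close> with respect to the past of \<open>S+\<close>. The strict inequality
  suffices because the dyadic approximations of \<open>S\<close> from above are strictly larger than \<open>S\<close>.\<close>

definition prior :: "('w \<Rightarrow> real) \<Rightarrow> ('w \<Rightarrow> real) \<Rightarrow> bool" where
  "prior S h \<longleftrightarrow> (\<forall>t\<ge>0. (\<lambda>x. if S x < t then h x else 0) \<in> borel_measurable (past t))"

text \<open>\<open>prior S (\<lambda>_. 1)\<close> says that the event \<open>S < t\<close> belongs
  to \<open>past t\<close> for every t.\<close>

definition optional :: "('w \<Rightarrow> real) \<Rightarrow> bool" where
  "optional S \<longleftrightarrow> (\<forall>x\<in>space M. 0 \<le> S x) \<and> prior S (\<lambda>_. 1)"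

lemma optional_nonneg: "optional S \<Longrightarrow> x \<in> space M \<Longrightarrow> 0 \<le> S x"
  by (simp add: optional_def)

lemma prior_dyadic:
  assumes S: "\<And>x. x \<in> space M \<Longrightarrow> 0 \<le> S x" and h: "prior S h"
  shows "(\<lambda>x. if dyadic_index m (S x) \<le> k then h x else 0) \<in> borel_measurable (past (real k / 2 ^ m))"
proof -
  have "(\<lambda>x. if S x < real k / 2 ^ m then h x else 0) \<in> borel_measurable (past (real k / 2 ^ m))"
    using h by (simp add: prior_def)
  then show ?thesis
    by (rule measurable_cong[THEN iffD1, rotated]) (simp add: dyadic_index_le_iff[OF S])
qed

lemma optional_dyadic:
  "optional S \<Longrightarrow> (\<lambda>x. if dyadic_index m (S x) \<le> k then 1 else 0 :: real) \<in> borel_measurable (past (real k / 2 ^ m))"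
  by (rule prior_dyadic) (auto simp: optional_def)

lemma prior_measurable:
  assumes h: "prior S h" and S: "\<And>x. x \<in> space M \<Longrightarrow> S x < real n"
  shows "h \<in> borel_measurable M"
proof -
  have "(\<lambda>x. if S x < real n then h x else 0) \<in> borel_measurable (past (real n))"
    using h by (simp add: prior_def)
  then have "(\<lambda>x. if S x < real n then h x else 0) \<in> borel_measurable M"
    by (rule measurable_from_past)
  then show ?thesis by (rule measurable_cong[THEN iffD1, rotated]) (simp add: S)
qed

lemma optional_measurable:
  assumes S: "optional S"
  shows "S \<in> borel_measurable M"
proof (rule borel_measurable_iff_less[THEN iffD2], rule allI)
  fix t
  show "{x \<in> space M. S x < t} \<in> sets M"
  proof (cases "0 \<le> t")
    case True
    then have "(\<lambda>x. if S x < t then 1 else 0 :: real) \<in> borel_measurable (past t)"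
      using S by (simp add: prior_def optional_def)
    then have "(\<lambda>x. if S x < t then 1 else 0 :: real) \<in> borel_measurable M"
      by (rule measurable_from_past)
    then have "{x \<in> space M. (if S x < t then 1 else 0 :: real) \<in> {1}} \<in> sets M"
      by (rule measurable_sets_Collect) simp
    moreover have "{x \<in> space M. (if S x < t then 1 else 0 :: real) \<in> {1}} = {x \<in> space M. S x < t}"
      by auto
    ultimately show ?thesis by simp
  next
    case False
    then have "{x \<in> space M. S x < t} = {}" using optional_nonneg[OF S] by force
    then show ?thesis by (simp only: sets.empty_sets)
  qed
qed

sublocale continuous_process M B
  by unfold_locales (auto intro: random_variable continuous_paths)

lemma incr_power_integrable:
  assumes "0 \<le> s" "s \<le> t"
  shows "integrable M (\<lambda>x. (incr s t i x) ^ k)"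
  using assms incr_moment(1)[of s t i k] by (cases "s = t") auto

lemma incr_measurable_past:
  assumes "0 \<le> r" "r \<le> u" "u \<le> s"
  shows "(\<lambda>x. incr r u i x) \<in> borel_measurable (past s)"
proof -
  have [measurable]: "B u \<in> borel_measurable (past s)" "B r \<in> borel_measurable (past s)"
    using assms by (auto intro: measurable_past)
  have "(\<lambda>x. B u x - B r x) \<in> borel_measurable (past s)" by measurable
  then show ?thesis
    by (rule measurable_compose) (intro borel_measurable_continuous_onI continuous_intros)
qed

text \<open>Convexity of \<open>x\<^sup>4\<close> gives \<open>(x + y)\<^sup>4 \<ge> x\<^sup>4 + 4 x\<^sup>3 y\<close>, and the last term has mean zero.\<close>

lemma fourth_power_submartingale:
  assumes t: "0 \<le> r" "r \<le> s" "s \<le> t" and A: "A \<in> sets (past s)"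
  shows "expectation (\<lambda>x. indicator A x * (incr r s i x) ^ 4)
    \<le> expectation (\<lambda>x. indicator A x * (incr r t i x) ^ 4)"
proof (cases "s = t")
  case False
  let ?x = "\<lambda>x. incr r s i x"
  let ?y = "\<lambda>x. incr s t i x"
  have st: "0 \<le> s" "s < t" using t False by auto
  have AM: "A \<in> sets M" using A sets_past_subset by blast
  have ind: "integrable M (\<lambda>x. indicator A x * f x)" if "integrable M f" for f :: "'w \<Rightarrow> real"
    using that AM integrable_mult_indicator[of A M f] by simp
  have conv: "x ^ 4 + 4 * (x ^ 3 * y) \<le> (x + y) ^ 4" for x y :: real
  proof -
    have "(x + y) ^ 4 - x ^ 4 - 4 * (x ^ 3 * y) = y\<^sup>2 * (2 * x\<^sup>2 + (2 * x + y)\<^sup>2)"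
      by (simp add: power4_eq_xxxx power3_eq_cube power2_eq_square algebra_simps)
    also have "\<dots> \<ge> 0" by simp
    finally show ?thesis by simp
  qed
  have x3: "(\<lambda>x. indicator A x * ?x x ^ 3) \<in> borel_measurable (past s)"
    using A incr_measurable_past[of r s s i] t by simp
  have x3int: "integrable M (\<lambda>x. indicator A x * ?x x ^ 3)"
    using t by (intro ind incr_power_integrable)
  have g: "(\<lambda>v :: real ^ 'd. v $ i) \<in> borel_measurable borel"
    by (intro borel_measurable_continuous_onI continuous_intros)
  have gint: "integrable M (\<lambda>x. ?y x)"
    using incr_power_integrable[of s t i 1] st by simp
  note xy = past_indep_compose[OF st x3 x3int g gint]
  have "expectation (\<lambda>x. indicator A x * ?x x ^ 4)
    = expectation (\<lambda>x. indicator A x * ?x x ^ 4 + 4 * (indicator A x * ?x x ^ 3 * ?y x))"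
    using xy incr_moments(1)[OF st] ind[OF incr_power_integrable[of r s i 4]] t by simp
  also have "\<dots> \<le> expectation (\<lambda>x. indicator A x * (incr r t i x) ^ 4)"
  proof (rule integral_mono)
    show "integrable M (\<lambda>x. indicator A x * ?x x ^ 4 + 4 * (indicator A x * ?x x ^ 3 * ?y x))"
      using xy ind[OF incr_power_integrable[of r s i 4]] t by simp
    show "integrable M (\<lambda>x. indicator A x * (incr r t i x) ^ 4)"
      using ind[OF incr_power_integrable[of r t i 4]] t by simp
    fix x
    show "indicator A x * ?x x ^ 4 + 4 * (indicator A x * ?x x ^ 3 * ?y x)
      \<le> indicator A x * (incr r t i x) ^ 4"
      using conv[of "?x x" "?y x"] by (auto simp: indicator_def)
  qed
  finally show ?thesis .
qed simp

lemma prior_space: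
  assumes "optional S"
  shows "prior S (indicator (space M))"
  unfolding prior_def
proof (intro allI impI)
  fix t :: real assume "0 \<le> t"
  then have "(\<lambda>x. if S x < t then 1 else 0 :: real) \<in> borel_measurable (past t)"
    using assms by (simp add: prior_def optional_def)
  then show "(\<lambda>x. if S x < t then indicator (space M) x else 0 :: real) \<in> borel_measurable (past t)"
    by (rule measurable_cong[THEN iffD1, rotated]) auto
qed

text \<open>Fixing the grid value turns the random time into a deterministic one, at which A is an
  event of the past. The event for the value k is the difference of those for at most k and at most
  k - 1.\<close>

lemma prior_indicator_dyadic_eq:
  assumes S: "optional S" and A: "prior S (indicator A)" "A \<subseteq> space M"
  shows "A \<inter> {x \<in> space M. dyadic_index m (S x) = k} \<in> sets (past (real k / 2 ^ m))"
proof -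
  have le: "A \<inter> {x \<in> space M. dyadic_index m (S x) \<le> k} \<in> sets (past (real k / 2 ^ m))" for k
  proof -
    have "{x \<in> space (past (real k / 2 ^ m)). (if dyadic_index m (S x) \<le> k then indicator A x else 0 :: real) \<in> {1}}
      \<in> sets (past (real k / 2 ^ m))"
      by (rule measurable_sets_Collect[OF prior_dyadic[OF optional_nonneg[OF S] A(1)]]) simp_all
    moreover have "{x \<in> space (past (real k / 2 ^ m)). (if dyadic_index m (S x) \<le> k then indicator A x else 0 :: real) \<in> {1}}
      = A \<inter> {x \<in> space M. dyadic_index m (S x) \<le> k}" using A(2) by (auto simp: indicator_def)
    ultimately show ?thesis by (simp only:)
  qed
  show ?thesis
  proof (cases k)
    case 0
    then show ?thesis by (simp add: dyadic_index_def)
  next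
    case (Suc l)
    have "A \<inter> {x \<in> space M. dyadic_index m (S x) = k} =
       (A \<inter> {x \<in> space M. dyadic_index m (S x) \<le> k}) - (A \<inter> {x \<in> space M. dyadic_index m (S x) \<le> l})"
      by (auto simp: Suc)
    moreover have "A \<inter> {x \<in> space M. dyadic_index m (S x) \<le> l} \<in> sets (past (real k / 2 ^ m))"
      using le[of l] sets_past_mono[of "real l / 2 ^ m" "real k / 2 ^ m"] Suc by (auto simp: divide_right_mono)
    ultimately show ?thesis using le[of k] by auto
  qed
qed

text \<open>A bound uniform in m, for the passage to the limit in \<open>optional_stopping\<close>.
  On each grid value k of T the submartingale property moves the time from k / 2^m to n, and the
  pieces reassemble to the Gaussian moment 3 n^2 at time n.\<close>

lemma dyadic_fourth_moment:
  fixes m :: nat and i :: 'd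
  assumes T: "optional T" and bound: "\<And>x. x \<in> space M \<Longrightarrow> T x < real n"
  defines "W \<equiv> \<lambda>x. (incr 0 (real (dyadic_index m (T x)) / 2 ^ m) i x) ^ 4"
  shows "integrable M W" and "expectation W \<le> 3 * (real n)\<^sup>2"
proof -
  let ?K = "n * 2 ^ m"
  let ?b = "\<lambda>k x. (incr 0 (real k / 2 ^ m) i x) ^ 4"
  define A where "A k = space M \<inter> {x \<in> space M. dyadic_index m (T x) = k}" for k
  have A: "A k \<in> sets (past (real k / 2 ^ m))" for k
    unfolding A_def by (rule prior_indicator_dyadic_eq[OF T prior_space[OF T] order_refl])
  have K: "dyadic_index m (T x) \<le> ?K" if "x \<in> space M" for x
    using dyadic_index_le_iff[OF optional_nonneg[OF T that], of m ?K] bound[OF that] by simp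
  have AM: "A k \<in> sets M" for k using A sets_past_subset by blast
  have bint: "integrable M (?b k)" for k by (rule incr_power_integrable) auto
  have int: "integrable M (\<lambda>x. indicator (A l) x * ?b k x)" for k l
    using integrable_mult_indicator[OF AM bint, of l k] by simp
  have split: "F (dyadic_index m (T x)) = (\<Sum>k\<le>?K. indicator (A k) x * F k)" if "x \<in> space M"
    for x and F :: "nat \<Rightarrow> real"
  proof -
    have "(\<Sum>k\<le>?K. indicator (A k) x * F k) = (\<Sum>k\<in>{dyadic_index m (T x)}. F k)"
      using K[OF that] that by (intro sum.mono_neutral_cong_right) (auto simp: A_def)
    then show ?thesis by simp
  qed
  have W: "W x = (\<Sum>k\<le>?K. indicator (A k) x * ?b k x)" if "x \<in> space M" for x
    unfolding W_def using split[OF that, of "\<lambda>k. ?b k x"] .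
  show "integrable M W"
    by (rule Bochner_Integration.integrable_cong[THEN iffD2, OF refl W], assumption)
       (intro Bochner_Integration.integrable_sum int)
  have "expectation W = expectation (\<lambda>x. \<Sum>k\<le>?K. indicator (A k) x * ?b k x)"
    by (rule Bochner_Integration.integral_cong[OF refl W])
  also have "\<dots> = (\<Sum>k\<le>?K. expectation (\<lambda>x. indicator (A k) x * ?b k x))"
    by (rule Bochner_Integration.integral_sum) (rule int)
  also have "\<dots> \<le> (\<Sum>k\<le>?K. expectation (\<lambda>x. indicator (A k) x * ?b ?K x))"
    by (intro sum_mono fourth_power_submartingale A) (auto simp: divide_right_mono simp flip: of_nat_mult of_nat_power)
  also have "\<dots> = expectation (\<lambda>x. \<Sum>k\<le>?K. indicator (A k) x * ?b ?K x)"
    by (rule Bochner_Integration.integral_sum[symmetric]) (rule int)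
  also have "\<dots> = expectation (?b ?K)"
    by (rule Bochner_Integration.integral_cong[OF refl]) (rule split[symmetric, where F = "\<lambda>_. ?b ?K _"])
  also have "\<dots> \<le> 3 * (real n)\<^sup>2"
    using incr_moments(2)[of 0 "real n" i] by (cases "n = 0") auto
  finally show "expectation W \<le> 3 * (real n)\<^sup>2" .
qed

section \<open>Weighted optional stopping for the first two moments\<close>

context
  fixes S T h :: "'w \<Rightarrow> real" and n :: nat and c :: real
  assumes S: "optional S" and T: "optional T"
    and ST: "\<And>x. x \<in> space M \<Longrightarrow> S x \<le> T x" and bound: "\<And>x. x \<in> space M \<Longrightarrow> T x < real n"
    and h: "prior S h" and hc: "\<And>x. x \<in> space M \<Longrightarrow> \<bar>h x\<bar> \<le> c"
begin

lemma h_measurable: "h \<in> borel_measurable M"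
  using prior_measurable[OF h, of n] ST bound by (meson order_le_less_trans)

context
  fixes m :: nat
begin

private abbreviation "a k \<equiv> real k / 2 ^ m"
private abbreviation "kS x \<equiv> dyadic_index m (S x)"
private abbreviation "kT x \<equiv> dyadic_index m (T x)"
text \<open>\<open>G\<close> is 1 on the blocks between the grid times of S and T and is known at
  the start of each block. Thus \<open>P\<close> is a discrete stochastic integral with predictable
  integrand, whose final value is the increment between the two grid times.\<close>

private abbreviation "G k x \<equiv> of_bool (kS x \<le> k \<and> k < kT x) :: real"
private abbreviation "D k i x \<equiv> incr (a k) (a (Suc k)) i x"
private abbreviation "P k i x \<equiv> (\<Sum>l<k. G l x * D l i x)"

private lemma step: "0 \<le> a k" "a k < a (Suc k)"
  by (auto simp: divide_strict_right_mono)

private lemma G_past: "G k \<in> borel_measurable (past (a k))"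
proof -
  have "(\<lambda>x. (if kS x \<le> k then 1 else 0 :: real) * (1 - (if kT x \<le> k then 1 else 0))) \<in> borel_measurable (past (a k))"
    by (intro borel_measurable_times borel_measurable_diff optional_dyadic S T borel_measurable_const)
  also have "(\<lambda>x. (if kS x \<le> k then 1 else 0 :: real) * (1 - (if kT x \<le> k then 1 else 0))) = G k"
    by auto
  finally show ?thesis .
qed

text \<open>\<open>h\<close> alone need not be known at time \<open>a k\<close>; multiplied by
  \<open>G k\<close> it is, because \<open>G k\<close> vanishes unless S has occurred
  before.\<close>

private lemma hG_past: "(\<lambda>x. h x * G k x) \<in> borel_measurable (past (a k))"
proof -
  have "(\<lambda>x. (if kS x \<le> k then h x else 0) * (1 - (if kT x \<le> k then 1 else 0))) \<in> borel_measurable (past (a k))"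
    by (intro borel_measurable_times borel_measurable_diff optional_dyadic prior_dyadic S T h
      borel_measurable_const optional_nonneg)
  also have "(\<lambda>x. (if kS x \<le> k then h x else 0) * (1 - (if kT x \<le> k then 1 else 0))) = (\<lambda>x. h x * G k x)"
    by auto
  finally show ?thesis .
qed

private lemma P_past: "P k i \<in> borel_measurable (past (a k))"
proof (intro borel_measurable_sum borel_measurable_times)
  fix l assume l: "l \<in> {..<k}"
  then have le: "a l \<le> a k" "a (Suc l) \<le> a k" by (auto simp: divide_right_mono)
  show "G l \<in> borel_measurable (past (a k))" by (rule measurable_past_mono[OF G_past le(1)])
  show "D l i \<in> borel_measurable (past (a k))"
    using le step[of l] by (intro incr_measurable_past) auto
qed

private lemma D_indep:
  assumes f: "f \<in> borel_measurable (past (a k))" "integrable M f"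
  shows "integrable M (\<lambda>x. f x * D k i x)" "expectation (\<lambda>x. f x * D k i x) = 0"
    and "integrable M (\<lambda>x. f x * (D k i x * D k j x))"
    and "expectation (\<lambda>x. f x * (D k i x * D k j x)) = (if i = j then expectation f / 2 ^ m else 0)"
proof -
  have g: "(\<lambda>v :: real ^ 'd. v $ i) \<in> borel_measurable borel" "(\<lambda>v :: real ^ 'd. v $ i * v $ j) \<in> borel_measurable borel"
    by (intro borel_measurable_continuous_onI continuous_intros)+
  have d: "a (Suc k) - a k = 1 / 2 ^ m" by (simp add: field_simps)
  have int: "integrable M (\<lambda>x. D k i x)"
    using incr_power_integrable[of "a k" "a (Suc k)" i 1] step[of k] by simp
  note 1 = past_indep_compose[OF step f g(1) int]
  note 2 = past_indep_compose[OF step f g(2) incr_product_moment(1)[OF step]]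
  show "integrable M (\<lambda>x. f x * D k i x)" by (rule 1)
  show "expectation (\<lambda>x. f x * D k i x) = 0"
    unfolding 1(2) using incr_moments(1)[OF step[of k], of i] by simp
  show "integrable M (\<lambda>x. f x * (D k i x * D k j x))" by (rule 2)
  show "expectation (\<lambda>x. f x * (D k i x * D k j x)) = (if i = j then expectation f / 2 ^ m else 0)"
    unfolding 2(2) incr_product_moment(2)[OF step] d by simp
qed

private lemma hG_integrable: "integrable M f \<Longrightarrow> integrable M (\<lambda>x. h x * G k x * f x)"
  by (rule integrable_bounded_mult[where c = c])
     (use hc in \<open>auto intro: measurable_from_past[OF hG_past] order_trans[OF abs_ge_zero]\<close>)

private lemma G_integrable: "integrable M f \<Longrightarrow> integrable M (\<lambda>x. G k x * f x)"
  by (rule integrable_bounded_mult[where c = 1]) (auto intro: measurable_from_past[OF G_past])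

private lemma P_integrable: "integrable M (P k i)" "integrable M (\<lambda>x. P k i x * P k j x)"
proof -
  have 1: "integrable M (P k i)" for k i
    using incr_power_integrable[of "a _" "a (Suc _)" i 1] step
    by (intro Bochner_Integration.integrable_sum G_integrable) (auto intro: less_imp_le)
  show "integrable M (P k i)" by (rule 1)
  show "integrable M (\<lambda>x. P k i x * P k j x)"
  proof (induction k)
    case (Suc k)
    have eq: "P (Suc k) i x * P (Suc k) j x = P k i x * P k j x + (G k x * P k i x) * D k j x
      + (G k x * P k j x) * D k i x + G k x * (D k i x * D k j x)" for x
      by (simp add: algebra_simps)
    have meas: "(\<lambda>x. G k x * P k i x) \<in> borel_measurable (past (a k))" for i
      by (intro borel_measurable_times G_past P_past)
    have "integrable M (G k)" using G_integrable[of "\<lambda>_. 1" k] by simp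
    then show ?case
      unfolding eq
      by (intro Bochner_Integration.integrable_add Suc.IH D_indep meas G_past G_integrable 1)
  qed simp
qed

private lemma discrete_first_moment: "expectation (\<lambda>x. h x * P k i x) = 0"
proof -
  have int: "integrable M (\<lambda>x. h x * G l x)" for l using hG_integrable[of "\<lambda>_. 1" l] by simp
  have "expectation (\<lambda>x. h x * P k i x) = expectation (\<lambda>x. \<Sum>l<k. (h x * G l x) * D l i x)"
    by (simp only: sum_distrib_left mult.assoc)
  also have "\<dots> = (\<Sum>l<k. expectation (\<lambda>x. (h x * G l x) * D l i x))"
    by (intro Bochner_Integration.integral_sum D_indep hG_past int)
  also have "\<dots> = 0" by (intro sum.neutral ballI D_indep(2) hG_past int)
  finally show ?thesis .
qed

text \<open>When one more block is expanded, the two mixed terms are a past factor times a centred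
  increment and vanish. The product of the two new increments contributes the block length 2^-m if
  \<open>i = j\<close> and nothing otherwise.\<close>

private lemma discrete_second_moment:
  "expectation (\<lambda>x. h x * (P k i x * P k j x)) = (if i = j then expectation (\<lambda>x. h x * (\<Sum>l<k. G l x)) / 2 ^ m else 0)"
proof (induction k)
  case (Suc k)
  have int: "integrable M (\<lambda>x. h x * G l x)" for l using hG_integrable[of "\<lambda>_. 1" l] by simp
  have eq: "h x * (P (Suc k) i x * P (Suc k) j x) = h x * (P k i x * P k j x) + (h x * G k x * P k i x) * D k j x
      + (h x * G k x * P k j x) * D k i x + (h x * G k x) * (D k i x * D k j x)" for x
    by (simp add: algebra_simps)
  have meas: "(\<lambda>x. h x * G k x * P k i x) \<in> borel_measurable (past (a k))" for i
    by (intro borel_measurable_times hG_past P_past)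
  note mixed = D_indep[OF meas hG_integrable[OF P_integrable(1)]]
  note diag = D_indep[OF hG_past int]
  have hPP: "integrable M (\<lambda>x. h x * (P k i x * P k j x))"
    by (rule integrable_bounded_mult[OF P_integrable(2) h_measurable hc])
  have "expectation (\<lambda>x. h x * (P (Suc k) i x * P (Suc k) j x))
      = expectation (\<lambda>x. h x * (P k i x * P k j x)) + (if i = j then expectation (\<lambda>x. h x * G k x) / 2 ^ m else 0)"
    unfolding eq
    by (subst Bochner_Integration.integral_add, (intro Bochner_Integration.integrable_add hPP mixed diag)+)+
       (simp only: mixed diag add_0_right)
  also have "\<dots> = (if i = j then expectation (\<lambda>x. h x * (\<Sum>l<k. G l x) + h x * G k x) / 2 ^ m else 0)"
  proof -
    have "integrable M (\<lambda>x. h x * (\<Sum>l<k. G l x))"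
      unfolding sum_distrib_left by (intro Bochner_Integration.integrable_sum int)
    then show ?thesis using Suc.IH int[of k] by (simp add: add_divide_distrib)
  qed
  finally show ?case by (simp add: distrib_left)
qed simp

text \<open>The two Wald identities between grid times. No block after the first
  \<open>n * 2 ^ m\<close> is active because T stays below n, so finite sums suffice and
  telescope.\<close>

lemma dyadic_optional_stopping:
  defines "Z \<equiv> \<lambda>i x. incr (a (kS x)) (a (kT x)) i x"
  shows "expectation (\<lambda>x. h x * Z i x) = 0"
    and "expectation (\<lambda>x. h x * (Z i x * Z j x)) = (if i = j then expectation (\<lambda>x. h x * (a (kT x) - a (kS x))) else 0)"
proof -
  let ?K = "n * 2 ^ m"
  have kle: "kS x \<le> kT x" "kT x \<le> ?K" if "x \<in> space M" for x
  proof -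
    show "kS x \<le> kT x" unfolding dyadic_index_def
      using ST[OF that] by (intro add_right_mono nat_mono floor_mono mult_right_mono) auto
    show "kT x \<le> ?K"
      using dyadic_index_le_iff[OF optional_nonneg[OF T that], of m ?K] bound[OF that] by simp
  qed
  have sum: "(\<Sum>l<?K. G l x * (f (Suc l) - f l)) = f (kT x) - f (kS x)"
    if "x \<in> space M" for x and f :: "nat \<Rightarrow> real"
  proof -
    have "(\<Sum>l<?K. G l x * (f (Suc l) - f l)) = (\<Sum>l\<in>{kS x..<kT x}. f (Suc l) - f l)"
      using kle[OF that] by (intro sum.mono_neutral_cong_right) auto
    also have "\<dots> = f (kT x) - f (kS x)" by (rule sum_Suc_diff'[OF kle(1)[OF that]])
    finally show ?thesis .
  qed
  have Z: "Z i x = P ?K i x" if "x \<in> space M" for i x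
    unfolding Z_def using sum[OF that, of "\<lambda>k. B (a k) x $ i"] by simp
  have len: "(\<Sum>l<?K. G l x) = real (kT x) - real (kS x)" if "x \<in> space M" for x
    using sum[OF that, of real] by simp
  have "expectation (\<lambda>x. h x * Z i x) = expectation (\<lambda>x. h x * P ?K i x)"
    by (rule Bochner_Integration.integral_cong) (simp_all add: Z)
  then show "expectation (\<lambda>x. h x * Z i x) = 0" by (simp only: discrete_first_moment)
  have "expectation (\<lambda>x. h x * (Z i x * Z j x)) = expectation (\<lambda>x. h x * (P ?K i x * P ?K j x))"
    by (rule Bochner_Integration.integral_cong) (simp_all add: Z)
  also have "\<dots> = (if i = j then expectation (\<lambda>x. h x * (\<Sum>l<?K. G l x)) / 2 ^ m else 0)"
    by (rule discrete_second_moment)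
  also have "expectation (\<lambda>x. h x * (\<Sum>l<?K. G l x)) = expectation (\<lambda>x. h x * (real (kT x) - real (kS x)))"
    by (rule Bochner_Integration.integral_cong) (simp_all only: len)
  also have "\<dots> / 2 ^ m = expectation (\<lambda>x. h x * (a (kT x) - a (kS x)))"
  proof -
    have "h x * (a (kT x) - a (kS x)) = h x * (real (kT x) - real (kS x)) / 2 ^ m" for x
      by (simp add: diff_divide_distrib[symmetric])
    then show ?thesis by (simp only: integral_divide_zero)
  qed
  finally show "expectation (\<lambda>x. h x * (Z i x * Z j x))
    = (if i = j then expectation (\<lambda>x. h x * (a (kT x) - a (kS x))) else 0)" .
qed

end

text \<open>The weight h does the work of conditioning on the past of S. The grid identities survive
  the limit because uniformly bounded fourth moments of the coordinates bound the second moments of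
  their products.\<close>

lemma optional_stopping:
  defines "Z \<equiv> \<lambda>i x. incr (S x) (T x) i x"
  shows "integrable M (\<lambda>x. h x * Z i x)" "expectation (\<lambda>x. h x * Z i x) = 0"
    and "integrable M (\<lambda>x. h x * (Z i x * Z j x))"
    and "expectation (\<lambda>x. h x * (Z i x * Z j x)) = (if i = j then expectation (\<lambda>x. h x * (T x - S x)) else 0)"
proof -
  define b where "b U m i x = incr 0 (real (dyadic_index m (U x)) / 2 ^ m) i x" for U :: "'w \<Rightarrow> real" and m i x
  define z where "z m i x = b T m i x - b S m i x" for m i x
  have z: "z m i x = incr (real (dyadic_index m (S x)) / 2 ^ m) (real (dyadic_index m (T x)) / 2 ^ m) i x"
    for m i x by (simp add: z_def b_def)
  note [measurable] = optional_measurable[OF S] optional_measurable[OF T] h_measurable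
  have boundS: "S x < real n" if "x \<in> space M" for x using ST[OF that] bound[OF that] by simp
  have [measurable]: "b U m i \<in> borel_measurable M" if U: "optional U" for U m i
  proof -
    have [measurable]: "U \<in> borel_measurable M" by (rule optional_measurable[OF U])
    have "(\<lambda>x. B (real (dyadic_index m (U x)) / 2 ^ m) x) \<in> borel_measurable M"
      by (intro measurable_at_random_time) auto
    moreover have "B 0 \<in> borel_measurable M" by (rule random_variable) simp
    ultimately have "(\<lambda>x. B (real (dyadic_index m (U x)) / 2 ^ m) x - B 0 x) \<in> borel_measurable M"
      by (rule borel_measurable_diff)
    then show ?thesis unfolding b_def
      by (rule measurable_compose) (intro borel_measurable_continuous_onI continuous_intros)
  qed
  have [measurable]: "z m i \<in> borel_measurable M" for m i
    unfolding z_def using S T by measurable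
  have fourth: "(x - y) ^ 4 \<le> 8 * (x ^ 4 + y ^ 4)" for x y :: real
  proof -
    have "(x - y)\<^sup>2 \<le> 2 * (x\<^sup>2 + y\<^sup>2)"
      using zero_le_power2[of "x + y"] by (simp add: power2_sum power2_diff)
    then have "((x - y)\<^sup>2)\<^sup>2 \<le> (2 * (x\<^sup>2 + y\<^sup>2))\<^sup>2" by (intro power_mono) auto
    also have "\<dots> \<le> 8 * ((x\<^sup>2)\<^sup>2 + (y\<^sup>2)\<^sup>2)"
      using zero_le_power2[of "x\<^sup>2 - y\<^sup>2"] by (simp add: power2_sum power2_diff algebra_simps)
    finally show ?thesis by simp
  qed
  have bint: "integrable M (\<lambda>x. (b U m i x) ^ 4)" "expectation (\<lambda>x. (b U m i x) ^ 4) \<le> 3 * (real n)\<^sup>2"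
    if "U = S \<or> U = T" for U m i
    using that dyadic_fourth_moment[OF S boundS, of m i]
      dyadic_fourth_moment[OF T bound, of m i] by (auto simp: b_def)
  have z4bound: "integrable M (\<lambda>x. 8 * ((b T m i x) ^ 4 + (b S m i x) ^ 4))" for m i
    using bint by simp
  have z4int: "integrable M (\<lambda>x. (z m i x) ^ 4)" for m i
  proof (rule Bochner_Integration.integrable_bound[OF z4bound[of m i]])
    show "AE x in M. norm ((z m i x) ^ 4) \<le> norm (8 * ((b T m i x) ^ 4 + (b S m i x) ^ 4))"
      using fourth by (auto simp: z_def intro!: AE_I2)
  qed measurable
  \<comment> \<open>The factor 8 of \<open>fourth\<close> times twice the bound
    \<open>3 * (real n)\<^sup>2\<close> of \<open>dyadic_fourth_moment\<close>.\<close>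
  define V where "V = 48 * (real n)\<^sup>2"
  have z4: "expectation (\<lambda>x. (z m i x) ^ 4) \<le> V" for m i
  proof -
    have "expectation (\<lambda>x. (z m i x) ^ 4) \<le> expectation (\<lambda>x. 8 * ((b T m i x) ^ 4 + (b S m i x) ^ 4))"
      using z4int z4bound fourth by (intro integral_mono) (auto simp: z_def)
    also have "\<dots> = 8 * (expectation (\<lambda>x. (b T m i x) ^ 4) + expectation (\<lambda>x. (b S m i x) ^ 4))"
      using bint by simp
    also have "\<dots> \<le> V" using bint(2)[of T m i] bint(2)[of S m i] by (simp add: V_def)
    finally show ?thesis .
  qed
  have Zlim: "(\<lambda>m. z m i x) \<longlonglongrightarrow> Z i x" if "x \<in> space M" for i x
    unfolding z Z_def using that
    by (intro tendsto_vec_nth tendsto_diff continuous_on_Ici_tendsto[OF continuous_paths]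
        dyadic_index_tendsto optional_nonneg[OF S] optional_nonneg[OF T]) auto
  \<comment> \<open>One majorant for both moments: with equal indices it covers the square of
    \<open>h x * z m i x\<close>, otherwise that of the product of two coordinates. The summand 1
    leaves room for bounding a second power by a fourth.\<close>
  have sqbound: "integrable M f \<and> expectation f \<le> c\<^sup>2 * (1 + V)"
    if [measurable]: "f \<in> borel_measurable M"
      and le: "\<And>x. x \<in> space M \<Longrightarrow> 0 \<le> f x \<and> f x \<le> c\<^sup>2 * (1 + ((z m i x) ^ 4 + (z m j x) ^ 4) / 2)" for f m i j
  proof -
    have int: "integrable M (\<lambda>x. c\<^sup>2 * (1 + ((z m i x) ^ 4 + (z m j x) ^ 4) / 2))"
      using z4int by simp
    have f: "integrable M f"
      by (rule Bochner_Integration.integrable_bound[OF int]) (use le in \<open>auto intro!: AE_I2 intro: order_trans\<close>)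
    have "expectation f \<le> expectation (\<lambda>x. c\<^sup>2 * (1 + ((z m i x) ^ 4 + (z m j x) ^ 4) / 2))"
      using f int le by (intro integral_mono) auto
    also have "\<dots> = c\<^sup>2 * (1 + (expectation (\<lambda>x. (z m i x) ^ 4) + expectation (\<lambda>x. (z m j x) ^ 4)) / 2)"
      using z4int by (simp add: prob_space)
    also have "\<dots> \<le> c\<^sup>2 * (1 + V)"
      using z4[of m i] z4[of m j] by (intro mult_left_mono) auto
    finally show ?thesis using f by simp
  qed
  have amgm: "x * y \<le> (x\<^sup>2 + y\<^sup>2) / 2" for x y :: real
    using zero_le_power2[of "x - y"] by (simp add: power2_diff)
  have aux: "a \<le> 1 + (x + x) / 2" if "a \<le> (x + 1) / 2" "0 \<le> x" for a x :: real
    using that by (simp add: field_simps)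
  have hsq: "(h x)\<^sup>2 \<le> c\<^sup>2" if "x \<in> space M" for x
    using hc[OF that] by (simp add: abs_le_square_iff[symmetric])
  have first: "integrable M (\<lambda>x. (h x * z m i x)\<^sup>2) \<and> expectation (\<lambda>x. (h x * z m i x)\<^sup>2) \<le> c\<^sup>2 * (1 + V)" for m i
  proof (rule sqbound[of _ m i i])
    fix x assume "x \<in> space M"
    moreover have "(z m i x)\<^sup>2 \<le> ((z m i x) ^ 4 + 1) / 2"
      using amgm[of "(z m i x)\<^sup>2" 1] by simp
    moreover have "0 \<le> (z m i x) ^ 4" by simp
    ultimately have "(z m i x)\<^sup>2 \<le> 1 + ((z m i x) ^ 4 + (z m i x) ^ 4) / 2"
      using aux by blast
    moreover note \<open>x \<in> space M\<close>
    ultimately have "(h x)\<^sup>2 * (z m i x)\<^sup>2 \<le> c\<^sup>2 * (1 + ((z m i x) ^ 4 + (z m i x) ^ 4) / 2)"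
      using hsq[of x] by (intro mult_mono) auto
    then show "0 \<le> (h x * z m i x)\<^sup>2 \<and> (h x * z m i x)\<^sup>2 \<le> c\<^sup>2 * (1 + ((z m i x) ^ 4 + (z m i x) ^ 4) / 2)"
      by (simp add: power_mult_distrib)
  qed measurable
  have second: "integrable M (\<lambda>x. (h x * (z m i x * z m j x))\<^sup>2) \<and> expectation (\<lambda>x. (h x * (z m i x * z m j x))\<^sup>2) \<le> c\<^sup>2 * (1 + V)"
    for m i j
  proof (rule sqbound[of _ m i j])
    fix x assume "x \<in> space M"
    moreover have "(z m i x)\<^sup>2 * (z m j x)\<^sup>2 \<le> ((z m i x) ^ 4 + (z m j x) ^ 4) / 2"
      using amgm[of "(z m i x)\<^sup>2" "(z m j x)\<^sup>2"] by simp
    then have "(z m i x)\<^sup>2 * (z m j x)\<^sup>2 \<le> 1 + ((z m i x) ^ 4 + (z m j x) ^ 4) / 2"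
      by (rule add_increasing[OF zero_le_one])
    ultimately have "(h x)\<^sup>2 * ((z m i x)\<^sup>2 * (z m j x)\<^sup>2) \<le> c\<^sup>2 * (1 + ((z m i x) ^ 4 + (z m j x) ^ 4) / 2)"
      using hsq[of x] by (intro mult_mono) auto
    then show "0 \<le> (h x * (z m i x * z m j x))\<^sup>2 \<and>
        (h x * (z m i x * z m j x))\<^sup>2 \<le> c\<^sup>2 * (1 + ((z m i x) ^ 4 + (z m j x) ^ 4) / 2)"
      by (simp add: power_mult_distrib)
  qed measurable
  have lim1: "(\<lambda>m. h x * z m i x) \<longlonglongrightarrow> h x * Z i x" if "x \<in> space M" for x
    by (intro tendsto_intros Zlim that)
  have lim2: "(\<lambda>m. h x * (z m i x * z m j x)) \<longlonglongrightarrow> h x * (Z i x * Z j x)" if "x \<in> space M" for x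
    by (intro tendsto_intros Zlim that)
  note conv1 = expectation_tendsto_of_second_moment[where X = "\<lambda>m x. h x * z m i x", OF _ lim1
      first[THEN conjunct1] first[THEN conjunct2]]
  note conv2 = expectation_tendsto_of_second_moment[where X = "\<lambda>m x. h x * (z m i x * z m j x)", OF _ lim2
      second[THEN conjunct1] second[THEN conjunct2]]
  show "integrable M (\<lambda>x. h x * Z i x)" by (rule conv1) measurable
  show "integrable M (\<lambda>x. h x * (Z i x * Z j x))" by (rule conv2) measurable
  have "(\<lambda>m. expectation (\<lambda>x. h x * z m i x)) \<longlonglongrightarrow> expectation (\<lambda>x. h x * Z i x)" by (rule conv1) measurable
  moreover have "expectation (\<lambda>x. h x * z m i x) = 0" for m
    unfolding z by (rule dyadic_optional_stopping)
  ultimately have "(\<lambda>m. 0) \<longlonglongrightarrow> expectation (\<lambda>x. h x * Z i x)" by (simp only:)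
  then show "expectation (\<lambda>x. h x * Z i x) = 0" by (rule LIMSEQ_unique[OF _ tendsto_const])
  let ?l = "\<lambda>m x. real (dyadic_index m (T x)) / 2 ^ m - real (dyadic_index m (S x)) / 2 ^ m"
  \<comment> \<open>Grid times exceed the true times by at most 1, so
    \<open>c * (real n + 1)\<close> dominates at every level m.\<close>
  have "(\<lambda>m. expectation (\<lambda>x. h x * ?l m x)) \<longlonglongrightarrow> expectation (\<lambda>x. h x * (T x - S x))"
  proof (rule integral_dominated_convergence[where w = "\<lambda>_. c * (real n + 1)"])
    show "AE x in M. (\<lambda>m. h x * ?l m x) \<longlonglongrightarrow> h x * (T x - S x)"
      by (intro AE_I2 tendsto_intros dyadic_index_tendsto optional_nonneg[OF S] optional_nonneg[OF T])
    show "AE x in M. norm (h x * ?l m x) \<le> c * (real n + 1)" for m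
    proof (rule AE_I2)
      fix x assume w: "x \<in> space M"
      note nn = optional_nonneg[OF S w] optional_nonneg[OF T w]
      have "1 / 2 ^ m \<le> (1::real)" by simp
      then have "\<bar>?l m x\<bar> \<le> real n + 1"
        using dyadic_index_upper[OF nn(1), of m] dyadic_index_upper[OF nn(2), of m] nn
          dyadic_index_gt[OF nn(1), of m] dyadic_index_gt[OF nn(2), of m] bound[OF w] boundS[OF w] by linarith
      then show "norm (h x * ?l m x) \<le> c * (real n + 1)"
        unfolding real_norm_def abs_mult using hc[OF w] by (intro mult_mono) auto
    qed
  qed auto
  then have lim: "(\<lambda>m. if i = j then expectation (\<lambda>x. h x * ?l m x) else 0)
      \<longlonglongrightarrow> (if i = j then expectation (\<lambda>x. h x * (T x - S x)) else 0)" by simp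
  have "(\<lambda>m. expectation (\<lambda>x. h x * (z m i x * z m j x))) \<longlonglongrightarrow> expectation (\<lambda>x. h x * (Z i x * Z j x))"
    by (rule conv2) measurable
  moreover have "expectation (\<lambda>x. h x * (z m i x * z m j x)) = (if i = j then expectation (\<lambda>x. h x * ?l m x) else 0)" for m
    unfolding z by (rule dyadic_optional_stopping)
  ultimately have "(\<lambda>m. if i = j then expectation (\<lambda>x. h x * ?l m x) else 0)
      \<longlonglongrightarrow> expectation (\<lambda>x. h x * (Z i x * Z j x))" by (simp only:)
  from this lim show "expectation (\<lambda>x. h x * (Z i x * Z j x)) = (if i = j then expectation (\<lambda>x. h x * (T x - S x)) else 0)"
    by (rule LIMSEQ_unique)
qed

end

end

section \<open>Behaviour after an optional time\<close>

context anchored_brownian_motion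
begin

text \<open>Doob's argument: split A by the first index k at which the level is reached, carry the
  fourth power from k to N by the submartingale property, and add the disjoint pieces. The increment
  over the full length v is independent of A and has fourth moment
  \<open>3 * v\<^sup>2\<close>.\<close>

lemma maximal_inequality:
  fixes i :: 'd
  assumes s: "0 \<le> s" and v: "0 < v" and N: "0 < N" and lam: "0 < lam" and A: "A \<in> sets (past s)"
  defines "b \<equiv> \<lambda>k x. incr s (s + real k * v / real N) i x"
  shows "lam ^ 4 * prob (A \<inter> {x \<in> space M. \<exists>k\<le>N. lam \<le> \<bar>b k x\<bar>}) \<le> 3 * v\<^sup>2 * prob A"
proof -
  define r where "r k = s + real k * v / real N" for k
  have r: "s \<le> r k" "k \<le> l \<Longrightarrow> r k \<le> r l" for k l
    using v N by (auto simp: r_def intro!: divide_right_mono mult_right_mono)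
  have rN: "r N = s + v" using N by (simp add: r_def)
  have b: "b k x = incr s (r k) i x" for k x by (simp add: b_def r_def)
  have b_past: "b k \<in> borel_measurable (past (r l))" if "k \<le> l" for k l
    unfolding b using s r that by (intro incr_measurable_past) auto
  define E where "E k = A \<inter> {x \<in> space M. lam \<le> \<bar>b k x\<bar> \<and> (\<forall>l<k. \<bar>b l x\<bar> < lam)}" for k
  have E: "E k \<in> sets (past (r k))" for k
  proof -
    have "{x \<in> space (past (r k)). lam \<le> \<bar>b k x\<bar>} \<in> sets (past (r k))"
      using b_past[of k k] by measurable
    moreover have "{x \<in> space (past (r k)). \<forall>l\<in>{..<k}. \<bar>b l x\<bar> < lam} \<in> sets (past (r k))"
    proof (rule sets.sets_Collect_finite_All)
      fix l assume "l \<in> {..<k}"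
      then have [measurable]: "b l \<in> borel_measurable (past (r k))" using b_past[of l k] by simp
      show "{x \<in> space (past (r k)). \<bar>b l x\<bar> < lam} \<in> sets (past (r k))" by measurable
    qed simp
    moreover have "A \<in> sets (past (r k))" using A sets_past_mono[OF r(1)] by blast
    ultimately have "A \<inter> ({x \<in> space (past (r k)). lam \<le> \<bar>b k x\<bar>} \<inter>
        {x \<in> space (past (r k)). \<forall>l\<in>{..<k}. \<bar>b l x\<bar> < lam}) \<in> sets (past (r k))"
      by (intro sets.Int)
    also have "A \<inter> ({x \<in> space (past (r k)). lam \<le> \<bar>b k x\<bar>} \<inter>
        {x \<in> space (past (r k)). \<forall>l\<in>{..<k}. \<bar>b l x\<bar> < lam}) = E k"
      by (auto simp: E_def)
    finally show ?thesis .
  qed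
  have AM: "A \<in> sets M" and EM: "E k \<in> sets M" for k using A E sets_past_subset by blast+
  have int: "integrable M (\<lambda>x. indicator F x * b k x ^ 4)" if "F \<in> sets M" for F k
    using integrable_mult_indicator[OF that incr_power_integrable[of s "r k" i 4]] s r(1) by (simp add: b)
  have "A \<inter> {x \<in> space M. \<exists>k\<le>N. lam \<le> \<bar>b k x\<bar>} \<subseteq> (\<Union>k\<le>N. E k)"
  proof
    fix x assume w: "x \<in> A \<inter> {x \<in> space M. \<exists>k\<le>N. lam \<le> \<bar>b k x\<bar>}"
    define k where "k = (LEAST k. lam \<le> \<bar>b k x\<bar>)"
    obtain k' where k': "k' \<le> N" "lam \<le> \<bar>b k' x\<bar>" using w by auto
    have "lam \<le> \<bar>b k x\<bar>" "k \<le> N"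
      using LeastI[of "\<lambda>k. lam \<le> \<bar>b k x\<bar>" k'] Least_le[of "\<lambda>k. lam \<le> \<bar>b k x\<bar>" k'] k' by (auto simp: k_def)
    moreover have "\<bar>b l x\<bar> < lam" if "l < k" for l
      using not_less_Least[of l "\<lambda>k. lam \<le> \<bar>b k x\<bar>"] that by (auto simp: k_def)
    ultimately show "x \<in> (\<Union>k\<le>N. E k)" using w by (auto simp: E_def)
  qed
  then have "prob (A \<inter> {x \<in> space M. \<exists>k\<le>N. lam \<le> \<bar>b k x\<bar>}) \<le> prob (\<Union>k\<le>N. E k)"
    by (rule finite_measure_mono) (use EM in auto)
  also have "\<dots> \<le> (\<Sum>k\<le>N. prob (E k))"
    by (rule finite_measure_subadditive_finite) (use EM in auto)
  finally have "lam ^ 4 * prob (A \<inter> {x \<in> space M. \<exists>k\<le>N. lam \<le> \<bar>b k x\<bar>}) \<le> lam ^ 4 * (\<Sum>k\<le>N. prob (E k))"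
    by (intro mult_left_mono) auto
  also have "\<dots> = (\<Sum>k\<le>N. lam ^ 4 * prob (E k))" by (rule sum_distrib_left)
  also have "\<dots> \<le> (\<Sum>k\<le>N. expectation (\<lambda>x. indicator (E k) x * b N x ^ 4))"
  proof (rule sum_mono)
    fix k assume k: "k \<in> {..N}"
    have "lam ^ 4 * prob (E k) = expectation (\<lambda>x. indicator (E k) x * lam ^ 4)"
      using EM[of k] by simp
    also have "\<dots> \<le> expectation (\<lambda>x. indicator (E k) x * b k x ^ 4)"
    proof (rule integral_mono)
      fix x
      have "lam ^ 4 \<le> \<bar>b k x\<bar> ^ 4" if "x \<in> E k"
        using that lam by (intro power_mono) (auto simp: E_def)
      then show "indicator (E k) x * lam ^ 4 \<le> indicator (E k) x * b k x ^ 4"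
        by (simp add: indicator_def power_even_abs)
    qed (use EM[of k] in \<open>auto intro: int simp: integrable_real_indicator emeasure_eq_measure\<close>)
    also have "\<dots> \<le> expectation (\<lambda>x. indicator (E k) x * b N x ^ 4)"
      unfolding b using s r k E by (intro fourth_power_submartingale) auto
    finally show "lam ^ 4 * prob (E k) \<le> expectation (\<lambda>x. indicator (E k) x * b N x ^ 4)" .
  qed
  also have "\<dots> = expectation (\<lambda>x. \<Sum>k\<le>N. indicator (E k) x * b N x ^ 4)"
    by (rule Bochner_Integration.integral_sum[symmetric]) (rule int[OF EM])
  also have "\<dots> \<le> expectation (\<lambda>x. indicator A x * b N x ^ 4)"
  proof (rule integral_mono)
    show "integrable M (\<lambda>x. \<Sum>k\<le>N. indicator (E k) x * b N x ^ 4)"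
      by (intro Bochner_Integration.integrable_sum int EM)
    show "integrable M (\<lambda>x. indicator A x * b N x ^ 4)" by (rule int[OF AM])
    fix x
    have "(\<Sum>k\<le>N. indicator (E k) x) \<le> (indicator A x :: real)"
    proof (cases "\<exists>k\<le>N. x \<in> E k")
      case True
      then obtain k where k: "k \<le> N" "x \<in> E k" by blast
      have "x \<notin> E l" if "l \<noteq> k" for l
        using that k(2) by (cases l k rule: linorder_cases) (auto simp: E_def not_le[symmetric])
      then have "(\<Sum>l\<le>N. indicator (E l) x) = (\<Sum>l\<in>{k}. indicator (E l) x :: real)"
        using k by (intro sum.mono_neutral_right) auto
      then show ?thesis using k by (auto simp: E_def)
    qed (auto simp: indicator_def)
    then show "(\<Sum>k\<le>N. indicator (E k) x * b N x ^ 4) \<le> indicator A x * b N x ^ 4"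
      unfolding sum_distrib_right[symmetric] by (rule mult_right_mono) simp
  qed
  also have "\<dots> = 3 * v\<^sup>2 * prob A"
  proof -
    have g: "(\<lambda>x :: real ^ 'd. (x $ i) ^ 4) \<in> borel_measurable borel"
      by (intro borel_measurable_continuous_onI continuous_intros)
    have sv: "s < s + v" using v by simp
    have h: "(indicator A :: _ \<Rightarrow> real) \<in> borel_measurable (past s)" "integrable M (indicator A :: _ \<Rightarrow> real)"
      using A AM by (auto simp: integrable_real_indicator emeasure_eq_measure)
    show ?thesis
      using past_indep_compose(2)[OF s sv h g incr_moment(1)[OF s sv]] incr_moments(2)[OF s sv, of i] AM
      by (simp add: b rN)
  qed
  finally show ?thesis .
qed

lemma coordinate_measurable_at:
  assumes "U \<in> borel_measurable M" "V \<in> borel_measurable M"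
    and "\<And>x. x \<in> space M \<Longrightarrow> 0 \<le> U x" "\<And>x. x \<in> space M \<Longrightarrow> 0 \<le> V x"
  shows "(\<lambda>x. incr (V x) (U x) i x) \<in> borel_measurable M"
proof -
  have "(\<lambda>x. B (U x) x - B (V x) x) \<in> borel_measurable M"
    using assms by (intro borel_measurable_diff measurable_at_random_time)
  then show ?thesis by (rule measurable_compose) (intro borel_measurable_continuous_onI continuous_intros)
qed

text \<open>Rational offsets keep the event measurable; by path continuity they detect an excess at
  any real offset (\<open>exceedsI\<close>).\<close>

definition exceeds :: "('w \<Rightarrow> real) \<Rightarrow> 'd \<Rightarrow> real \<Rightarrow> real \<Rightarrow> 'w set" where
  "exceeds S i v lam = {x \<in> space M. \<exists>q\<in>\<rat> \<inter> {0..v}. lam < \<bar>incr (S x) (S x + q) i x\<bar>}"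

lemma exceeds_sets:
  assumes "optional S"
  shows "exceeds S i v lam \<in> sets M"
proof -
  note [measurable] = optional_measurable[OF assms]
  have "exceeds S i v lam = (\<Union>q\<in>\<rat> \<inter> {0..v}. {x \<in> space M. lam < \<bar>incr (S x) (S x + q) i x\<bar>})"
    by (auto simp: exceeds_def)
  also have "\<dots> \<in> sets M"
  proof (rule sets.countable_UN'')
    show "countable (\<rat> \<inter> {0..v})" using countable_rat by blast
  next
    fix q assume q: "q \<in> \<rat> \<inter> {0..v}"
    have [measurable]: "(\<lambda>x. incr (S x) (S x + q) i x) \<in> borel_measurable M"
      using q optional_nonneg[OF assms] by (intro coordinate_measurable_at) auto
    show "{x \<in> space M. lam < \<bar>incr (S x) (S x + q) i x\<bar>} \<in> sets M" by measurable
  qed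
  finally show ?thesis .
qed

text \<open>Both the start S and the offsets are put on grids. Cutting A by the grid value of S
  reduces each level to \<open>maximal_inequality\<close> at a deterministic time, and continuity of
  paths removes the grids.\<close>

lemma prob_exceeds:
  assumes S: "optional S" and bound: "\<And>x. x \<in> space M \<Longrightarrow> S x < real n"
    and A: "prior S (indicator A)" "A \<in> sets M" and v: "0 < v" and lam: "0 < lam"
  shows "prob (A \<inter> exceeds S i v lam) \<le> 3 * v\<^sup>2 / lam ^ 4 * prob A"
proof -
  note [measurable] = optional_measurable[OF S] A(2)
  let ?c = "3 * v\<^sup>2 / lam ^ 4"
  let ?s = "\<lambda>m x. real (dyadic_index m (S x)) / 2 ^ m"
  define O' where "O' m = {x \<in> space M. \<exists>k\<le>2 ^ m. lam \<le> \<bar>incr (?s m x) (?s m x + real k * v / real (2 ^ m)) i x\<bar>}" for m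
  have [measurable]: "O' m \<in> sets M" for m
  proof -
    have [measurable]: "(\<lambda>x. incr (?s m x) (?s m x + real k * v / real (2 ^ m)) i x) \<in> borel_measurable M" for k
      using v by (intro coordinate_measurable_at) auto
    show ?thesis unfolding O'_def by measurable
  qed
  have dyadic: "prob (A \<inter> O' m) \<le> ?c * prob A" for m
  proof -
    let ?K = "n * 2 ^ m"
    define A' where "A' l = A \<inter> {x \<in> space M. dyadic_index m (S x) = l}" for l
    have A': "A' l \<in> sets (past (real l / 2 ^ m))" for l
      unfolding A'_def using S A(1) sets.sets_into_space[OF A(2)] by (intro prior_indicator_dyadic_eq)
    then have A'M: "A' l \<in> sets M" for l using sets_past_subset by blast
    have K: "dyadic_index m (S x) \<le> ?K" if "x \<in> space M" for x
      using dyadic_index_le_iff[OF optional_nonneg[OF S that], of m ?K] bound[OF that] by simp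
    have disj: "disjoint_family_on A' {..?K}" by (auto simp: disjoint_family_on_def A'_def)
    have A_eq: "A = (\<Union>l\<le>?K. A' l)" using K sets.sets_into_space[OF A(2)] by (auto simp: A'_def)
    have "A \<inter> O' m = (\<Union>l\<le>?K. A' l \<inter> O' m)" using A_eq by blast
    also have "prob \<dots> \<le> (\<Sum>l\<le>?K. prob (A' l \<inter> O' m))"
      by (rule finite_measure_subadditive_finite) (use A'M in auto)
    also have "\<dots> \<le> (\<Sum>l\<le>?K. ?c * prob (A' l))"
    proof (rule sum_mono)
      fix l
      have "A' l \<inter> O' m = A' l \<inter> {x \<in> space M. \<exists>k\<le>2 ^ m.
          lam \<le> \<bar>incr (real l / 2 ^ m) (real l / 2 ^ m + real k * v / real (2 ^ m)) i x\<bar>}"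
        by (auto simp: A'_def O'_def)
      moreover have "lam ^ 4 * prob (A' l \<inter> {x \<in> space M. \<exists>k\<le>2 ^ m.
          lam \<le> \<bar>incr (real l / 2 ^ m) (real l / 2 ^ m + real k * v / real (2 ^ m)) i x\<bar>}) \<le> 3 * v\<^sup>2 * prob (A' l)"
        by (rule maximal_inequality) (use v lam A' in auto)
      ultimately show "prob (A' l \<inter> O' m) \<le> ?c * prob (A' l)"
        using lam by (simp add: field_simps)
    qed
    also have "\<dots> = ?c * prob A"
      unfolding sum_distrib_left[symmetric]
      using finite_measure_finite_Union[of "{..?K}" A'] A'M disj A_eq by (simp add: image_subset_iff)
    finally show ?thesis .
  qed
  \<comment> \<open>The grid events are not monotone in m, so the limit is taken over the increasing
    events that they hold from m on. The strict level in \<open>exceeds\<close> against the weak one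
    in \<open>O'\<close> puts every excess into one of them.\<close>
  define U where "U m = A \<inter> (\<Inter>k\<in>{m..}. O' k)" for m
  have U: "U m \<in> sets M" for m unfolding U_def using A(2) by (intro sets.Int sets.countable_INT) auto
  have "incseq U" by (force simp: incseq_def U_def)
  then have "(\<lambda>m. prob (U m)) \<longlonglongrightarrow> prob (\<Union>m. U m)"
    using U by (intro finite_Lim_measure_incseq) auto
  moreover have "prob (U m) \<le> ?c * prob A" for m
  proof -
    have "U m \<subseteq> A \<inter> O' m" by (auto simp: U_def)
    then have "prob (U m) \<le> prob (A \<inter> O' m)" by (rule finite_measure_mono) auto
    then show ?thesis using dyadic[of m] by linarith
  qed
  ultimately have "prob (\<Union>m. U m) \<le> ?c * prob A" by (intro LIMSEQ_le_const2) auto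
  moreover have "A \<inter> exceeds S i v lam \<subseteq> (\<Union>m. U m)"
  proof
    fix x assume w: "x \<in> A \<inter> exceeds S i v lam"
    then have wM: "x \<in> space M" by (simp add: exceeds_def)
    obtain q where q: "0 \<le> q" "q \<le> v" "lam < \<bar>incr (S x) (S x + q) i x\<bar>"
      using w by (auto simp: exceeds_def)
    \<comment> \<open>The grid offset just below q, at distance at most
      \<open>v / 2 ^ m\<close>.\<close>
    define k where "k m = nat \<lfloor>q / v * 2 ^ m\<rfloor>" for m
    have k1: "k m \<le> 2 ^ m" for m
    proof -
      have "q / v * 2 ^ m \<le> 1 * 2 ^ m" using q v by (intro mult_right_mono) auto
      then show ?thesis by (simp add: k_def nat_le_iff floor_le_iff)
    qed
    have k2: "(\<lambda>m. real (k m) * v / real (2 ^ m)) \<longlonglongrightarrow> q"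
    proof (rule tendsto_sandwich[of "\<lambda>m. q - v * (1 / 2 ^ m)" _ _ "\<lambda>_. q"])
      show "(\<lambda>m. q - v * (1 / 2 ^ m)) \<longlonglongrightarrow> q"
        using tendsto_diff[OF tendsto_const tendsto_mult[OF tendsto_const half_power_tendsto], of q v] by simp
      have nn: "0 \<le> q / v * 2 ^ m" for m using q v by simp
      have kr: "real (k m) = of_int \<lfloor>q / v * 2 ^ m\<rfloor>" for m
        using nn[of m] by (simp add: k_def)
      have lo: "q / v * 2 ^ m - 1 \<le> real (k m)" and hi: "real (k m) \<le> q / v * 2 ^ m" for m
        unfolding kr by linarith+
      show "\<forall>\<^sub>F m in sequentially. q - v * (1 / 2 ^ m) \<le> real (k m) * v / real (2 ^ m)"
      proof (rule always_eventually, rule allI)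
        fix m
        have "(q / v * 2 ^ m - 1) * v / 2 ^ m \<le> real (k m) * v / 2 ^ m"
          using lo[of m] v by (intro divide_right_mono mult_right_mono) auto
        moreover have "(q / v * 2 ^ m - 1) * v / 2 ^ m = q - v * (1 / 2 ^ m)"
          using v by (simp add: field_simps)
        ultimately show "q - v * (1 / 2 ^ m) \<le> real (k m) * v / real (2 ^ m)" by simp
      qed
      show "\<forall>\<^sub>F m in sequentially. real (k m) * v / real (2 ^ m) \<le> q"
      proof (rule always_eventually, rule allI)
        fix m
        have "real (k m) * v / 2 ^ m \<le> (q / v * 2 ^ m) * v / 2 ^ m"
          using hi[of m] v by (intro divide_right_mono mult_right_mono) auto
        then show "real (k m) * v / real (2 ^ m) \<le> q"
          using v by simp
      qed
    qed simp
    have s: "(\<lambda>m. ?s m x) \<longlonglongrightarrow> S x" by (rule dyadic_index_tendsto[OF optional_nonneg[OF S wM]])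
    have "(\<lambda>m. \<bar>incr (?s m x) (?s m x + real (k m) * v / real (2 ^ m)) i x\<bar>)
        \<longlonglongrightarrow> \<bar>incr (S x) (S x + q) i x\<bar>"
      using v by (intro tendsto_rabs tendsto_vec_nth tendsto_diff
          continuous_on_Ici_tendsto[OF continuous_paths[OF wM]] tendsto_add s k2) auto
    from order_tendstoD(1)[OF this q(3)]
    obtain m where m: "\<And>l. m \<le> l \<Longrightarrow>
        lam < \<bar>incr (?s l x) (?s l x + real (k l) * v / real (2 ^ l)) i x\<bar>"
      unfolding eventually_sequentially by blast
    have "x \<in> O' l" if "m \<le> l" for l
      using m[OF that] k1[of l] wM unfolding O'_def by (auto intro!: exI[of _ "k l"] less_imp_le)
    then have "x \<in> U m" using w by (auto simp: U_def)
    then show "x \<in> (\<Union>m. U m)" by blast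
  qed
  then have "prob (A \<inter> exceeds S i v lam) \<le> prob (\<Union>m. U m)"
    by (rule finite_measure_mono) (use U in auto)
  ultimately show ?thesis by linarith
qed

text \<open>The rational offset is sought to the left of r, so that it stays in [0, v] even for
  \<open>r = v\<close>.\<close>

lemma exceedsI:
  assumes w: "x \<in> space M" and S: "optional S" and r: "0 < r" "r \<le> v"
    and ex: "lam < \<bar>incr (S x) (S x + r) i x\<bar>"
  shows "x \<in> exceeds S i v lam"
proof -
  have "continuous_on {0<..} (\<lambda>q. \<bar>incr (S x) (S x + q) i x\<bar>)"
    by (intro continuous_intros continuous_on_compose2[OF continuous_paths[OF w]])
       (use optional_nonneg[OF S w] in auto)
  then have "isCont (\<lambda>q. \<bar>incr (S x) (S x + q) i x\<bar>) r"
    using r by (simp add: continuous_on_eq_continuous_at)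
  then have "((\<lambda>q. \<bar>incr (S x) (S x + q) i x\<bar>) \<longlongrightarrow> \<bar>incr (S x) (S x + r) i x\<bar>) (at_left r)"
    unfolding isCont_def by (rule filterlim_mono) (auto simp: at_le)
  from order_tendstoD(1)[OF this ex] obtain b where b: "b < r"
      "\<And>q. b < q \<Longrightarrow> q < r \<Longrightarrow> lam < \<bar>incr (S x) (S x + q) i x\<bar>"
    unfolding eventually_at_left_field by blast
  obtain q where "q \<in> \<rat>" "max b 0 < q" "q < r"
    using Rats_dense_in_real[of "max b 0" r] b(1) r by auto
  then show ?thesis using b(2)[of q] r w by (auto simp: exceeds_def intro!: bexI[of _ q])
qed

end

lemma dyadic_scale:
  fixes u :: real
  assumes "0 < u" "u \<le> (1 / 2) ^ k0"
  obtains k where "k0 \<le> k" "(1 / 2) ^ Suc k < u" "u \<le> (1 / 2) ^ k"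
proof -
  define n where "n = (LEAST n. (1 / 2) ^ n < u)"
  obtain n0 :: nat where n0: "(1 / 2) ^ n0 < u" using real_arch_pow_inv[OF assms(1), of "1 / 2"] by auto
  have n: "(1 / 2) ^ n < u" unfolding n_def using LeastI[of "\<lambda>n. (1 / 2) ^ n < u" n0] n0 by simp
  have less: "u \<le> (1 / 2) ^ l" if "l < n" for l
    using not_less_Least[of l "\<lambda>n. (1 / 2) ^ n < u"] that by (auto simp: n_def)
  have "k0 < n"
  proof (rule ccontr)
    assume "\<not> k0 < n"
    then have "(1 / 2 :: real) ^ k0 \<le> (1 / 2) ^ n" by (intro power_decreasing) auto
    then show False using n assms by linarith
  qed
  then show thesis using n less[of "n - 1"] by (intro that[of "n - 1"]) auto
qed

section \<open>Brownian motion inside the moving sphere at small times\<close>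

context anchored_brownian_motion
begin

text \<open>On the block \<open>2\<^sup>-\<^sup>k\<^sup>-\<^sup>1 < u \<le> 2\<^sup>-\<^sup>k\<close> the fourth-power maximal inequality gives a probability of
  order \<open>1/k\<^sup>2\<close>, because the squared radius is at least of order \<open>k 2\<^sup>-\<^sup>k\<close> there. The random scale
  \<open>\<sigma>\<close> is localised between powers of 2.\<close>

lemma small_time_inside:
  assumes kappa: "0 < \<kappa>"
  shows "\<exists>\<delta>>0. \<forall>S \<sigma>. optional S \<and> (\<exists>n. \<forall>x\<in>space M. S x < real n) \<and> prior S \<sigma> \<and> (\<forall>x\<in>space M. 0 < \<sigma> x) \<longrightarrow>
    (\<exists>Bad\<in>sets M. (\<forall>A\<in>sets M. prior S (indicator A) \<longrightarrow> prob (A \<inter> Bad) \<le> \<kappa> * prob A) \<and>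
      (\<forall>x\<in>space M - Bad. \<forall>u. 0 < u \<and> u \<le> \<delta> \<longrightarrow>
        (norm (B (S x + u * \<sigma> x) x - B (S x) x))\<^sup>2 < real CARD('d) * (\<sigma> x * (u * ln (1 / u)))))"
proof -
  let ?d = "real CARD('d)"
  \<comment> \<open>\<open>prob_exceeds\<close> with length 2 q and a level whose fourth power is (q
    k)^2 / 16 gives 3 * 4 * 16 / k^2 for each coordinate; the factor \<open>?d\<close> comes from
    the union over the coordinates.\<close>
  have "summable (\<lambda>k. 192 * ?d * (1 / real k ^ 2))"
    using inverse_power_summable[of 2, where 'a = real] by (intro summable_mult) (simp add: inverse_eq_divide)
  from suminf_exist_split[OF kappa this] obtain k1 where
    k1: "\<And>n. n \<ge> k1 \<Longrightarrow> norm (\<Sum>i. 192 * ?d * (1 / real (i + n) ^ 2)) < \<kappa>" by blast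
  \<comment> \<open>The tail from \<open>k1\<close> on fits below \<kappa>; starting at 1 or later
    keeps all the levels \<open>lam\<close> positive.\<close>
  define k0 where "k0 = max k1 1"
  have k0: "1 \<le> k0" by (simp add: k0_def)
  define e where "e k = 192 * ?d * (1 / real (k + k0) ^ 2)" for k
  have e_sum: "summable e"
    unfolding e_def using \<open>summable (\<lambda>k. 192 * ?d * (1 / real k ^ 2))\<close>
    by (rule summable_ignore_initial_segment[of _ k0])
  have e0: "0 \<le> e k" for k by (simp add: e_def)
  have "norm (suminf e) < \<kappa>" unfolding e_def by (rule k1) (simp add: k0_def)
  then have e: "suminf e \<le> \<kappa>" by simp
  show ?thesis
  proof (intro exI[of _ "(1 / 2) ^ k0"] conjI allI impI)
    fix S \<sigma> :: "'w \<Rightarrow> real"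
    assume *: "optional S \<and> (\<exists>n. \<forall>x\<in>space M. S x < real n) \<and> prior S \<sigma> \<and> (\<forall>x\<in>space M. 0 < \<sigma> x)"
    then have S: "optional S" and \<sigma>: "prior S \<sigma>" and pos: "\<And>x. x \<in> space M \<Longrightarrow> 0 < \<sigma> x" by auto
    from * obtain n where bound: "\<And>x. x \<in> space M \<Longrightarrow> S x < real n" by blast
    have [measurable]: "\<sigma> \<in> borel_measurable M" using prior_measurable[OF \<sigma> bound] .
    define J where "J j = {x \<in> space M. \<lfloor>log 2 (\<sigma> x)\<rfloor> = j}" for j :: int
    have J [measurable]: "J j \<in> sets M" for j unfolding J_def by measurable
    define q where "q j k = 2 powi j * (1 / 2 :: real) ^ k" for j :: int and k :: nat
    have q: "0 < q j k" for j k by (simp add: q_def)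
    \<comment> \<open>Squares of all coordinates at most q k / 4 suffice: on the block u exceeds
      2^-(k+1), the scale is at least 2^j, and \<open>ln (1 / u)\<close> is at least k ln 2, which
      exceeds k / 2. The length 2 q used with it covers \<open>u * \<sigma> x\<close>, as the scale
      is at most 2 * 2^j.\<close>
    define lam where "lam j k = sqrt (q j k * real k) / 2" for j k
    define O' where "O' k i j = J j \<inter> exceeds S i (2 * q j k) (lam j k)" for k i j
    have O' [measurable]: "O' k i j \<in> sets M" for k i j
      unfolding O'_def using exceeds_sets[OF S] by auto
    define Bad where "Bad = (\<Union>k. \<Union>i. \<Union>j. O' (k + k0) i j)"
    have Bad [measurable]: "Bad \<in> sets M" unfolding Bad_def by measurable
    have prior_J: "prior S (indicator (A \<inter> J j))" if A: "prior S (indicator A)" for A j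
      unfolding prior_def
    proof (intro allI impI)
      fix t :: real assume t: "0 \<le> t"
      have [measurable]: "(\<lambda>x. if S x < t then indicator A x else 0 :: real) \<in> borel_measurable (past t)"
        "(\<lambda>x. if S x < t then \<sigma> x else 0) \<in> borel_measurable (past t)"
        using A \<sigma> t by (auto simp: prior_def)
      \<comment> \<open>The value of \<sigma> need not be known at time t where
        \<open>S x < t\<close> fails; it is replaced by 0 there, and the first factor removes that
        part.\<close>
      have "(\<lambda>x. (if S x < t then indicator A x else 0) *
          of_bool (\<lfloor>log 2 (if S x < t then \<sigma> x else 0)\<rfloor> = j) :: real) \<in> borel_measurable (past t)"
        by measurable
      then show "(\<lambda>x. if S x < t then indicator (A \<inter> J j) x else 0 :: real) \<in> borel_measurable (past t)"
        by (rule measurable_cong[THEN iffD1, rotated]) (auto simp: J_def indicator_def)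
    qed
    have one: "emeasure M (A \<inter> (\<Union>j. O' k i j)) \<le> ennreal (192 / real k ^ 2 * prob A)"
      if A: "A \<in> sets M" "prior S (indicator A)" and k: "1 \<le> k" for A k i
    proof -
      have "A \<inter> (\<Union>j. O' k i j) = (\<Union>j. (A \<inter> J j) \<inter> exceeds S i (2 * q j k) (lam j k))"
        by (auto simp: O'_def)
      also have "emeasure M \<dots> = (\<integral>\<^sup>+j. emeasure M ((A \<inter> J j) \<inter> exceeds S i (2 * q j k) (lam j k)) \<partial>count_space UNIV)"
        using A(1) exceeds_sets[OF S]
        by (intro emeasure_UN_countable) (auto simp: disjoint_family_on_def J_def)
      also have "\<dots> \<le> (\<integral>\<^sup>+j. ennreal (192 / real k ^ 2) * emeasure M (A \<inter> J j) \<partial>count_space UNIV)"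
      proof (rule nn_integral_mono)
        fix j
        have lam: "0 < lam j k" using q[of j k] k by (simp add: lam_def)
        have lam4: "lam j k ^ 4 = (q j k * real k)\<^sup>2 / 16"
        proof -
          have "lam j k ^ 4 = ((sqrt (q j k * real k))\<^sup>2)\<^sup>2 / 16"
            unfolding lam_def by (simp only: power_divide power_mult[symmetric]) simp
          then show ?thesis using q[of j k] by simp
        qed
        have "prob ((A \<inter> J j) \<inter> exceeds S i (2 * q j k) (lam j k)) \<le> 3 * (2 * q j k)\<^sup>2 / lam j k ^ 4 * prob (A \<inter> J j)"
          by (rule prob_exceeds[OF S bound prior_J[OF A(2)]]) (use A(1) q[of j k] lam in auto)
        also have "3 * (2 * q j k)\<^sup>2 / lam j k ^ 4 = 192 / real k ^ 2"
          unfolding lam4 using q[of j k] k by (simp add: power_mult_distrib field_simps)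
        finally show "emeasure M ((A \<inter> J j) \<inter> exceeds S i (2 * q j k) (lam j k)) \<le> ennreal (192 / real k ^ 2) * emeasure M (A \<inter> J j)"
          by (simp add: emeasure_eq_measure ennreal_mult[symmetric] ennreal_leI)
      qed
      also have "\<dots> = ennreal (192 / real k ^ 2) * (\<integral>\<^sup>+j. emeasure M (A \<inter> J j) \<partial>count_space UNIV)"
        by (rule nn_integral_cmult) simp
      also have "(\<integral>\<^sup>+j. emeasure M (A \<inter> J j) \<partial>count_space UNIV) = emeasure M (\<Union>j. A \<inter> J j)"
        using A(1) by (intro emeasure_UN_countable[symmetric]) (auto simp: disjoint_family_on_def J_def)
      also have "(\<Union>j. A \<inter> J j) = A" using sets.sets_into_space[OF A(1)] by (auto simp: J_def)
      also have "ennreal (192 / real k ^ 2) * emeasure M A = ennreal (192 / real k ^ 2 * prob A)"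
        unfolding emeasure_eq_measure by (rule ennreal_mult[symmetric]) auto
      finally show ?thesis .
    qed
    show "\<exists>Bad\<in>sets M. (\<forall>A\<in>sets M. prior S (indicator A) \<longrightarrow> prob (A \<inter> Bad) \<le> \<kappa> * prob A) \<and>
         (\<forall>x\<in>space M - Bad. \<forall>u. 0 < u \<and> u \<le> (1 / 2) ^ k0 \<longrightarrow>
            (norm (B (S x + u * \<sigma> x) x - B (S x) x))\<^sup>2 < ?d * (\<sigma> x * (u * ln (1 / u))))"
    proof (intro bexI[OF _ Bad] conjI ballI impI allI)
      fix A assume A: "A \<in> sets M" "prior S (indicator A)"
      have block: "emeasure M (A \<inter> (\<Union>i. \<Union>j. O' (k + k0) i j)) \<le> ennreal (e k * prob A)" for k
      proof -
        have "A \<inter> (\<Union>i. \<Union>j. O' (k + k0) i j) = (\<Union>i\<in>UNIV. A \<inter> (\<Union>j. O' (k + k0) i j))" by auto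
        also have "emeasure M \<dots> \<le> (\<Sum>i\<in>UNIV. emeasure M (A \<inter> (\<Union>j. O' (k + k0) i j)))"
          using A(1) by (intro emeasure_subadditive_finite) auto
        also have "\<dots> \<le> (\<Sum>i\<in>(UNIV :: 'd set). ennreal (192 / real (k + k0) ^ 2 * prob A))"
          using one[OF A, of "k + k0"] k0 by (intro sum_mono) auto
        also have "\<dots> = ennreal (e k * prob A)"
          by (simp add: e_def ennreal_mult[symmetric] ennreal_of_nat_eq_real_of_nat mult_ac)
        finally show ?thesis .
      qed
      have "A \<inter> Bad = (\<Union>k. A \<inter> (\<Union>i. \<Union>j. O' (k + k0) i j))" by (auto simp: Bad_def)
      also have "emeasure M \<dots> \<le> (\<Sum>k. emeasure M (A \<inter> (\<Union>i. \<Union>j. O' (k + k0) i j)))"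
        using A(1) by (intro emeasure_subadditive_countably) auto
      also have "\<dots> \<le> (\<Sum>k. ennreal (e k * prob A))"
        using block by (intro suminf_le) auto
      also have "\<dots> = ennreal (\<Sum>k. e k * prob A)"
        using e0 e_sum by (intro suminf_ennreal2 summable_mult2) auto
      also have "(\<Sum>k. e k * prob A) = suminf e * prob A" using e_sum by (rule suminf_mult2[symmetric])
      finally have "prob (A \<inter> Bad) \<le> suminf e * prob A"
        using suminf_nonneg[OF e_sum e0] by (simp add: emeasure_eq_measure)
      also have "\<dots> \<le> \<kappa> * prob A" using e by (rule mult_right_mono) simp
      finally show "prob (A \<inter> Bad) \<le> \<kappa> * prob A" .
    next
      fix x and u :: real assume w: "x \<in> space M - Bad" and u: "0 < u \<and> u \<le> (1 / 2) ^ k0"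
      then have wM: "x \<in> space M" by simp
      let ?W = "B (S x + u * \<sigma> x) x - B (S x) x"
      obtain k where k: "k0 \<le> k" "(1 / 2) ^ Suc k < u" "u \<le> (1 / 2) ^ k"
        using dyadic_scale[of u k0] u by blast
      define j where "j = \<lfloor>log 2 (\<sigma> x)\<rfloor>"
      have s1: "2 powi j \<le> \<sigma> x"
      proof -
        have "2 powr (real_of_int j) \<le> 2 powr (log 2 (\<sigma> x))" unfolding j_def by (intro powr_mono) auto
        then show ?thesis using pos[OF wM] by (simp add: powr_real_of_int')
      qed
      have s2: "\<sigma> x \<le> 2 * 2 powi j"
      proof -
        have "2 powr (log 2 (\<sigma> x)) \<le> 2 powr (real_of_int j + 1)" unfolding j_def by (intro powr_mono) linarith+
        then show ?thesis using pos[OF wM] by (simp add: powr_add powr_real_of_int')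
      qed
      have small: "\<bar>?W $ i\<bar> \<le> lam j k" for i
      proof (rule ccontr)
        assume "\<not> ?thesis"
        then have "x \<in> exceeds S i (2 * q j k) (lam j k)"
        proof (intro exceedsI[OF wM S])
          show "0 < u * \<sigma> x" using u pos[OF wM] by simp
          have "u * \<sigma> x \<le> (1 / 2) ^ k * (2 * 2 powi j)"
            using k(3) s2 u pos[OF wM] by (intro mult_mono) auto
          then show "u * \<sigma> x \<le> 2 * q j k" by (simp add: q_def mult_ac)
        qed simp
        then have "x \<in> O' k i j" using wM by (simp add: O'_def J_def j_def)
        then have "x \<in> O' ((k - k0) + k0) i j" using k(1) by simp
        then have "x \<in> Bad" unfolding Bad_def by blast
        then show False using w by simp
      qed
      have ln_u: "real k * ln 2 \<le> ln (1 / u)"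
      proof -
        have "(2 :: real) ^ k \<le> 1 / u" using k(3) u by (simp add: field_simps)
        then have "ln ((2 :: real) ^ k) \<le> ln (1 / u)" using u by simp
        then show ?thesis by (simp add: ln_realpow)
      qed
      have ln2: "(1 / 2 :: real) < ln 2" using ln2_ge_two_thirds by linarith
      have half: "q j k * real k / 4 < \<sigma> x * (u * ln (1 / u))"
      proof -
        have k1: "1 \<le> k" using k(1) k0 by simp
        have "q j k * real k / 4 = 2 powi j * ((1 / 2) ^ Suc k * (real k * (1 / 2)))"
          by (simp add: q_def)
        also have "\<dots> < 2 powi j * ((1 / 2) ^ Suc k * (real k * ln 2))"
          using ln2 k1 by (intro mult_strict_left_mono) auto
        also have "\<dots> \<le> \<sigma> x * (u * ln (1 / u))"
          using s1 k(2) ln_u u less_imp_le[OF pos[OF wM]] by (intro mult_mono) auto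
        finally show ?thesis .
      qed
      have "(norm ?W)\<^sup>2 = (\<Sum>i\<in>UNIV. (?W $ i)\<^sup>2)"
        by (simp add: norm_vec_def L2_set_def sum_nonneg)
      also have "\<dots> \<le> (\<Sum>i\<in>(UNIV :: 'd set). q j k * real k / 4)"
      proof (rule sum_mono)
        fix i
        have "(?W $ i)\<^sup>2 \<le> (lam j k)\<^sup>2" using small[of i] by (simp add: abs_le_square_iff[symmetric])
        also have "\<dots> = q j k * real k / 4" using q[of j k] by (simp add: lam_def power_divide)
        finally show "(?W $ i)\<^sup>2 \<le> q j k * real k / 4" .
      qed
      also have "\<dots> < ?d * (\<sigma> x * (u * ln (1 / u)))" using half by simp
      finally show "(norm ?W)\<^sup>2 < ?d * (\<sigma> x * (u * ln (1 / u)))" .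
    qed
  qed simp
qed

end

section \<open>Decrease of the distance to the sphere\<close>

text \<open>Applying \<open>ln s \<le> s - 1\<close> to the square root of 1 - y, instead of 1 - y
  itself, gains the term (s - 1)^2. It controls y^2 because y = (1 - s) (1 + s) with s below 3/2,
  and (5/2)^2 is below 8.\<close>

lemma ln_one_minus_le:
  fixes y :: real
  assumes "\<bar>y\<bar> < 1"
  shows "ln (1 - y) \<le> - y - y\<^sup>2 / 8"
proof -
  define s where "s = sqrt (1 - y)"
  have s: "0 < s" "s\<^sup>2 = 1 - y" using assms by (auto simp: s_def)
  have "s\<^sup>2 < (3 / 2)\<^sup>2" using assms s(2) by (simp add: power2_eq_square)
  then have s32: "s < 3 / 2" by (rule power2_less_imp_less) simp
  have "ln (1 - y) = 2 * ln s" using s by (simp add: ln_realpow flip: s(2))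
  also have "\<dots> \<le> 2 * (s - 1)" using ln_le_minus_one[OF s(1)] by simp
  also have "\<dots> = - y - (s - 1)\<^sup>2" using s(2) by (simp add: power2_diff)
  also have "\<dots> \<le> - y - y\<^sup>2 / 8"
  proof -
    have "y = (1 - s) * (1 + s)" using s(2) by (simp add: power2_eq_square algebra_simps)
    then have "y\<^sup>2 = (s - 1)\<^sup>2 * (1 + s)\<^sup>2" by (simp add: power_mult_distrib power2_commute)
    also have "\<dots> \<le> (s - 1)\<^sup>2 * 8"
    proof (rule mult_left_mono)
      have "(1 + s)\<^sup>2 \<le> (5 / 2)\<^sup>2" using s(1) s32 by (intro power_mono) auto
      then show "(1 + s)\<^sup>2 \<le> 8" by (simp add: power2_eq_square)
    qed simp
    finally show ?thesis by simp
  qed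
  finally show ?thesis .
qed

text \<open>At the origin any unit vector serves: \<open>norm_direction\<close> and
  \<open>direction_inner\<close> hold for every choice.\<close>

definition direction :: "real ^ 'd \<Rightarrow> real ^ 'd" where
  "direction x = (if x = 0 then axis undefined 1 else x /\<^sub>R norm x)"

lemma norm_direction [simp]: "norm (direction x) = 1"
  by (simp add: direction_def)

lemma direction_inner: "direction x \<bullet> x = norm x"
  by (simp add: direction_def dot_square_norm power2_eq_square)

lemma borel_measurable_direction: "(\<lambda>x :: real ^ 'd. direction x $ i) \<in> borel_measurable borel"
proof -
  have [measurable]: "(\<lambda>x :: real ^ 'd. x $ i) \<in> borel_measurable borel"
    by (intro borel_measurable_continuous_onI continuous_intros)
  have "(\<lambda>x :: real ^ 'd. if x = 0 then axis undefined 1 $ i else x $ i / norm x) \<in> borel_measurable borel"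
    by measurable
  also have "(\<lambda>x :: real ^ 'd. if x = 0 then axis undefined 1 $ i else x $ i / norm x) = (\<lambda>x. direction x $ i)"
    by (auto simp: direction_def divide_inverse_commute)
  finally show ?thesis .
qed

section \<open>Pathwise estimates for the logarithm of the gap\<close>

context anchored_path
begin

abbreviation "gap n \<equiv> L - norm (X n)"
abbreviation "radial_step n \<equiv> (direction (X n) \<bullet> (X (Suc n) - X n)) / gap n"

lemma gap_pos: "0 < gap n"
  using pos_inside[of n] by simp

text \<open>Controls the overshoot: the step that enters the \<epsilon>-neighbourhood of the
  boundary lowers the logarithm of the gap by at most \<open>- ln (1 - \<gamma>)\<close>.\<close>

lemma gap_Suc_ge: "(1 - \<gamma>) * gap n \<le> gap (Suc n)"
  using step_bound[of n] norm_triangle_sub[of "X (Suc n)" "X n"] by (simp add: algebra_simps)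

lemma radial_step_bound: "\<bar>radial_step n\<bar> < 1"
proof -
  have "\<bar>direction (X n) \<bullet> (X (Suc n) - X n)\<bar> \<le> norm (X (Suc n) - X n)"
    using Cauchy_Schwarz_ineq2[of "direction (X n)" "X (Suc n) - X n"] by simp
  also have "\<dots> \<le> \<gamma> * gap n" by (rule step_bound)
  also have "\<dots> < 1 * gap n" using gamma gap_pos by (intro mult_strict_right_mono) auto
  finally show ?thesis using gap_pos[of n] by (simp add: abs_divide)
qed

lemma gap_Suc_le: "gap (Suc n) \<le> gap n * (1 - radial_step n)"
proof -
  have "norm (X n) + direction (X n) \<bullet> (X (Suc n) - X n) = direction (X n) \<bullet> X (Suc n)"
    by (simp add: inner_diff_right direction_inner)
  also have "\<dots> \<le> norm (X (Suc n))"
    using norm_cauchy_schwarz[of "direction (X n)" "X (Suc n)"] by simp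
  finally have "gap (Suc n) \<le> gap n - direction (X n) \<bullet> (X (Suc n) - X n)" by linarith
  also have "\<dots> = gap n * (1 - radial_step n)" using gap_pos[of n] by (simp add: right_diff_distrib)
  finally show ?thesis .
qed

lemma ln_gap_step: "ln (gap (Suc n)) - ln (gap n) \<le> - radial_step n - (radial_step n)\<^sup>2 / 8"
proof -
  have pos: "0 < 1 - radial_step n" using radial_step_bound[of n] by linarith
  have "ln (gap (Suc n)) \<le> ln (gap n * (1 - radial_step n))"
    using gap_Suc_le[of n] gap_pos[of "Suc n"] by simp
  also have "\<dots> = ln (gap n) + ln (1 - radial_step n)"
    using gap_pos[of n] pos by (rule ln_mult_pos)
  finally show ?thesis using ln_one_minus_le[OF radial_step_bound[of n]] by linarith
qed

text \<open>The sum telescopes up to the first index with gap at most \<epsilon>, and later summands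
  vanish. The last active step starts from a gap above \<epsilon> and keeps at least the fraction 1
  - \<gamma> of it; the initial gap is at most L.\<close>

lemma stopped_ln_gap_ge:
  assumes eps: "0 < \<epsilon>" "\<epsilon> < L"
  defines "In \<equiv> \<lambda>k. \<forall>j\<le>k. norm (X j) < L - \<epsilon>"
  shows "ln ((1 - \<gamma>) * \<epsilon>) - ln L \<le> (\<Sum>k<n. of_bool (In k) * (ln (gap (Suc k)) - ln (gap k)))"
proof (induction n)
  case 0
  have "(1 - \<gamma>) * \<epsilon> \<le> 1 * L" using gamma eps by (intro mult_mono) auto
  moreover have "0 < (1 - \<gamma>) * \<epsilon>" using gamma eps by simp
  ultimately show ?case using eps by simp
next
  case (Suc n)
  show ?case
  proof (cases "In n")
    case True
    then have In: "In k" if "k \<le> n" for k using that by (auto simp: In_def)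
    have "(\<Sum>k<Suc n. of_bool (In k) * (ln (gap (Suc k)) - ln (gap k))) = (\<Sum>k<Suc n. ln (gap (Suc k)) - ln (gap k))"
      using In by (intro sum.cong) auto
    also have "\<dots> = ln (gap (Suc n)) - ln (gap 0)" by (rule sum_lessThan_telescope)
    finally have eq: "(\<Sum>k<Suc n. of_bool (In k) * (ln (gap (Suc k)) - ln (gap k))) = ln (gap (Suc n)) - ln (gap 0)" .
    have "\<epsilon> \<le> gap n" using True by (auto simp: In_def dest: spec[of _ n])
    then have "(1 - \<gamma>) * \<epsilon> \<le> (1 - \<gamma>) * gap n" using gamma by (intro mult_left_mono) auto
    also note gap_Suc_ge[of n]
    finally have "ln ((1 - \<gamma>) * \<epsilon>) \<le> ln (gap (Suc n))" using gamma eps gap_pos[of "Suc n"] by simp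
    moreover have "ln (gap 0) \<le> ln L" using gap_pos[of 0] eps by simp
    ultimately show ?thesis unfolding eq by linarith
  qed (use Suc in simp)
qed

section \<open>Limit of the walk along a path with finite limit time\<close>

context
  assumes enters: enters
    and reach: "\<And>\<epsilon>. 0 < \<epsilon> \<Longrightarrow> \<exists>n. L - \<epsilon> \<le> norm (X n)"
    and bounded_time: "bdd_above (range T)"
begin

definition limit_time :: real where "limit_time = (SUP n. T n)"

lemma time_tendsto: "T \<longlonglongrightarrow> limit_time"
  unfolding limit_time_def by (rule LIMSEQ_incseq_SUP[OF bounded_time time_mono])

text \<open>Finitely many gaps stay away from 0, so any smaller level can be reached only at index m
  or later.\<close>

lemma gap_lower_bound: "\<exists>\<epsilon>>0. \<forall>k<m. \<epsilon> < gap k"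
proof (induction m)
  case (Suc m)
  then obtain \<epsilon> where "0 < \<epsilon>" "\<forall>k<m. \<epsilon> < gap k" by blast
  then show ?case using gap_pos[of m]
    by (intro exI[of _ "min \<epsilon> (gap m / 2)"]) (auto simp: less_Suc_eq min_less_iff_disj)
qed (auto intro: exI[of _ 1])

lemma walk_tendsto: "walk L \<gamma> x0 w \<longlonglongrightarrow> (w limit_time, limit_time)"
proof -
  have "(\<lambda>n. (w (T n), T n)) \<longlonglongrightarrow> (w limit_time, limit_time)"
    by (intro tendsto_Pair continuous_on_Ici_tendsto[OF cont] time_tendsto time_nonneg)
  then show ?thesis by (simp add: pos_eq[symmetric])
qed

lemma limit_on_boundary: "norm (w limit_time) = L"
proof -
  have "(\<lambda>n. norm (X n)) \<longlonglongrightarrow> norm (w limit_time)"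
    unfolding pos_eq by (intro tendsto_norm continuous_on_Ici_tendsto[OF cont] time_tendsto time_nonneg)
  then have lim: "gap \<longlonglongrightarrow> L - norm (w limit_time)" by (rule tendsto_diff[OF tendsto_const])
  have "0 \<le> L - norm (w limit_time)"
    by (rule LIMSEQ_le_const[OF lim]) (use gap_pos in \<open>auto intro: less_imp_le\<close>)
  moreover have "\<not> 0 < L - norm (w limit_time)"
  proof
    let ?d = "L - norm (w limit_time)"
    assume d: "0 < ?d"
    then have "\<forall>\<^sub>F n in sequentially. ?d / 2 < gap n" by (intro order_tendstoD(1)[OF lim]) simp
    then obtain m where m: "\<And>n. m \<le> n \<Longrightarrow> ?d / 2 < gap n" unfolding eventually_sequentially by blast
    obtain e where e: "0 < e" "\<And>k. k < m \<Longrightarrow> e < gap k" using gap_lower_bound[of m] by blast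
    \<comment> \<open>Gaps before m exceed e and those from m on exceed half the limit, so no index
      can reach this level.\<close>
    obtain n where "L - min e (?d / 2) \<le> norm (X n)" using reach[of "min e (?d / 2)"] e d by auto
    then have "gap n \<le> e" "gap n \<le> ?d / 2"
      using min.cobounded1[of e "?d / 2"] min.cobounded2[of e "?d / 2"] by linarith+
    then show False using m[of n] e(2)[of n] by (cases "m \<le> n") auto
  qed
  ultimately show ?thesis by simp
qed

lemma ball_exit_time_eq: "ball_exit_time L w = limit_time"
proof -
  let ?S = "{t. 0 < t \<and> norm (w t) = L}"
  have "0 < lifespan L \<gamma> (X 0) * \<rho> 0" using enters lifespan_pos[of 0] unfolding enters_def by (blast intro: mult_pos_pos)
  then have "0 < T 1" using wtime_Suc[of L \<gamma> x0 w 0] time_nonneg[of 0] by simp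
  also have "T 1 \<le> limit_time" unfolding limit_time_def by (rule cSUP_upper[OF _ bounded_time]) simp
  finally have mem: "limit_time \<in> ?S" using limit_on_boundary by simp
  have "limit_time \<le> t" if "t \<in> ?S" for t
  proof (rule ccontr)
    assume "\<not> limit_time \<le> t"
    then have "\<forall>\<^sub>F n in sequentially. t < T n" by (intro order_tendstoD(1)[OF time_tendsto]) simp
    then obtain n where "t < T n" unfolding eventually_sequentially by blast
    then show False using inside_until[OF enters, of t n] that by simp
  qed
  then have "Inf ?S = limit_time" using mem by (intro cInf_eq_minimum)
  then show ?thesis using mem first_time_nonempty[of ?S] by (auto simp: ball_exit_time_def)
qed

lemma outcome_tendsto:
  "((\<lambda>\<epsilon>. wms_outcome L \<gamma> x0 w \<epsilon>) \<longlongrightarrow> (w (ball_exit_time L w), ball_exit_time L w)) (at_right 0)"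
proof (rule tendstoI)
  fix e :: real assume "0 < e"
  let ?z = "(w limit_time, limit_time)"
  obtain m where m: "\<And>n. m \<le> n \<Longrightarrow> dist (walk L \<gamma> x0 w n) ?z < e"
    using tendstoD[OF walk_tendsto \<open>0 < e\<close>] unfolding eventually_sequentially by blast
  obtain d where d: "0 < d" "\<And>k. k < m \<Longrightarrow> d < gap k" using gap_lower_bound[of m] by blast
  have "dist (wms_outcome L \<gamma> x0 w \<epsilon>) ?z < e" if eps: "0 < \<epsilon>" "\<epsilon> < d" for \<epsilon>
  proof -
    let ?P = "\<lambda>n. L - \<epsilon> \<le> norm (X n)"
    have "wms_outcome L \<gamma> x0 w \<epsilon> = walk L \<gamma> x0 w (LEAST n. ?P n)"
      using reach[OF eps(1)] by (simp add: wms_outcome_def wms_steps_eq wms_eq_walk[OF enters])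
    moreover have "m \<le> (LEAST n. ?P n)"
    proof (rule ccontr)
      assume "\<not> m \<le> (LEAST n. ?P n)"
      then have "d < gap (LEAST n. ?P n)" by (intro d) simp
      moreover have "?P (LEAST n. ?P n)" using reach[OF eps(1)] by (rule LeastI_ex)
      ultimately show False using eps by linarith
    qed
    ultimately show ?thesis using m by simp
  qed
  then show "\<forall>\<^sub>F \<epsilon> in at_right 0. dist (wms_outcome L \<gamma> x0 w \<epsilon>) (w (ball_exit_time L w), ball_exit_time L w) < e"
    unfolding ball_exit_time_eq eventually_at_right_field using d(1) by blast
qed

end

end

section \<open>Adaptedness of the walk and the mean decrease of its gap\<close>

context anchored_brownian_motion
begin

lemma prior_mult:
  assumes "prior S h" "prior S h'"
  shows "prior S (\<lambda>x. h x * h' x)"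
  unfolding prior_def
proof (intro allI impI)
  fix t :: real assume t: "0 \<le> t"
  have "(\<lambda>x. (if S x < t then h x else 0) * (if S x < t then h' x else 0)) \<in> borel_measurable (past t)"
    using assms t by (intro borel_measurable_times) (auto simp: prior_def)
  then show "(\<lambda>x. if S x < t then h x * h' x else 0) \<in> borel_measurable (past t)"
    by (rule measurable_cong[THEN iffD1, rotated]) auto
qed

lemma prior_mono:
  assumes h: "prior S h" and T: "optional T" and ST: "\<And>x. x \<in> space M \<Longrightarrow> S x \<le> T x"
  shows "prior T h"
  unfolding prior_def
proof (intro allI impI)
  fix t :: real assume t: "0 \<le> t"
  have "(\<lambda>x. (if S x < t then h x else 0) * (if T x < t then 1 else 0)) \<in> borel_measurable (past t)"
    using h T t by (intro borel_measurable_times) (auto simp: prior_def optional_def)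
  then show "(\<lambda>x. if T x < t then h x else 0) \<in> borel_measurable (past t)"
    by (rule measurable_cong[THEN iffD1, rotated]) (use ST in force)
qed

lemma prior_zero_const: "prior (\<lambda>_. 0) (\<lambda>_. c)"
  unfolding prior_def by simp

lemma optional_zero: "optional (\<lambda>_. 0)"
  by (simp add: optional_def prior_zero_const)

end

locale brownian_walk = anchored_brownian_motion M B x0
  for M :: "'w measure" and B :: "real \<Rightarrow> 'w \<Rightarrow> real ^ 'd" and x0 :: "real ^ 'd" +
  fixes L \<gamma> :: real
  assumes gamma: "0 < \<gamma>" "\<gamma> < 1" and inside: "norm x0 < L"
begin

abbreviation "X n x \<equiv> wpos L \<gamma> x0 (traj x) n"
abbreviation "T n x \<equiv> wtime L \<gamma> x0 (traj x) n"
abbreviation "\<rho> n x \<equiv> cross_frac L \<gamma> (traj x) (X n x) (T n x)"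

lemma path_anchored: "x \<in> space M \<Longrightarrow> anchored_path L \<gamma> x0 (traj x)"
  using gamma inside continuous_paths anchored by unfold_locales auto

lemma L_pos: "0 < L"
  using inside norm_ge_zero[of x0] by linarith

lemma walk_measurable [measurable]: "X n \<in> borel_measurable M" "T n \<in> borel_measurable M"
  using measurable_walk by auto

lemma walk_time_nonneg: "0 \<le> T n x"
  using measurable_walk by auto

lemma rho_measurable [measurable]: "\<rho> n \<in> borel_measurable M"
  by (intro measurable_cross_frac walk_measurable walk_time_nonneg)

text \<open>The path stopped at t is measurable with respect to \<open>past t\<close>. By
  \<open>walk_cong_before\<close> in both directions, the walks along the full and the stopped path
  reach step n before t together and then agree, so the stopped path decides everything.\<close>

lemma prior_walk:
  assumes f [measurable]: "f \<in> borel_measurable borel"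
  shows "prior (T n) (\<lambda>x. f (X n x))"
  unfolding prior_def
proof (intro allI impI)
  fix t :: real assume t: "0 \<le> t"
  interpret S: continuous_process "past t" "\<lambda>u. B (min u t)"
  proof
    fix u :: real assume "0 \<le> u"
    then show "B (min u t) \<in> borel_measurable (past t)" using t by (intro measurable_past) auto
  next
    fix x assume "x \<in> space (past t)"
    then have "continuous_on {0..} (\<lambda>u. B u x)" by (simp add: continuous_paths)
    then show "continuous_on {0..} (\<lambda>u. B (min u t) x)"
      by (rule continuous_on_compose2) (use t in \<open>auto intro!: continuous_intros\<close>)
  qed
  let ?w = "\<lambda>x u. B u x" and ?w' = "\<lambda>x u. B (min u t) x"
  have [measurable]: "(\<lambda>x. wpos L \<gamma> x0 (?w' x) n) \<in> borel_measurable (past t)"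
    "(\<lambda>x. wtime L \<gamma> x0 (?w' x) n) \<in> borel_measurable (past t)"
    using S.measurable_walk by auto
  have "(\<lambda>x. if wtime L \<gamma> x0 (?w' x) n < t then f (wpos L \<gamma> x0 (?w' x) n) else 0) \<in> borel_measurable (past t)"
    by measurable
  moreover have "(if wtime L \<gamma> x0 (?w' x) n < t then f (wpos L \<gamma> x0 (?w' x) n) else 0)
      = (if T n x < t then f (X n x) else 0)" for x
  proof -
    have "walk L \<gamma> x0 (?w' x) n = walk L \<gamma> x0 (?w x) n" if "T n x < t"
      by (rule walk_cong_before[OF _ that]) simp
    moreover have "walk L \<gamma> x0 (?w x) n = walk L \<gamma> x0 (?w' x) n" if "wtime L \<gamma> x0 (?w' x) n < t"
      by (rule walk_cong_before[OF _ that]) simp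
    ultimately show ?thesis by (smt (verit, best))
  qed
  ultimately show "(\<lambda>x. if T n x < t then f (X n x) else 0) \<in> borel_measurable (past t)" by simp
qed

lemma optional_walk_time: "optional (T n)"
  using prior_walk[of "\<lambda>_. 1" n] walk_time_nonneg by (simp add: optional_def)

lemma walk_time_bounded: "\<exists>N. \<forall>x\<in>space M. T n x < real N"
proof -
  obtain N :: nat where "real n * (exp 1 / real CARD('d) * L\<^sup>2) < real N" using reals_Archimedean2 by blast
  then show ?thesis using anchored_path.time_bound[OF path_anchored, of _ n] by (intro exI[of _ N]) force
qed

text \<open>The small-time estimate at \<open>T n\<close> with scale \<open>lifespan\<close>, whose
  1/d cancels the number of coordinates and makes the bound there the squared radius of the moving
  sphere. One \<delta> serves all n and all past events A, so the estimate is conditional and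
  uniform over the steps.\<close>

lemma rho_small:
  assumes "0 < \<kappa>"
  shows "\<exists>\<delta>>0. \<forall>n. \<forall>A\<in>sets M. prior (T n) (indicator A) \<longrightarrow>
    prob (A \<inter> {x \<in> space M. \<rho> n x < \<delta>}) \<le> \<kappa> * prob A"
proof -
  from small_time_inside[OF assms] obtain \<delta> where \<delta>: "0 < \<delta>" and main: "\<forall>S \<sigma>. optional S \<and> (\<exists>n. \<forall>x\<in>space M. S x < real n) \<and>
      prior S \<sigma> \<and> (\<forall>x\<in>space M. 0 < \<sigma> x) \<longrightarrow>
    (\<exists>Bad\<in>sets M. (\<forall>A\<in>sets M. prior S (indicator A) \<longrightarrow> prob (A \<inter> Bad) \<le> \<kappa> * prob A) \<and>
      (\<forall>x\<in>space M - Bad. \<forall>u. 0 < u \<and> u \<le> \<delta> \<longrightarrow>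
        (norm (B (S x + u * \<sigma> x) x - B (S x) x))\<^sup>2 < real CARD('d) * (\<sigma> x * (u * ln (1 / u)))))"
    by (elim exE conjE)
  show ?thesis
  proof (intro exI[of _ \<delta>] conjI allI ballI impI \<delta>)
    fix n A assume A: "A \<in> sets M" "prior (T n) (indicator A)"
    let ?\<sigma> = "\<lambda>x. lifespan L \<gamma> (X n x)"
    have "optional (T n) \<and> (\<exists>N. \<forall>x\<in>space M. T n x < real N) \<and> prior (T n) ?\<sigma> \<and> (\<forall>x\<in>space M. 0 < ?\<sigma> x)"
      using optional_walk_time walk_time_bounded prior_walk[OF borel_measurable_lifespan]
        anchored_path.lifespan_pos[OF path_anchored] by blast
    from main[rule_format, OF this] obtain Bad where Bad: "Bad \<in> sets M" "prob (A \<inter> Bad) \<le> \<kappa> * prob A"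
      and good: "\<And>x u. x \<in> space M - Bad \<Longrightarrow> 0 < u \<Longrightarrow> u \<le> \<delta> \<Longrightarrow>
        (norm (B (T n x + u * ?\<sigma> x) x - B (T n x) x))\<^sup>2 < real CARD('d) * (?\<sigma> x * (u * ln (1 / u)))"
      using A by blast
    have "\<delta> \<le> \<rho> n x" if w: "x \<in> space M - Bad" for x
    proof -
      interpret P: anchored_path L \<gamma> x0 "traj x" using path_anchored w by simp
      show ?thesis
        unfolding cross_frac_def
      proof (rule cInf_greatest[OF cross_set_nonempty])
        fix u assume "u \<in> {u. 0 < u \<and> u \<le> 1 \<and> \<gamma> * (L - norm (X n x)) * profile u
          \<le> norm (B (T n x + u * ?\<sigma> x) x - X n x)}"
        then have u: "0 < u" "u \<le> 1" and le: "\<gamma> * (L - norm (X n x)) * profile u \<le> norm (B (T n x + u * ?\<sigma> x) x - X n x)"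
          by auto
        show "\<delta> \<le> u"
        proof (rule ccontr)
          assume "\<not> \<delta> \<le> u"
          then have "(norm (B (T n x + u * ?\<sigma> x) x - X n x))\<^sup>2 < real CARD('d) * (?\<sigma> x * (u * ln (1 / u)))"
            using good[OF w u(1)] unfolding P.pos_eq by simp
          also have "\<dots> = (\<gamma> * (L - norm (X n x)) * profile u)\<^sup>2"
            using u by (simp add: lifespan_def profile_def power_mult_distrib)
          also have "\<dots> \<le> (norm (B (T n x + u * ?\<sigma> x) x - X n x))\<^sup>2"
            using le u gamma P.gap_pos[of n] profile_nonneg[OF u] by (intro power_mono) auto
          finally show False by simp
        qed
      qed
    qed
    then have "A \<inter> {x \<in> space M. \<rho> n x < \<delta>} \<subseteq> A \<inter> Bad" by force
    then have "prob (A \<inter> {x \<in> space M. \<rho> n x < \<delta>}) \<le> prob (A \<inter> Bad)"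
      by (rule finite_measure_mono) (use A Bad in auto)
    then show "prob (A \<inter> {x \<in> space M. \<rho> n x < \<delta>}) \<le> \<kappa> * prob A" using Bad(2) by linarith
  qed
qed

text \<open>A crossing fraction of 0 lies below every \<delta>, so \<open>rho_small\<close> on the
  whole space bounds its probability by every positive \<kappa>.\<close>

lemma AE_enters: "AE x in M. anchored_path.enters L \<gamma> x0 (traj x)"
proof -
  have "AE x in M. 0 < \<rho> n x" for n
  proof -
    have "prob {x \<in> space M. \<rho> n x \<le> 0} \<le> 0 + \<kappa>" if \<kappa>: "0 < \<kappa>" for \<kappa>
    proof -
      obtain \<delta> where \<delta>: "0 < \<delta>" and le: "\<And>A. A \<in> sets M \<Longrightarrow> prior (T n) (indicator A) \<Longrightarrow>
        prob (A \<inter> {x \<in> space M. \<rho> n x < \<delta>}) \<le> \<kappa> * prob A" using rho_small[OF \<kappa>] by blast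
      from le[OF sets.top prior_space[OF optional_walk_time]] have "prob (space M \<inter> {x \<in> space M. \<rho> n x < \<delta>}) \<le> \<kappa>"
        by (simp add: prob_space)
      moreover have "prob {x \<in> space M. \<rho> n x \<le> 0} \<le> prob (space M \<inter> {x \<in> space M. \<rho> n x < \<delta>})"
        using \<delta> by (intro finite_measure_mono) auto
      ultimately show ?thesis by simp
    qed
    then have "prob {x \<in> space M. \<rho> n x \<le> 0} \<le> 0" by (rule field_le_epsilon)
    then have "prob {x \<in> space M. \<rho> n x \<le> 0} = 0" using measure_nonneg by (rule antisym)
    then have "AE x in M. \<not> \<rho> n x \<le> 0"
      by (subst (asm) prob_Collect_eq_0) auto
    then show ?thesis by (simp add: not_le)
  qed
  then have "AE x in M. \<forall>n. 0 < \<rho> n x" by (simp add: AE_all_countable)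
  then show ?thesis
    by (rule AE_mp) (intro AE_I2 impI, simp add: anchored_path.enters_def[OF path_anchored])
qed

text \<open>Up to a null event this says that the number of steps exceeds n, so its probabilities
  add up to the expected number of steps.\<close>

definition not_near :: "real \<Rightarrow> nat \<Rightarrow> 'w set" where
  "not_near \<epsilon> n = {x \<in> space M. \<forall>j\<le>n. norm (X j x) < L - \<epsilon>}"

lemma not_near_sets [measurable]: "not_near \<epsilon> n \<in> sets M"
  unfolding not_near_def by measurable

lemma prior_not_near: "prior (T n) (indicator (not_near \<epsilon> n))"
proof (induction n)
  case 0
  have "not_near \<epsilon> 0 = space M \<or> not_near \<epsilon> 0 = {}" by (auto simp: not_near_def)
  then show ?case
  proof
    assume "not_near \<epsilon> 0 = space M"
    then show ?thesis using prior_space[OF optional_walk_time[of 0]] by simp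
  next
    assume "not_near \<epsilon> 0 = {}"
    then show ?thesis using prior_zero_const[of 0] by (simp add: prior_def)
  qed
next
  case (Suc n)
  have "prior (T (Suc n)) (indicator (not_near \<epsilon> n))"
    by (rule prior_mono[OF Suc optional_walk_time]) (rule anchored_path.time_step(1)[OF path_anchored])
  moreover have "prior (T (Suc n)) (\<lambda>x. if norm (X (Suc n) x) < L - \<epsilon> then 1 else 0)"
    by (rule prior_walk) measurable
  ultimately have "prior (T (Suc n)) (\<lambda>x. indicator (not_near \<epsilon> n) x * (if norm (X (Suc n) x) < L - \<epsilon> then 1 else 0))"
    by (rule prior_mult)
  also have "(\<lambda>x. indicator (not_near \<epsilon> n) x * (if norm (X (Suc n) x) < L - \<epsilon> then 1 else 0)) = indicat_real (not_near \<epsilon> (Suc n))"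
    by (auto simp: not_near_def indicator_def le_Suc_eq fun_eq_iff)
  finally show ?case .
qed

abbreviation "gap n x \<equiv> L - norm (X n x)"
abbreviation "radial_step n x \<equiv> (direction (X n x) \<bullet> (X (Suc n) x - X n x)) / gap n x"

text \<open>Direction and gap are known at \<open>T n\<close> and serve as weights, coordinate by
  coordinate, in \<open>optional_stopping\<close>; on \<open>not_near\<close> these weights are
  bounded by 1 / \<epsilon>. In the second moment only the diagonal survives and adds up to the
  squared norm 1 of the direction, while the squared gap cancels against
  \<open>lifespan\<close>.\<close>

lemma radial_step_moments:
  fixes n :: nat
  assumes eps: "0 < \<epsilon>"
  defines "I \<equiv> \<lambda>x. indicator (not_near \<epsilon> n) x :: real"
  shows "integrable M (\<lambda>x. I x * radial_step n x)" "expectation (\<lambda>x. I x * radial_step n x) = 0"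
    and "integrable M (\<lambda>x. I x * (radial_step n x)\<^sup>2)"
    and "expectation (\<lambda>x. I x * (radial_step n x)\<^sup>2)
      = expectation (\<lambda>x. I x * (exp 1 / real CARD('d) * \<gamma>\<^sup>2 * \<rho> n x))"
proof -
  obtain N where N: "\<And>x. x \<in> space M \<Longrightarrow> T (Suc n) x < real N" using walk_time_bounded by blast
  have mono: "\<And>x. x \<in> space M \<Longrightarrow> T n x \<le> T (Suc n) x" by (rule anchored_path.time_step(1)[OF path_anchored])
  define Z where "Z i x = incr (T n x) (T (Suc n) x) i x" for i x
  have stop: "integrable M (\<lambda>x. h x * Z i x)" "expectation (\<lambda>x. h x * Z i x) = 0"
    "integrable M (\<lambda>x. h x * (Z i x * Z j x))"
    "expectation (\<lambda>x. h x * (Z i x * Z j x)) = (if i = j then expectation (\<lambda>x. h x * (T (Suc n) x - T n x)) else 0)"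
    if "prior (T n) h" "\<And>x. \<bar>h x\<bar> \<le> c" for h c i j
    unfolding Z_def
    by (rule optional_stopping[OF optional_walk_time optional_walk_time mono N that]; assumption)+
  have Z: "Z i x = (X (Suc n) x - X n x) $ i" if "x \<in> space M" for i x
    using anchored_path.pos_eq[OF path_anchored[OF that]] by (simp add: Z_def)
  define h1 where "h1 i x = I x * (direction (X n x) $ i / gap n x)" for i x
  define h2 where "h2 i j x = I x * ((direction (X n x) $ i / gap n x) * (direction (X n x) $ j / gap n x))" for i j x
  have dir [measurable]: "(\<lambda>x :: real ^ 'd. direction x $ i) \<in> borel_measurable borel" for i
    by (rule borel_measurable_direction)
  have p1: "prior (T n) (h1 i)" for i
    unfolding h1_def I_def by (intro prior_mult prior_not_near prior_walk) measurable
  have p2: "prior (T n) (h2 i j)" for i j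
    unfolding h2_def I_def by (intro prior_mult prior_not_near prior_walk) measurable
  have coord: "\<bar>direction (X n x) $ i / gap n x\<bar> \<le> 1 / \<epsilon>" if "x \<in> not_near \<epsilon> n" for i x
  proof -
    have "\<epsilon> \<le> gap n x" using that by (auto simp: not_near_def dest: spec[of _ n])
    moreover have "\<bar>direction (X n x) $ i\<bar> \<le> 1" using component_le_norm_cart[of "direction (X n x)" i] by simp
    ultimately show ?thesis using eps by (auto simp: abs_divide intro!: frac_le)
  qed
  have b1: "\<bar>h1 i x\<bar> \<le> 1 / \<epsilon>" for i x
    using coord[of x i] eps by (auto simp: h1_def I_def indicator_def)
  have b2: "\<bar>h2 i j x\<bar> \<le> (1 / \<epsilon>) * (1 / \<epsilon>)" for i j x
  proof (cases "x \<in> not_near \<epsilon> n")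
    case True
    then show ?thesis using mult_mono[OF coord[OF True, of i] coord[OF True, of j]] eps
      by (simp add: h2_def I_def abs_mult)
  qed (use eps in \<open>simp add: h2_def I_def\<close>)
  note s1 = stop(1,2)[OF p1 b1]
  note s2 = stop(3,4)[OF p2 b2]
  have e1: "I x * radial_step n x = (\<Sum>i\<in>UNIV. h1 i x * Z i x)" if "x \<in> space M" for x
    unfolding Z[OF that] h1_def
    by (simp add: inner_vec_def sum_distrib_left sum_divide_distrib mult_ac)
  have e2: "I x * (radial_step n x)\<^sup>2 = (\<Sum>i\<in>UNIV. \<Sum>j\<in>UNIV. h2 i j x * (Z i x * Z j x))" if "x \<in> space M" for x
  proof -
    have r: "radial_step n x = (\<Sum>i\<in>UNIV. direction (X n x) $ i / gap n x * Z i x)"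
      unfolding Z[OF that] by (simp add: inner_vec_def sum_divide_distrib)
    have "I x * (radial_step n x)\<^sup>2 = I x * (\<Sum>i\<in>UNIV. \<Sum>j\<in>UNIV.
        (direction (X n x) $ i / gap n x * Z i x) * (direction (X n x) $ j / gap n x * Z j x))"
      unfolding r power2_eq_square sum_product ..
    also have "\<dots> = (\<Sum>i\<in>UNIV. \<Sum>j\<in>UNIV. h2 i j x * (Z i x * Z j x))"
      unfolding sum_distrib_left h2_def by (intro sum.cong refl) (simp only: mult_ac)
    finally show ?thesis .
  qed
  show "integrable M (\<lambda>x. I x * radial_step n x)"
    by (rule Bochner_Integration.integrable_cong[THEN iffD2, OF refl e1], assumption)
       (intro Bochner_Integration.integrable_sum s1)
  have "expectation (\<lambda>x. I x * radial_step n x) = expectation (\<lambda>x. \<Sum>i\<in>UNIV. h1 i x * Z i x)"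
    by (rule Bochner_Integration.integral_cong[OF refl e1])
  also have "\<dots> = (\<Sum>i\<in>UNIV. expectation (\<lambda>x. h1 i x * Z i x))"
    by (rule Bochner_Integration.integral_sum) (rule s1)
  also have "\<dots> = 0" by (simp only: s1 sum.neutral_const)
  finally show "expectation (\<lambda>x. I x * radial_step n x) = 0" .
  show "integrable M (\<lambda>x. I x * (radial_step n x)\<^sup>2)"
    by (rule Bochner_Integration.integrable_cong[THEN iffD2, OF refl e2], assumption)
       (intro Bochner_Integration.integrable_sum s2)
  have hint: "integrable M (\<lambda>x. h2 i i x * (T (Suc n) x - T n x))" for i
  proof (rule integrable_bounded_mult[where c = "(1 / \<epsilon>) * (1 / \<epsilon>)"])
    show "integrable M (\<lambda>x. T (Suc n) x - T n x)"
    proof (rule integrable_const_bound[of _ "real N"])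
      have "0 \<le> T (Suc n) x - T n x" "T (Suc n) x - T n x \<le> real N" if "x \<in> space M" for x
        using mono[OF that] N[OF that] walk_time_nonneg[of x n] by linarith+
      then show "AE x in M. norm (T (Suc n) x - T n x) \<le> real N"
        by (intro AE_I2) simp
    qed measurable
    show "h2 i i \<in> borel_measurable M" unfolding h2_def I_def by measurable
  qed (rule b2)
  have "expectation (\<lambda>x. I x * (radial_step n x)\<^sup>2) = expectation (\<lambda>x. \<Sum>i\<in>UNIV. \<Sum>j\<in>UNIV. h2 i j x * (Z i x * Z j x))"
    by (rule Bochner_Integration.integral_cong[OF refl e2])
  also have "\<dots> = (\<Sum>i\<in>UNIV. \<Sum>j\<in>UNIV. expectation (\<lambda>x. h2 i j x * (Z i x * Z j x)))"
    by (subst Bochner_Integration.integral_sum, intro Bochner_Integration.integrable_sum s2,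
        intro sum.cong refl Bochner_Integration.integral_sum s2)
  also have "\<dots> = (\<Sum>i\<in>UNIV. expectation (\<lambda>x. h2 i i x * (T (Suc n) x - T n x)))"
    unfolding s2 by (intro sum.cong refl) simp
  also have "\<dots> = expectation (\<lambda>x. \<Sum>i\<in>UNIV. h2 i i x * (T (Suc n) x - T n x))"
    by (rule Bochner_Integration.integral_sum[symmetric]) (rule hint)
  also have "\<dots> = expectation (\<lambda>x. I x * (exp 1 / real CARD('d) * \<gamma>\<^sup>2 * \<rho> n x))"
  proof (rule Bochner_Integration.integral_cong[OF refl])
    fix x assume w: "x \<in> space M"
    have g: "0 < gap n x" using anchored_path.gap_pos[OF path_anchored[OF w]] .
    have "(\<Sum>i\<in>UNIV. (direction (X n x) $ i) * (direction (X n x) $ i)) = direction (X n x) \<bullet> direction (X n x)"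
      by (simp add: inner_vec_def)
    also have "\<dots> = 1" by (simp add: dot_square_norm)
    finally have unit: "(\<Sum>i\<in>UNIV. (direction (X n x) $ i) * (direction (X n x) $ i)) = 1" .
    have "(\<Sum>i\<in>UNIV. h2 i i x * (T (Suc n) x - T n x))
      = (\<Sum>i\<in>UNIV. I x * (T (Suc n) x - T n x) / (gap n x)\<^sup>2 * (direction (X n x) $ i * direction (X n x) $ i))"
      by (intro sum.cong refl) (simp add: h2_def power2_eq_square)
    also have "\<dots> = I x * (T (Suc n) x - T n x) / (gap n x)\<^sup>2"
      by (simp only: sum_distrib_left[symmetric] unit mult_1_right)
    also have "\<dots> = I x * (exp 1 / real CARD('d) * \<gamma>\<^sup>2 * \<rho> n x)"
    proof -
      have eq: "T (Suc n) x - T n x = lifespan L \<gamma> (X n x) * \<rho> n x"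
        by (simp only: wtime_Suc add_diff_cancel_left')
      show ?thesis unfolding eq using g by (simp add: lifespan_def power_mult_distrib)
    qed
    finally show "(\<Sum>i\<in>UNIV. h2 i i x * (T (Suc n) x - T n x)) = I x * (exp 1 / real CARD('d) * \<gamma>\<^sup>2 * \<rho> n x)" .
  qed
  finally show "expectation (\<lambda>x. I x * (radial_step n x)\<^sup>2)
      = expectation (\<lambda>x. I x * (exp 1 / real CARD('d) * \<gamma>\<^sup>2 * \<rho> n x))" .
qed

text \<open>The mean of the stopped logarithm is squeezed: pathwise it cannot fall below the bound
  of \<open>stopped_ln_gap_ge\<close>, while step k lowers it on average by at least
  \<open>c * prob (not_near \<epsilon> k)\<close>.\<close>

lemma sum_not_near:
  "\<exists>c>0. \<forall>\<epsilon> n. 0 < \<epsilon> \<and> \<epsilon> < L \<longrightarrow> c * (\<Sum>k<n. prob (not_near \<epsilon> k)) \<le> ln L - ln ((1 - \<gamma>) * \<epsilon>)"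
proof -
  obtain \<delta> where \<delta>: "0 < \<delta>" and half: "\<And>n A. A \<in> sets M \<Longrightarrow> prior (T n) (indicator A) \<Longrightarrow>
    prob (A \<inter> {x \<in> space M. \<rho> n x < \<delta>}) \<le> 1 / 2 * prob A"
    using rho_small[of "1 / 2"] by (auto)
  let ?e = "exp 1 / real CARD('d) * \<gamma>\<^sup>2"
  \<comment> \<open>On at least half of \<open>not_near\<close> the fraction is at least \<delta>,
    so the second moment is at least \<open>?e * \<delta> / 2\<close> times its probability; the
    factor 1/8 from \<open>ln_gap_step\<close> makes 1/16.\<close>
  define c where "c = ?e * \<delta> / 16"
  have e: "0 < ?e" using gamma by simp
  have "c * (\<Sum>k<n. prob (not_near \<epsilon> k)) \<le> ln L - ln ((1 - \<gamma>) * \<epsilon>)" if eps: "0 < \<epsilon>" "\<epsilon> < L" for \<epsilon> n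
  proof -
    let ?I = "\<lambda>k x. indicator (not_near \<epsilon> k) x :: real"
    note mom = radial_step_moments[OF eps(1)]
    have second: "2 * c * prob (not_near \<epsilon> k) \<le> expectation (\<lambda>x. ?I k x * (radial_step k x)\<^sup>2) / 4" for k
    proof -
      let ?A = "not_near \<epsilon> k" and ?S = "{x \<in> space M. \<rho> k x < \<delta>}"
      have "prob ?A = prob (?A \<inter> ?S) + prob (?A - ?S)"
        using finite_measure_Union[of "?A \<inter> ?S" "?A - ?S"] by (simp add: Int_Diff_Un Int_Diff_disjoint)
      then have "prob ?A / 2 \<le> prob (?A - ?S)" using half[OF not_near_sets prior_not_near, of \<epsilon> k] by simp
      then have "?e * \<delta> * (prob ?A / 2) \<le> ?e * \<delta> * prob (?A - ?S)"
        using e \<delta> by (intro mult_left_mono) auto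
      also have "\<dots> = expectation (\<lambda>x. indicator (?A - ?S) x * (?e * \<delta>))" by simp
      also have "\<dots> \<le> expectation (\<lambda>x. ?I k x * (?e * \<rho> k x))"
      proof (rule integral_mono)
        show "integrable M (\<lambda>x. indicator (?A - ?S) x * (?e * \<delta>))"
          by (simp add: integrable_real_indicator emeasure_eq_measure)
        show "integrable M (\<lambda>x. ?I k x * (?e * \<rho> k x))"
        proof (rule integrable_const_bound[of _ "?e"])
          have "?I k x * (?e * \<rho> k x) \<le> 1 * (?e * 1)" for x
            by (intro mult_mono mult_nonneg_nonneg less_imp_le[OF e] cross_frac_bounds) (auto simp: indicator_def)
          moreover have "0 \<le> ?I k x * (?e * \<rho> k x)" for x
            using cross_frac_bounds(1) by (intro mult_nonneg_nonneg) auto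
          ultimately show "AE x in M. norm (?I k x * (?e * \<rho> k x)) \<le> ?e"
            by (intro AE_I2) (simp only: real_norm_def abs_of_nonneg mult_1_left mult_1_right)
        qed measurable
        fix x assume "x \<in> space M"
        show "indicator (?A - ?S) x * (?e * \<delta>) \<le> ?I k x * (?e * \<rho> k x)"
        proof (cases "x \<in> ?A - ?S")
          case True
          then have "?e * \<delta> \<le> ?e * \<rho> k x"
            using \<open>x \<in> space M\<close> by (intro mult_left_mono less_imp_le[OF e]) auto
          then show ?thesis using True by (simp only: indicator_simps DiffD1 mult_1_left)
        next
          case False
          then have zero: "indicator (?A - ?S) x = (0 :: real)" by (rule indicator_simps)
          have "0 \<le> ?I k x * (?e * \<rho> k x)"
            by (intro mult_nonneg_nonneg less_imp_le[OF e] cross_frac_bounds) simp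
          then show ?thesis by (simp only: zero mult_zero_left)
        qed
      qed
      also have "\<dots> = expectation (\<lambda>x. ?I k x * (radial_step k x)\<^sup>2)" by (rule mom(4)[symmetric])
      finally have le: "?e * \<delta> * (prob ?A / 2) \<le> expectation (\<lambda>x. ?I k x * (radial_step k x)\<^sup>2)" .
      have eq: "2 * c * prob ?A = ?e * \<delta> * (prob ?A / 2) / 4" by (simp add: c_def)
      show ?thesis unfolding eq by (rule divide_right_mono[OF le]) simp
    qed
    let ?q = "\<lambda>x. \<Sum>k<n. - (?I k x * radial_step k x) - ?I k x * (radial_step k x)\<^sup>2 / 8"
    have qint: "integrable M (\<lambda>x. - (?I k x * radial_step k x) - ?I k x * (radial_step k x)\<^sup>2 / 8)" for k
      by (intro Bochner_Integration.integrable_diff Bochner_Integration.integrable_minus integrable_divide mom)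
    have "ln ((1 - \<gamma>) * \<epsilon>) - ln L = expectation (\<lambda>_. ln ((1 - \<gamma>) * \<epsilon>) - ln L)" by (simp add: prob_space)
    also have "\<dots> \<le> expectation ?q"
    proof (rule integral_mono)
      show "integrable M ?q" by (intro Bochner_Integration.integrable_sum qint)
      fix x assume w: "x \<in> space M"
      interpret P: anchored_path L \<gamma> x0 "traj x" using path_anchored w by simp
      have I: "?I k x = of_bool (\<forall>j\<le>k. norm (X j x) < L - \<epsilon>)" for k using w by (simp add: not_near_def indicator_def)
      have "ln ((1 - \<gamma>) * \<epsilon>) - ln L \<le> (\<Sum>k<n. ?I k x * (ln (gap (Suc k) x) - ln (gap k x)))"
        unfolding I by (rule P.stopped_ln_gap_ge[OF eps])
      also have "\<dots> \<le> (\<Sum>k<n. ?I k x * (- radial_step k x - (radial_step k x)\<^sup>2 / 8))"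
        by (intro sum_mono mult_left_mono P.ln_gap_step) simp
      also have "\<dots> = ?q x" by (intro sum.cong refl) (simp add: right_diff_distrib)
      finally show "ln ((1 - \<gamma>) * \<epsilon>) - ln L \<le> ?q x" .
    qed simp
    also have "\<dots> = (\<Sum>k<n. expectation (\<lambda>x. - (?I k x * radial_step k x) - ?I k x * (radial_step k x)\<^sup>2 / 8))"
      by (rule Bochner_Integration.integral_sum) (rule qint)
    also have "\<dots> \<le> (\<Sum>k<n. - (c * prob (not_near \<epsilon> k)))"
    proof (rule sum_mono)
      fix k
      have "expectation (\<lambda>x. - (?I k x * radial_step k x) - ?I k x * (radial_step k x)\<^sup>2 / 8)
        = - expectation (\<lambda>x. ?I k x * radial_step k x) - expectation (\<lambda>x. ?I k x * (radial_step k x)\<^sup>2) / 8"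
        by (subst Bochner_Integration.integral_diff)
           (intro Bochner_Integration.integrable_minus integrable_divide mom, intro integrable_divide mom,
            simp only: Bochner_Integration.integral_minus integral_divide_zero)
      then show "expectation (\<lambda>x. - (?I k x * radial_step k x) - ?I k x * (radial_step k x)\<^sup>2 / 8)
        \<le> - (c * prob (not_near \<epsilon> k))"
        using second[of k] mom(2)[of k] by simp
    qed
    also have "\<dots> = - (c * (\<Sum>k<n. prob (not_near \<epsilon> k)))"
      by (simp only: sum_negf sum_distrib_left)
    finally show ?thesis by simp
  qed
  moreover have "0 < c" using gamma \<delta> by (simp add: c_def)
  ultimately show ?thesis by blast
qed

end

section \<open>Number of steps and limit of the walk\<close>

lemma suminf_one_ennreal: "(\<Sum>k::nat. 1 :: ennreal) = \<infinity>"
  by (simp add: suminf_eq_SUP ennreal_SUP_of_nat_eq_top)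

text \<open>A count equals the number of indices k that it exceeds, also when it is infinite. This
  turns the expected count into a sum of probabilities.\<close>

lemma ennreal_of_enat_wms_steps:
  "ennreal_of_enat (wms_steps L \<gamma> x0 w \<epsilon>) =
    (\<Sum>k. if \<forall>j\<le>k. norm (fst (wms L \<gamma> x0 w j)) < L - \<epsilon> then 1 else 0)"
proof (cases "\<exists>n. L - \<epsilon> \<le> norm (fst (wms L \<gamma> x0 w n))")
  case True
  let ?P = "\<lambda>n. L - \<epsilon> \<le> norm (fst (wms L \<gamma> x0 w n))"
  define m where "m = (LEAST n. ?P n)"
  have m: "?P m" unfolding m_def using True by (rule LeastI_ex)
  have below: "\<not> ?P j" if "j < m" for j using that not_less_Least[of j ?P] by (simp add: m_def)
  have iff: "(\<forall>j\<le>k. norm (fst (wms L \<gamma> x0 w j)) < L - \<epsilon>) \<longleftrightarrow> k < m" for k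
    using m below by (meson le_less_trans not_le)
  have "(\<Sum>k. if k < m then 1 else 0 :: ennreal) = (\<Sum>k<m. if k < m then 1 else 0)"
    by (rule suminf_finite) auto
  also have "\<dots> = of_nat m" by simp
  finally show ?thesis using True by (simp add: wms_steps_eq iff m_def[symmetric])
next
  case False
  then have "norm (fst (wms L \<gamma> x0 w j)) < L - \<epsilon>" for j by (simp add: not_le)
  then show ?thesis using False by (simp add: wms_steps_eq suminf_one_ennreal)
qed

section \<open>Expected number of steps and almost sure convergence\<close>

context brownian_walk
begin

abbreviation "step_count \<epsilon> x \<equiv> (\<Sum>k. indicator (not_near \<epsilon> k) x) :: ennreal"

lemma nn_integral_count:
  "\<exists>c>0. \<forall>\<epsilon>. 0 < \<epsilon> \<and> \<epsilon> < L \<longrightarrow>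
    (\<integral>\<^sup>+x. step_count \<epsilon> x \<partial>M) \<le> ennreal ((ln L - ln ((1 - \<gamma>) * \<epsilon>)) / c)"
proof -
  obtain c where c: "0 < c" and le: "\<And>\<epsilon> n. 0 < \<epsilon> \<Longrightarrow> \<epsilon> < L \<Longrightarrow>
      c * (\<Sum>k<n. prob (not_near \<epsilon> k)) \<le> ln L - ln ((1 - \<gamma>) * \<epsilon>)"
    using sum_not_near by blast
  have "(\<integral>\<^sup>+x. step_count \<epsilon> x \<partial>M) \<le> ennreal ((ln L - ln ((1 - \<gamma>) * \<epsilon>)) / c)" if eps: "0 < \<epsilon>" "\<epsilon> < L" for \<epsilon>
  proof -
    have "(\<integral>\<^sup>+x. step_count \<epsilon> x \<partial>M) = (\<Sum>k. emeasure M (not_near \<epsilon> k))"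
      by (subst nn_integral_suminf) auto
    also have "\<dots> \<le> ennreal ((ln L - ln ((1 - \<gamma>) * \<epsilon>)) / c)"
    proof (rule suminf_le_const[OF summableI])
      fix n
      have "(\<Sum>k<n. emeasure M (not_near \<epsilon> k)) = ennreal (\<Sum>k<n. prob (not_near \<epsilon> k))"
        by (simp add: emeasure_eq_measure)
      also have "\<dots> \<le> ennreal ((ln L - ln ((1 - \<gamma>) * \<epsilon>)) / c)"
        using le[OF eps, of n] c by (intro ennreal_leI) (simp add: field_simps)
      finally show "(\<Sum>k<n. emeasure M (not_near \<epsilon> k)) \<le> ennreal ((ln L - ln ((1 - \<gamma>) * \<epsilon>)) / c)" .
    qed
    finally show ?thesis .
  qed
  then show ?thesis using c by blast
qed

lemma AE_steps_eq_count: "AE x in M. ennreal_of_enat (wms_steps L \<gamma> x0 (traj x) \<epsilon>) = step_count \<epsilon> x"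
  using AE_enters AE_space
proof eventually_elim
  case (elim x)
  then show ?case
    unfolding ennreal_of_enat_wms_steps anchored_path.wms_eq_walk[OF path_anchored[OF elim(2)] elim(1)]
    by (intro suminf_cong) (simp add: not_near_def indicator_def)
qed

lemma expected_steps:
  "\<exists>C>0. \<exists>\<epsilon>0>0. \<forall>\<epsilon>. 0 < \<epsilon> \<and> \<epsilon> < 1 \<and> \<epsilon> \<le> \<epsilon>0 \<longrightarrow>
    (\<integral>\<^sup>+x. ennreal_of_enat (wms_steps L \<gamma> x0 (traj x) \<epsilon>) \<partial>M) \<le> ennreal (C * \<bar>ln \<epsilon>\<bar>)"
proof -
  obtain c where c: "0 < c" and le: "\<And>\<epsilon>. 0 < \<epsilon> \<Longrightarrow> \<epsilon> < L \<Longrightarrow>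
      (\<integral>\<^sup>+x. step_count \<epsilon> x \<partial>M) \<le> ennreal ((ln L - ln ((1 - \<gamma>) * \<epsilon>)) / c)"
    using nn_integral_count by blast
  let ?K = "\<bar>ln L\<bar> + \<bar>ln (1 - \<gamma>)\<bar> + 1"
  have "0 < ?K / c" using c by (intro divide_pos_pos) linarith+
  moreover have "\<exists>\<epsilon>0>0. \<forall>\<epsilon>. 0 < \<epsilon> \<and> \<epsilon> < 1 \<and> \<epsilon> \<le> \<epsilon>0 \<longrightarrow>
    (\<integral>\<^sup>+x. ennreal_of_enat (wms_steps L \<gamma> x0 (traj x) \<epsilon>) \<partial>M) \<le> ennreal (?K / c * \<bar>ln \<epsilon>\<bar>)"
  \<comment> \<open>\<open>L / 2\<close> puts \<epsilon> below L, as the counting bound requires;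
    \<open>exp (- 1)\<close> makes \<open>- ln \<epsilon>\<close> at least 1, so that the constants
    from L and \<gamma> are absorbed. The 1 in \<open>?K\<close> is the coefficient of
    \<open>- ln \<epsilon>\<close> itself.\<close>
  proof (rule exI[of _ "min (L / 2) (exp (- 1))"], intro conjI allI impI)
    show "0 < min (L / 2) (exp (- 1))" using L_pos by simp
    fix \<epsilon> :: real assume "0 < \<epsilon> \<and> \<epsilon> < 1 \<and> \<epsilon> \<le> min (L / 2) (exp (- 1))"
    then have eps: "0 < \<epsilon>" "\<epsilon> < L" "\<epsilon> \<le> exp (- 1)" using L_pos by auto
    have "ln \<epsilon> \<le> ln (exp (- 1))" using eps by (subst ln_le_cancel_iff) auto
    then have ln: "1 \<le> - ln \<epsilon>" by simp
    have "ln L - ln ((1 - \<gamma>) * \<epsilon>) = ln L - ln (1 - \<gamma>) - ln \<epsilon>"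
      using gamma eps by (simp add: ln_mult_pos)
    also have "\<dots> \<le> (\<bar>ln L\<bar> + \<bar>ln (1 - \<gamma>)\<bar>) * 1 - ln \<epsilon>"
      using abs_ge_self[of "ln L"] abs_ge_minus_self[of "ln (1 - \<gamma>)"] by simp
    also have "\<dots> \<le> (\<bar>ln L\<bar> + \<bar>ln (1 - \<gamma>)\<bar>) * (- ln \<epsilon>) - ln \<epsilon>"
      using ln by (intro diff_right_mono mult_left_mono) auto
    also have "\<dots> = ?K * \<bar>ln \<epsilon>\<bar>" using ln by (simp add: algebra_simps)
    finally have "(ln L - ln ((1 - \<gamma>) * \<epsilon>)) / c \<le> ?K / c * \<bar>ln \<epsilon>\<bar>"
      using c by (simp add: divide_right_mono)
    then have "(\<integral>\<^sup>+x. step_count \<epsilon> x \<partial>M) \<le> ennreal (?K / c * \<bar>ln \<epsilon>\<bar>)"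
      using le[OF eps(1,2)] ennreal_leI order_trans by blast
    moreover have "(\<integral>\<^sup>+x. ennreal_of_enat (wms_steps L \<gamma> x0 (traj x) \<epsilon>) \<partial>M) = (\<integral>\<^sup>+x. step_count \<epsilon> x \<partial>M)"
      by (rule nn_integral_cong_AE[OF AE_steps_eq_count])
    ultimately show "(\<integral>\<^sup>+x. ennreal_of_enat (wms_steps L \<gamma> x0 (traj x) \<epsilon>) \<partial>M) \<le> ennreal (?K / c * \<bar>ln \<epsilon>\<bar>)"
      by simp
  qed
  ultimately show ?thesis by blast
qed

text \<open>A path that never comes within \<epsilon> of the boundary has an infinite count, which
  the finite mean excludes almost surely.\<close>

lemma AE_reach: "AE x in M. \<forall>\<epsilon>>0. \<exists>n. L - \<epsilon> \<le> norm (X n x)"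
proof -
  have reach: "AE x in M. \<exists>n. L - \<epsilon> \<le> norm (X n x)" if eps: "0 < \<epsilon>" "\<epsilon> < L" for \<epsilon>
  proof -
    have "(\<integral>\<^sup>+x. step_count \<epsilon> x \<partial>M) \<noteq> \<infinity>"
      using nn_integral_count eps by (metis ennreal_less_top infinity_ennreal_def leD)
    then have "AE x in M. step_count \<epsilon> x \<noteq> \<infinity>"
      by (intro nn_integral_PInf_AE) auto
    then show ?thesis
      using AE_space
    proof eventually_elim
      case (elim x)
      show ?case
      proof (rule ccontr)
        assume "\<not> ?thesis"
        then have "x \<in> not_near \<epsilon> k" for k using elim(2) by (auto simp: not_near_def not_le)
        then have "step_count \<epsilon> x = \<infinity>" by (simp add: suminf_one_ennreal)
        then show False using elim(1) by simp
      qed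
    qed
  qed
  \<comment> \<open>The levels \<open>L / (real m + 2)\<close> are countably many, tend to 0 and
    stay below L, as \<open>reach\<close> requires.\<close>
  have "L < L * (real m + 2)" for m :: nat using L_pos by (simp add: algebra_simps add_pos_nonneg)
  then have "AE x in M. \<forall>m::nat. \<exists>n. L - L / (real m + 2) \<le> norm (X n x)"
    using L_pos by (subst AE_all_countable) (intro allI reach, auto simp: divide_less_eq)
  then show ?thesis
  proof eventually_elim
    case (elim x)
    show ?case
    proof (intro allI impI)
      fix \<epsilon> :: real assume "0 < \<epsilon>"
      obtain m :: nat where "L / \<epsilon> < real m" using reals_Archimedean2 by blast
      then have "L / (real m + 2) \<le> \<epsilon>"
        using \<open>0 < \<epsilon>\<close> by (simp add: field_simps)
      moreover obtain n where "L - L / (real m + 2) \<le> norm (X n x)" using elim by blast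
      ultimately show "\<exists>n. L - \<epsilon> \<le> norm (X n x)" by (intro exI[of _ n]) linarith
    qed
  qed
qed

text \<open>Wald's second identity with weight 1 from time 0, for a single arbitrary coordinate:
  both endpoints lie in the ball, so this coordinate moves by at most 2 L.\<close>

lemma expectation_walk_time: "expectation (T n) \<le> 4 * L\<^sup>2"
proof -
  obtain N where N: "\<And>x. x \<in> space M \<Longrightarrow> T n x < real N" using walk_time_bounded by blast
  fix i :: 'd
  let ?Z = "\<lambda>x. incr 0 (T n x) i x"
  have stop: "integrable M (\<lambda>x. 1 * (?Z x * ?Z x))"
    "expectation (\<lambda>x. 1 * (?Z x * ?Z x)) = (if i = i then expectation (\<lambda>x. 1 * (T n x - 0)) else 0)"
    by (rule optional_stopping[where S = "\<lambda>_. 0" and c = 1, OF optional_zero optional_walk_time _ N prior_zero_const];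
        (assumption | simp add: walk_time_nonneg))+
  have "expectation (T n) = expectation (\<lambda>x. 1 * (?Z x * ?Z x))" unfolding stop(2) by simp
  also have "\<dots> \<le> expectation (\<lambda>_. 4 * L\<^sup>2)"
  proof (rule integral_mono[OF stop(1)])
    fix x assume w: "x \<in> space M"
    interpret P: anchored_path L \<gamma> x0 "traj x" using path_anchored[OF w] .
    have "\<bar>?Z x\<bar> \<le> norm (B (T n x) x - B 0 x)" by (rule component_le_norm_cart)
    also have "\<dots> = norm (X n x - X 0 x)" using P.pos_eq[of n] P.anchored by simp
    also have "\<dots> \<le> norm (X n x) + norm (X 0 x)" by (rule norm_triangle_ineq4)
    also have "\<dots> \<le> 2 * L" using P.pos_inside[of n] P.pos_inside[of 0] by linarith
    finally have "\<bar>?Z x\<bar>\<^sup>2 \<le> (2 * L)\<^sup>2" by (intro power_mono) auto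
    then show "1 * (?Z x * ?Z x) \<le> 4 * L\<^sup>2" by (simp add: power2_eq_square)
  qed simp
  finally show ?thesis by (simp add: prob_space)
qed

text \<open>By monotone convergence the supremum of the increasing times inherits the uniform bound
  on their means, so it is finite almost surely.\<close>

lemma AE_bounded_time: "AE x in M. bdd_above (range (\<lambda>n. T n x))"
proof -
  have inc: "incseq (\<lambda>n x. ennreal (T n x))"
  proof (rule incseq_SucI, rule le_funI)
    fix n x
    show "ennreal (T n x) \<le> ennreal (T (Suc n) x)"
      by (intro ennreal_leI) (simp add: wtime_Suc lifespan_nonneg cross_frac_bounds)
  qed
  have "(\<integral>\<^sup>+x. (SUP n. ennreal (T n x)) \<partial>M) = (SUP n. \<integral>\<^sup>+x. ennreal (T n x) \<partial>M)"
    by (rule nn_integral_monotone_convergence_SUP[OF inc]) measurable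
  also have "\<dots> \<le> ennreal (4 * L\<^sup>2)"
  proof (rule SUP_least)
    fix n
    obtain N where N: "\<And>x. x \<in> space M \<Longrightarrow> T n x < real N" using walk_time_bounded by blast
    have "integrable M (T n)"
    proof (rule integrable_const_bound[of _ "real N"])
      show "AE x in M. norm (T n x) \<le> real N"
        using N by (intro AE_I2) (simp add: walk_time_nonneg less_imp_le)
    qed measurable
    then have "(\<integral>\<^sup>+x. ennreal (T n x) \<partial>M) = ennreal (expectation (T n))"
      by (rule nn_integral_eq_integral) (simp add: walk_time_nonneg)
    then show "(\<integral>\<^sup>+x. ennreal (T n x) \<partial>M) \<le> ennreal (4 * L\<^sup>2)"
      using expectation_walk_time[of n] by (simp add: ennreal_leI)
  qed
  finally have "(\<integral>\<^sup>+x. (SUP n. ennreal (T n x)) \<partial>M) \<noteq> \<infinity>"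
    by (metis ennreal_less_top infinity_ennreal_def leD)
  then have "AE x in M. (SUP n. ennreal (T n x)) \<noteq> \<infinity>"
    by (intro nn_integral_PInf_AE) measurable
  then show ?thesis
  proof eventually_elim
    case (elim x)
    then obtain r where r: "0 \<le> r" "(SUP n. ennreal (T n x)) = ennreal r"
      by (cases "SUP n. ennreal (T n x)" rule: ennreal_cases) auto
    show ?case
    proof (rule bdd_aboveI2)
      fix n
      have "ennreal (T n x) \<le> ennreal r" unfolding r(2)[symmetric] by (rule SUP_upper) simp
      then show "T n x \<le> r" using r(1) by simp
    qed
  qed
qed

abbreviation "limit_pair x \<equiv> (B (ball_exit_time L (traj x)) x, ball_exit_time L (traj x))"

lemma AE_outcome_tendsto:
  "AE x in M. ((\<lambda>\<epsilon>. wms_outcome L \<gamma> x0 (traj x) \<epsilon>) \<longlongrightarrow> limit_pair x) (at_right 0)"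
  using AE_enters AE_reach AE_bounded_time AE_space
proof eventually_elim
  case (elim x)
  show ?case
    using anchored_path.outcome_tendsto[OF path_anchored[OF elim(4)] elim(1) _ elim(3)] elim(2) by blast
qed

end

section \<open>Convergence in probability and the theorem\<close>

lemma (in continuous_process) measurable_exit_pair:
  "(\<lambda>x. (Y (ball_exit_time L (traj x)) x, ball_exit_time L (traj x))) \<in> borel_measurable N"
proof (intro borel_measurable_Pair measurable_at_random_time measurable_ball_exit_time)
  show "0 \<le> ball_exit_time L (traj x)" for x
    unfolding ball_exit_time_def by (rule first_time_nonneg) simp
qed

text \<open>Dominated convergence works along sequences, whereas the parameter tends to a through
  the reals; testing the limit on sequences bridges the two. Along each of them the indicators of
  the deviation events are eventually 0 almost surely.\<close>

lemma (in prob_space) converges_in_probability_of_AE: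
  fixes Y :: "real \<Rightarrow> 'a \<Rightarrow> 'b :: {metric_space, second_countable_topology}"
  assumes Y [measurable]: "\<And>\<epsilon>. Y \<epsilon> \<in> borel_measurable M" and Z [measurable]: "Z \<in> borel_measurable M"
    and lim: "AE x in M. ((\<lambda>\<epsilon>. Y \<epsilon> x) \<longlongrightarrow> Z x) (at_right a)"
  shows "converges_in_probability M Y Z (at_right a)"
  unfolding converges_in_probability_def
proof (intro conjI allI impI always_eventually Y Z)
  fix \<eta> :: real assume \<eta>: "0 < \<eta>"
  show "((\<lambda>\<epsilon>. prob {x \<in> space M. \<eta> < dist (Y \<epsilon> x) (Z x)}) \<longlongrightarrow> 0) (at_right a)"
  proof (rule tendsto_at_right_sequentially[of _ "a + 1"])
    fix S :: "nat \<Rightarrow> real" assume S: "\<And>n. a < S n" "S \<longlonglongrightarrow> a"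
    then have S_lim: "filterlim S (at_right a) sequentially"
      by (auto simp: filterlim_at intro!: always_eventually)
    let ?A = "\<lambda>n. {x \<in> space M. \<eta> < dist (Y (S n) x) (Z x)}"
    have "(\<lambda>n. expectation (indicator (?A n))) \<longlonglongrightarrow> expectation (\<lambda>x. 0 :: real)"
    proof (rule integral_dominated_convergence[where w = "\<lambda>_. 1"])
      show "AE x in M. (\<lambda>n. indicator (?A n) x) \<longlonglongrightarrow> (0 :: real)"
        using lim
      proof eventually_elim
        case (elim x)
        have "\<forall>\<^sub>F n in sequentially. dist (Y (S n) x) (Z x) < \<eta>"
          using tendstoD[OF filterlim_compose[OF elim S_lim] \<eta>] .
        then have "\<forall>\<^sub>F n in sequentially. indicator (?A n) x = (0 :: real)"
          by eventually_elim (simp add: indicator_def)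
        then show ?case by (rule tendsto_eventually)
      qed
    qed (auto simp: indicator_def)
    then show "(\<lambda>n. prob (?A n)) \<longlonglongrightarrow> 0" by simp
  qed simp
qed

theorem theorem4p1:
  fixes M :: "'w measure" and B :: "real \<Rightarrow> 'w \<Rightarrow> real ^ 'd" and x0 :: "real ^ 'd"
    and L \<gamma> :: real
  assumes dim: "CARD('d) \<ge> 2"
    and L: "L > 0"
    and \<gamma>: "0 < \<gamma>" "\<gamma> < 1"
    and x0: "norm x0 < L"
    and B: "brownian_motion M B x0"
  shows "(\<exists>C>0. \<exists>\<epsilon>0>0. \<forall>\<epsilon>. 0 < \<epsilon> \<and> \<epsilon> < 1 \<and> \<epsilon> \<le> \<epsilon>0 \<longrightarrow>
            (\<integral>\<^sup>+\<omega>. ennreal_of_enat (wms_steps L \<gamma> x0 (\<lambda>t. B t \<omega>) \<epsilon>) \<partial>M)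
              \<le> ennreal (C * \<bar>ln \<epsilon>\<bar>))
       \<and> converges_in_probability M
           (\<lambda>\<epsilon> \<omega>. wms_outcome L \<gamma> x0 (\<lambda>t. B t \<omega>) \<epsilon>)
           (\<lambda>\<omega>. (B (ball_exit_time L (\<lambda>t. B t \<omega>)) \<omega>, ball_exit_time L (\<lambda>t. B t \<omega>)))
           (at_right 0)"
proof -
  interpret B: brownian_motion M B x0 by (rule B)
  \<comment> \<open>B starts at x0 only almost surely. The shift makes the start sure and keeps all
    increments, and the two paths agree entirely outside a null event.\<close>
  define B' where "B' t \<omega> = B t \<omega> - B 0 \<omega> + x0" for t \<omega>
  have incr: "B' t \<omega> - B' s \<omega> = B t \<omega> - B s \<omega>" for s t \<omega> by (simp add: B'_def)
  have meas [measurable]: "B t \<in> borel_measurable M" if "0 \<le> t" for t by (rule B.random_variable[OF that])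
  interpret B': brownian_walk M B' x0 L \<gamma>
  proof
    fix t :: real assume t: "0 \<le> t"
    show "B' t \<in> borel_measurable M" unfolding B'_def using meas[OF t] meas[of 0] by measurable
  next
    fix \<omega> assume "\<omega> \<in> space M"
    then show "continuous_on {0..} (\<lambda>t. B' t \<omega>)"
      unfolding B'_def by (intro continuous_intros B.continuous_paths)
  next
    fix t :: "nat \<Rightarrow> real" and n assume "0 \<le> t 0" "mono t"
    then show "B.indep_vars (\<lambda>_. borel) (\<lambda>i \<omega>. B' (t (Suc i)) \<omega> - B' (t i) \<omega>) {..<n}"
      unfolding incr by (rule B.independent_increments)
  next
    fix s t :: real assume "0 \<le> s" "s < t"
    then show "distributed M lborel (\<lambda>\<omega>. B' t \<omega> - B' s \<omega>)
        (\<lambda>x. ennreal (\<Prod>i\<in>UNIV. normal_density 0 (sqrt (t - s)) (x $ i)))"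
      unfolding incr by (rule B.gaussian_increments)
  qed (use \<gamma> x0 in \<open>auto simp: B'_def\<close>)
  \<comment> \<open>Almost sure equality with \<open>B'\<close> does not transfer measurability, as
    M need not be complete; it is therefore obtained for B itself.\<close>
  interpret P: continuous_process M B
    by unfold_locales (auto intro: B.random_variable B.continuous_paths)
  have eq: "AE \<omega> in M. (\<lambda>t. B t \<omega>) = (\<lambda>t. B' t \<omega>)"
    using B.start by eventually_elim (simp add: B'_def)
  have steps: "(\<integral>\<^sup>+\<omega>. ennreal_of_enat (wms_steps L \<gamma> x0 (\<lambda>t. B t \<omega>) \<epsilon>) \<partial>M)
      = (\<integral>\<^sup>+\<omega>. ennreal_of_enat (wms_steps L \<gamma> x0 (\<lambda>t. B' t \<omega>) \<epsilon>) \<partial>M)" for \<epsilon>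
    by (rule nn_integral_cong_AE) (use eq in eventually_elim, simp)
  have "AE \<omega> in M. ((\<lambda>\<epsilon>. wms_outcome L \<gamma> x0 (\<lambda>t. B t \<omega>) \<epsilon>) \<longlongrightarrow>
      (B (ball_exit_time L (\<lambda>t. B t \<omega>)) \<omega>, ball_exit_time L (\<lambda>t. B t \<omega>))) (at_right 0)"
    using eq B'.AE_outcome_tendsto
  proof eventually_elim
    case (elim \<omega>)
    then show ?case using fun_cong[OF elim(1)] by simp
  qed
  then have "converges_in_probability M (\<lambda>\<epsilon> \<omega>. wms_outcome L \<gamma> x0 (\<lambda>t. B t \<omega>) \<epsilon>)
           (\<lambda>\<omega>. (B (ball_exit_time L (\<lambda>t. B t \<omega>)) \<omega>, ball_exit_time L (\<lambda>t. B t \<omega>))) (at_right 0)"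
    by (intro B.converges_in_probability_of_AE P.measurable_wms_outcome P.measurable_exit_pair)
  then show ?thesis unfolding steps using B'.expected_steps by blast
qed

end
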